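(* Let $P$ be a finite poset, $K$ a finite simplicial complex, $\mathsf{F}:P\to\mathsf{SubCx}(K)$ a filtration, and $\rho\ge0$, $s\ge0$ integers. Let $M:=H_\rho(\mathsf{F})$ be the persistence module over $P$ obtained from $\mathsf{F}$ by applying the degree-$\rho$ homology functor (with coefficients in a field $\mathbb{k}$), and let $K_M$ be the kernel module of $M$. Then, for every $(b,d)\in\mathsf{Seg}(P)$ with $b<d$, $$H_s^\downarrow\mathsf{ZB}_\rho^{\mathsf{F}}((b,d))\cong H_s^\downarrow K_M((b,d)).$$
   Context: Segments: $\mathsf{Seg}(P)$ consists of all pairs $(b,d)$ with $b\le d$ in $P$ (including $(a,a)$) together with a pair $(a,\infty)$ for each $a\in P$. It is ordered by the product order $(b_1,d_1)\le_\times(b_2,d_2)\iff b_1\le b_2$ and $d_1\le d_2$, where $p<\infty$ for all $p\in P$. $\mathsf{Vec}$ is the category of finite-dimensional vector spaces over $\mathbb{k}$; a persistence module over a poset $P$ is a functor $P\to\mathsf{Vec}$. $C_\rho^K$ is the space of simplicial $\rho$-chains of $K$ over $\mathbb{k}$. For a subcomplex $L\subseteq K$, $\mathsf{Z}_\rho(L)$, $\mathsf{B}_\rho(L)$ are the $\rho$-cycles and $\rho$-boundaries of $L$, viewed as subspaces of $C_\rho^K$. $\mathsf{SubCx}(K)$ is the poset of subcomplexes of $K$ under inclusion; a filtration is an order-preserving map $\mathsf{F}:P\to\mathsf{SubCx}(K)$. Birth-death spaces: $\mathsf{ZB}_\rho^{\mathsf{F}}((b,d)) := \mathsf{Z}_\rho(\mathsf{F}(b))\cap\mathsf{B}_\rho(\mathsf{F}(d))$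 for $b\le d$ in $P$, $\mathsf{ZB}_\rho^{\mathsf{F}}((b,\infty)) := \mathsf{Z}_\rho(\mathsf{F}(b))$. With inclusions as structure maps, $\mathsf{ZB}_\rho^{\mathsf{F}}$ is a functor $(\mathsf{Seg}(P),\le_\times)\to\mathsf{Vec}$. Kernel module: for $M:P\to\mathsf{Vec}$, $K_M:(\mathsf{Seg}(P),\le_\times)\to\mathsf{Vec}$ assigns $\ker(M(p\le p'))$ to a segment $(p,p')$ with $p'\ne\infty$, and $M(p)$ to $(p,\infty)$; for $(p_1,p_2)\le_\times(p_3,p_4)$ the structure map is the restriction of $M(p_1\le p_3):M(p_1)\to M(p_3)$ to $K_M((p_1,p_2))\to K_M((p_3,p_4))$. Möbius homology of a functor $N:R\to\mathsf{Vec}$, $R$ a finite poset: the order complex $\Delta R$ has as $i$-simplices the chains $a_0<\cdots<a_i$ in $R$, faces being subchains. For $r\in R$ let $\Delta R_{\le r}$ (resp. $\Delta R_{<r}$) be the subcomplex of chains whose maximal element is $\le r$ (resp. $<r$). The order cosheaf $\underline{N}$ assigns to a simplex $\sigma$ the space $N(\min\sigma)$, and to a pair $\tau\ge\sigma$ ($\sigma$ a face of $\tau$) the map $N(\min\tau\le\min\sigma)$. For a subcomplex $L\subseteq\Delta R$, $C_s(L;\underline{N}) := \bigoplus_{\sigma\in L,\dim\sigma=s}\underline{N}(\sigma)$, with boundary operator $\partial_s$ sending $x\in\underline{N}(\tau)$, $\dim\tau=s$, to $\sum_{\sigma}[\tau:\sigma]\,\underline{N}(\tau\ge\sigma)(x)$,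 the sum being over the codimension-one faces $\sigma$ of $\tau$ and $[\tau:\sigma]=\pm1$ the usual incidence signs for a chosen orientation of $\Delta R$. Then $H_s^\downarrow N(r)$ is the $s$-th homology of the relative chain complex $C_\bullet(\Delta R_{\le r};\underline{N})/C_\bullet(\Delta R_{<r};\underline{N})$. Here $R=(\mathsf{Seg}(P),\le_\times)$. *)

theory Defs
  imports
    "HOL-Algebra.AbelCoset"
    "HOL-Library.Extended"
    "HOL-Library.Product_Order"
    "Jordan_Normal_Form.Missing_VectorSpace"
begin

text \<open>A vector space over the field \<open>k\<close> is a \<^typ>\<open>('k, 'v) module\<close> record \<open>V\<close> with
  \<^prop>\<open>vectorspace k V\<close>.  The fields \<^const>\<open>mult\<close> and \<^const>\<open>one\<close>, which such records
  inherit from rings, carry no information.\<close>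

definition isomorphic_spaces ::
    "('k, 'x) ring_scheme \<Rightarrow> ('k, 'v) module \<Rightarrow> ('k, 'w) module \<Rightarrow> bool" where
  "isomorphic_spaces k V W \<longleftrightarrow> (\<exists>h. linear_map k V W h \<and> bij_betw h (carrier V) (carrier W))"

definition self_space :: "('k, 'x) ring_scheme \<Rightarrow> ('k, 'k) module" where
  "self_space k = \<lparr>carrier = carrier k, mult = mult k, one = one k, zero = zero k,
     add = add k, smult = mult k\<rparr>"

text \<open>If \<open>A\<close> is a coset of a subspace which \<open>f\<close> maps into the subspace \<open>N\<close> of \<open>M\<close>, then
  \<open>f x + N\<close> is the same coset for all \<open>x \<in> A\<close>, so the union below is the image of \<open>A\<close> under
  the map induced by \<open>f\<close> on quotients.\<close>

definition induced_map ::
    "('k, 'w) module \<Rightarrow> 'w set \<Rightarrow> ('v \<Rightarrow> 'w) \<Rightarrow> 'v set \<Rightarrow> 'w set" where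
  "induced_map M N f A = (\<Union>x\<in>A. N +>\<^bsub>M\<^esub> f x)"

definition quotient_space :: "('k, 'v) module \<Rightarrow> 'v set \<Rightarrow> ('k, 'v set) module" where
  "quotient_space M N = \<lparr>carrier = a_rcosets\<^bsub>M\<^esub> N, mult = undefined, one = undefined, zero = N,
     add = (<+>\<^bsub>M\<^esub>), smult = (\<lambda>a. induced_map M N (\<lambda>x. a \<odot>\<^bsub>M\<^esub> x))\<rparr>"

record ('k, 'v) chain_complex =
  chain_space :: "int \<Rightarrow> ('k, 'v) module"
  differential :: "int \<Rightarrow> 'v \<Rightarrow> 'v"

definition cycles :: "('k, 'v) chain_complex \<Rightarrow> int \<Rightarrow> 'v set" where
  "cycles C i = {x \<in> carrier (chain_space C i).
     differential C i x = \<zero>\<^bsub>chain_space C (i - 1)\<^esub>}"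

definition boundaries :: "('k, 'v) chain_complex \<Rightarrow> int \<Rightarrow> 'v set" where
  "boundaries C i = differential C (i + 1) ` carrier (chain_space C (i + 1))"

definition homology :: "('k, 'v) chain_complex \<Rightarrow> int \<Rightarrow> ('k, 'v set) module" where
  "homology C i = quotient_space ((chain_space C i)\<lparr>carrier := cycles C i\<rparr>) (boundaries C i)"

definition quotient_complex ::
    "('k, 'v) chain_complex \<Rightarrow> ('k, 'v) chain_complex \<Rightarrow> ('k, 'v set) chain_complex" where
  "quotient_complex C D =
     \<lparr>chain_space = (\<lambda>i. quotient_space (chain_space C i) (carrier (chain_space D i))),
      differential = (\<lambda>i. induced_map (chain_space C (i - 1)) (carrier (chain_space D (i - 1)))
                             (differential C i))\<rparr>"

definition simplicial_complex :: "'a set set \<Rightarrow> bool" where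
  "simplicial_complex K \<longleftrightarrow>
     (\<forall>\<sigma>\<in>K. finite \<sigma> \<and> \<sigma> \<noteq> {} \<and> (\<forall>\<tau>. \<tau> \<subseteq> \<sigma> \<and> \<tau> \<noteq> {} \<longrightarrow> \<tau> \<in> K))"

definition subcomplexes :: "'a set set \<Rightarrow> 'a set set set" where
  "subcomplexes K = {L. L \<subseteq> K \<and> simplicial_complex L}"

text \<open>Since the empty set is never a simplex, there are no simplices of dimension \<open>-1\<close>.\<close>

definition simplices :: "'a set set \<Rightarrow> int \<Rightarrow> 'a set set" where
  "simplices K i = {\<sigma> \<in> K. int (card \<sigma>) = i + 1}"

text \<open>An orientation is given by a total order of the vertices of each simplex.  These orders
  are not required to be compatible with each other, so that all orientations arise.\<close>

definition orientation :: "'a set set \<Rightarrow> ('a set \<Rightarrow> 'a rel) \<Rightarrow> bool" where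
  "orientation K ori \<longleftrightarrow> (\<forall>\<sigma>\<in>K. linear_order_on \<sigma> (ori \<sigma>))"

text \<open>Let \<open>\<tau> = [v\<^sub>0, \<dots>, v\<^sub>s]\<close> as an oriented simplex and \<open>\<sigma> = \<tau> - {v\<^sub>j}\<close>.  The incidence number is
  \<open>(-1)^j\<close> times the sign of the permutation that takes the order \<open>v\<^sub>0, \<dots>, v\<^sub>s\<close> without \<open>v\<^sub>j\<close> to
  the order chosen for \<open>\<sigma>\<close>.  The first cardinality below is \<open>j\<close>, the second one is the number of
  inversions of this permutation.\<close>

definition incidence :: "('a set \<Rightarrow> 'a rel) \<Rightarrow> 'a set \<Rightarrow> 'a set \<Rightarrow> int" where
  "incidence ori \<tau> \<sigma> =
     (-1) ^ (card (ori \<tau> \<inter> \<sigma> \<times> (\<tau> - \<sigma>)) +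
             card {(u, v) \<in> \<sigma> \<times> \<sigma>. u \<noteq> v \<and> (u, v) \<in> ori \<tau> \<and> (v, u) \<in> ori \<sigma>})"

text \<open>For a face \<open>\<sigma>\<close> of \<open>\<tau>\<close>, the map from the stalk at \<open>\<tau>\<close> to the stalk at \<open>\<sigma>\<close> is
  \<open>extension A \<tau> \<sigma>\<close>.\<close>

record ('a, 'k, 'v) cosheaf =
  stalk :: "'a set \<Rightarrow> ('k, 'v) module"
  extension :: "'a set \<Rightarrow> 'a set \<Rightarrow> 'v \<Rightarrow> 'v"

definition constant_cosheaf :: "('k, 'x) ring_scheme \<Rightarrow> ('a, 'k, 'k) cosheaf" where
  "constant_cosheaf k = \<lparr>stalk = (\<lambda>_. self_space k), extension = (\<lambda>_ _ x. x)\<rparr>"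

text \<open>The direct sum of the stalks at the \<open>i\<close>-simplices; all complexes considered are finite, so
  it agrees with the direct product.\<close>

definition chain_module ::
    "'a set set \<Rightarrow> ('a, 'k, 'v) cosheaf \<Rightarrow> int \<Rightarrow> ('k, 'a set \<Rightarrow> 'v) module" where
  "chain_module K A i =
     \<lparr>carrier = (\<Pi>\<^sub>E \<sigma>\<in>simplices K i. carrier (stalk A \<sigma>)),
      mult = undefined, one = undefined,
      zero = (\<lambda>\<sigma>\<in>simplices K i. \<zero>\<^bsub>stalk A \<sigma>\<^esub>),
      add = (\<lambda>f g. \<lambda>\<sigma>\<in>simplices K i. f \<sigma> \<oplus>\<^bsub>stalk A \<sigma>\<^esub> g \<sigma>),
      smult = (\<lambda>a f. \<lambda>\<sigma>\<in>simplices K i. a \<odot>\<^bsub>stalk A \<sigma>\<^esub> f \<sigma>)\<rparr>"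

definition boundary_map ::
    "('a set \<Rightarrow> 'a rel) \<Rightarrow> 'a set set \<Rightarrow> ('a, 'k, 'v) cosheaf \<Rightarrow> int
      \<Rightarrow> ('a set \<Rightarrow> 'v) \<Rightarrow> ('a set \<Rightarrow> 'v)" where
  "boundary_map ori K A i f =
     (\<lambda>\<sigma>\<in>simplices K (i - 1). \<Oplus>\<^bsub>stalk A \<sigma>\<^esub>\<tau>\<in>{\<tau> \<in> simplices K i. \<sigma> \<subseteq> \<tau>}.
        [incidence ori \<tau> \<sigma>] \<cdot>\<^bsub>stalk A \<sigma>\<^esub> extension A \<tau> \<sigma> (f \<tau>))"

text \<open>The chains of a subcomplex \<open>L\<close> are viewed as chains of \<open>K\<close> which vanish outside \<open>L\<close>.\<close>

definition chains_on ::
    "('a set \<Rightarrow> 'a rel) \<Rightarrow> 'a set set \<Rightarrow> ('a, 'k, 'v) cosheaf \<Rightarrow> 'a set set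
      \<Rightarrow> ('k, 'a set \<Rightarrow> 'v) chain_complex" where
  "chains_on ori K A L =
     \<lparr>chain_space = (\<lambda>i. (chain_module K A i)
        \<lparr>carrier := {f \<in> carrier (chain_module K A i).
                       \<forall>\<sigma>\<in>simplices K i - L. f \<sigma> = \<zero>\<^bsub>stalk A \<sigma>\<^esub>}\<rparr>),
      differential = boundary_map ori K A\<rparr>"

abbreviation simplicial_chains ::
    "('k, 'x) ring_scheme \<Rightarrow> ('a set \<Rightarrow> 'a rel) \<Rightarrow> 'a set set \<Rightarrow> 'a set set
      \<Rightarrow> ('k, 'a set \<Rightarrow> 'k) chain_complex" where
  "simplicial_chains k ori K L \<equiv> chains_on ori K (constant_cosheaf k) L"

text \<open>\<open>transition M p p'\<close> is the structure map \<open>M(p \<le> p')\<close>; it is irrelevant unless \<open>p \<le> p'\<close>.\<close>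

record ('p, 'k, 'v) poset_module =
  space :: "'p \<Rightarrow> ('k, 'v) module"
  transition :: "'p \<Rightarrow> 'p \<Rightarrow> 'v \<Rightarrow> 'v"

definition segments :: "'p::order set \<Rightarrow> ('p \<times> 'p extended) set" where
  "segments P = {(b, Fin d) | b d. b \<in> P \<and> d \<in> P \<and> b \<le> d} \<union> {(a, \<infinity>) | a. a \<in> P}"

definition homology_module ::
    "('k, 'x) ring_scheme \<Rightarrow> ('a set \<Rightarrow> 'a rel) \<Rightarrow> 'a set set \<Rightarrow> ('p \<Rightarrow> 'a set set) \<Rightarrow> int
      \<Rightarrow> ('p, 'k, ('a set \<Rightarrow> 'k) set) poset_module" where
  "homology_module k ori K F \<rho> =
     \<lparr>space = (\<lambda>p. homology (simplicial_chains k ori K (F p)) \<rho>),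
      transition = (\<lambda>p p'. induced_map (chain_space (simplicial_chains k ori K (F p')) \<rho>)
                             (boundaries (simplicial_chains k ori K (F p')) \<rho>) (\<lambda>x. x))\<rparr>"

definition birth_death_module ::
    "('k, 'x) ring_scheme \<Rightarrow> ('a set \<Rightarrow> 'a rel) \<Rightarrow> 'a set set \<Rightarrow> ('p \<Rightarrow> 'a set set) \<Rightarrow> int
      \<Rightarrow> ('p \<times> 'p extended, 'k, 'a set \<Rightarrow> 'k) poset_module" where
  "birth_death_module k ori K F \<rho> =
     \<lparr>space = (\<lambda>(b, d). (chain_module K (constant_cosheaf k) \<rho>)
        \<lparr>carrier := (case d of
             Fin d' \<Rightarrow> cycles (simplicial_chains k ori K (F b)) \<rho>
                        \<inter> boundaries (simplicial_chains k ori K (F d')) \<rho>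
           | _ \<Rightarrow> cycles (simplicial_chains k ori K (F b)) \<rho>)\<rparr>),
      transition = (\<lambda>_ _ x. x)\<rparr>"

definition kernel_module ::
    "('p, 'k, 'v) poset_module \<Rightarrow> ('p \<times> 'p extended, 'k, 'v) poset_module" where
  "kernel_module M =
     \<lparr>space = (\<lambda>(p, q). case q of
         Fin p' \<Rightarrow> (space M p)\<lparr>carrier :=
                     {x \<in> carrier (space M p). transition M p p' x = \<zero>\<^bsub>space M p'\<^esub>}\<rparr>
       | _ \<Rightarrow> space M p),
      transition = (\<lambda>(p\<^sub>1, _) (p\<^sub>3, _). transition M p\<^sub>1 p\<^sub>3)\<rparr>"

definition order_complex :: "'r::order set \<Rightarrow> 'r set set" where
  "order_complex R =
     {\<sigma>. \<sigma> \<subseteq> R \<and> finite \<sigma> \<and> \<sigma> \<noteq> {} \<and> Complete_Partial_Order.chain (\<le>) \<sigma>}"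

abbreviation chain_min :: "'r::order set \<Rightarrow> 'r" where
  "chain_min \<sigma> \<equiv> (LEAST x. x \<in> \<sigma>)"

abbreviation chain_max :: "'r::order set \<Rightarrow> 'r" where
  "chain_max \<sigma> \<equiv> (GREATEST x. x \<in> \<sigma>)"

definition order_cosheaf ::
    "('r::order, 'k, 'v) poset_module \<Rightarrow> ('r, 'k, 'v) cosheaf" where
  "order_cosheaf N =
     \<lparr>stalk = (\<lambda>\<sigma>. space N (chain_min \<sigma>)),
      extension = (\<lambda>\<tau> \<sigma>. transition N (chain_min \<tau>) (chain_min \<sigma>))\<rparr>"

definition moebius_homology ::
    "('r::order set \<Rightarrow> 'r rel) \<Rightarrow> 'r set \<Rightarrow> ('r, 'k, 'v) poset_module \<Rightarrow> int \<Rightarrow> 'r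
      \<Rightarrow> ('k, ('r set \<Rightarrow> 'v) set set) module" where
  "moebius_homology ori R N s r =
     homology
       (quotient_complex
         (chains_on ori (order_complex R) (order_cosheaf N)
            {\<sigma> \<in> order_complex R. chain_max \<sigma> \<le> r})
         (chains_on ori (order_complex R) (order_cosheaf N)
            {\<sigma> \<in> order_complex R. chain_max \<sigma> < r})) s"

end

theory Submission
  imports Defs
begin

text \<open>For a segment \<open>(p, q)\<close>, the kernel of the map from the homology of \<open>F p\<close> to that of \<open>F q\<close> is the
quotient of the birth-death space at \<open>(p, q)\<close> by the space of boundaries of \<open>F p\<close>; for \<open>q = \<infinity>\<close> the
birth-death space consists of all cycles and the quotient is the whole homology.  So there is a
short exact sequence of functors on the segments, from the functor \<open>B\<close> that sends \<open>(p, q)\<close> to the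
boundaries of \<open>F p\<close>, through the birth-death functor, to the kernel module.  It induces a short exact
sequence of the relative chain complexes that compute Moebius homology, and the theorem follows once
the one for \<open>B\<close> is shown to be acyclic at \<open>(b, d)\<close>.

The reason for the acyclicity is that \<open>B\<close> does not see the second endpoint: it takes the same value
at a segment \<open>a = (p, q)\<close> and at the diagonal segment \<open>g a = (p, p)\<close> below it.  The relative complex
is spanned by the chains with maximum \<open>(b, d)\<close>, which is not diagonal since \<open>b < d\<close>.  So every such
chain has a least member \<open>m\<close> that is not diagonal, and inserting \<open>g m\<close> into the chain or deleting it
pairs the chains off without changing their coefficient spaces.  This matching becomes an induction
on the number of non-diagonal members in \<open>relative_cycle_bounds\<close>, with the conclusion stated as
\<open>coefficients_acyclic\<close>.

All spaces that occur are described as images of linear maps from a subspace \<open>Z\<close> of one ambient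
space, with kernel \<open>N\<close> (locale \<open>subquotient\<close>).  Subspaces, quotients and homology of such spaces are
again of this form, and for both functors the ambient complex is the complex of chains of segments
with coefficients in the simplicial chains of \<open>K\<close>, where all structure maps are inclusions.  Thus
iterated quotients such as the homology of a quotient complex with coefficients in homology
classes can be traced back to conditions on honest chains (\<open>homology_subquotient\<close>,
\<open>relative_homology_subquotient\<close>), and the long exact sequence is replaced by the second isomorphism
theorem (\<open>isomorphic_subquotients\<close>, applied in \<open>relative_homology_isomorphic\<close>).\<close>

section \<open>Subquotients of a vector space\<close>

lemma subspaceI:
  assumes "vectorspace k V" "S \<subseteq> carrier V" "\<zero>\<^bsub>V\<^esub> \<in> S"
    and "\<And>x y. x \<in> S \<Longrightarrow> y \<in> S \<Longrightarrow> x \<oplus>\<^bsub>V\<^esub> y \<in> S"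
    and "\<And>a x. a \<in> carrier k \<Longrightarrow> x \<in> S \<Longrightarrow> a \<odot>\<^bsub>V\<^esub> x \<in> S"
  shows "subspace k S V"
  using assms by (simp add: subspace_def submodule_def vectorspace_def)

lemma subspaceD:
  assumes "subspace k S V"
  shows "vectorspace k V" "S \<subseteq> carrier V" "\<zero>\<^bsub>V\<^esub> \<in> S"
    and "\<And>x y. x \<in> S \<Longrightarrow> y \<in> S \<Longrightarrow> x \<oplus>\<^bsub>V\<^esub> y \<in> S"
    and "\<And>a x. a \<in> carrier k \<Longrightarrow> x \<in> S \<Longrightarrow> a \<odot>\<^bsub>V\<^esub> x \<in> S"
    and "\<And>x. x \<in> S \<Longrightarrow> \<ominus>\<^bsub>V\<^esub> x \<in> S"
    and "\<And>x y. x \<in> S \<Longrightarrow> y \<in> S \<Longrightarrow> x \<ominus>\<^bsub>V\<^esub> y \<in> S"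
proof -
  interpret subspace k S V by fact
  interpret vectorspace k V by (rule vs)
  interpret submodule k S V by (rule submod)
  show "vectorspace k V" by (rule vs)
  show "S \<subseteq> carrier V" by (rule subset)
  show "\<zero>\<^bsub>V\<^esub> \<in> S" by simp
  show "\<And>x y. x \<in> S \<Longrightarrow> y \<in> S \<Longrightarrow> x \<oplus>\<^bsub>V\<^esub> y \<in> S" by simp
  show "\<And>a x. a \<in> carrier k \<Longrightarrow> x \<in> S \<Longrightarrow> a \<odot>\<^bsub>V\<^esub> x \<in> S" by simp
  show neg: "\<ominus>\<^bsub>V\<^esub> x \<in> S" if "x \<in> S" for x
  proof -
    have "(\<ominus>\<^bsub>k\<^esub> \<one>\<^bsub>k\<^esub>) \<odot>\<^bsub>V\<^esub> x \<in> S" using that by simp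
    moreover have "x \<in> carrier V" using that subset by blast
    ultimately show ?thesis by (simp add: smult_minus_1)
  qed
  show "\<And>x y. x \<in> S \<Longrightarrow> y \<in> S \<Longrightarrow> x \<ominus>\<^bsub>V\<^esub> y \<in> S"
    by (simp add: a_minus_def neg)
qed

lemma subspace_zero: "vectorspace k V \<Longrightarrow> subspace k {\<zero>\<^bsub>V\<^esub>} V"
proof -
  assume "vectorspace k V"
  then interpret vectorspace k V .
  show ?thesis by (rule subspaceI) (auto intro: vectorspace_axioms)
qed

lemma subspace_finsum:
  assumes "subspace k S V" "finite A" "\<And>a. a \<in> A \<Longrightarrow> f a \<in> S"
  shows "finsum V f A \<in> S"
proof -
  interpret vectorspace k V by (rule subspaceD(1)[OF assms(1)])
  have S: "S \<subseteq> carrier V" by (rule subspaceD(2)[OF assms(1)])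
  show ?thesis using assms(2,3)
  proof (induction A)
    case empty
    show ?case using subspaceD(3)[OF assms(1)] by simp
  next
    case (insert a A)
    have "finsum V f (insert a A) = f a \<oplus>\<^bsub>V\<^esub> finsum V f A"
      using insert S by (intro finsum_insert) auto
    then show ?case using insert subspaceD(4)[OF assms(1)] by simp
  qed
qed

lemma subspace_Int:
  assumes "subspace k S V" "subspace k T V"
  shows "subspace k (S \<inter> T) V"
  using subspaceD[OF assms(1)] subspaceD[OF assms(2)] by (intro subspaceI) auto

lemma subspace_abelian_subgroup:
  assumes "subspace k T W"
  shows "abelian_subgroup T W"
proof -
  note T = subspaceD[OF assms]
  interpret W: vectorspace k W by (rule T(1))
  have "additive_subgroup T W"
    unfolding additive_subgroup_def by (rule W.add.subgroupI) (use T in \<open>auto simp: a_inv_def\<close>)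
  then show ?thesis using W.abelian_group_axioms by (rule abelian_subgroupI3)
qed

text \<open>This covers scalar multiplication on a quotient as well as the maps that chain maps and
differentials induce; additivity is only asked for at translates of the given point by elements of
the subspace.\<close>

lemma induced_map_coset:
  assumes "subspace k T L" "subspace k S M" and x: "x \<in> carrier L"
    and f: "f x \<in> carrier M" "\<And>t. t \<in> T \<Longrightarrow> f t \<in> S" "\<And>t. t \<in> T \<Longrightarrow> f (t \<oplus>\<^bsub>L\<^esub> x) = f t \<oplus>\<^bsub>M\<^esub> f x"
  shows "induced_map M S f (T +>\<^bsub>L\<^esub> x) = S +>\<^bsub>M\<^esub> f x"
proof -
  interpret T: abelian_subgroup T L by (rule subspace_abelian_subgroup[OF assms(1)])
  interpret S: abelian_subgroup S M by (rule subspace_abelian_subgroup[OF assms(2)])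
  have "S +>\<^bsub>M\<^esub> f y = S +>\<^bsub>M\<^esub> f x" if y: "y \<in> T +>\<^bsub>L\<^esub> x" for y
  proof -
    from y obtain t where t: "t \<in> T" "y = t \<oplus>\<^bsub>L\<^esub> x" by (auto simp: a_r_coset_def')
    then have "f y \<in> S +>\<^bsub>M\<^esub> f x" using f(2,3) by (auto simp: a_r_coset_def')
    then show ?thesis using S.a_repr_independence' f(1) by simp
  qed
  moreover have "x \<in> T +>\<^bsub>L\<^esub> x" using x by (rule T.a_rcos_self)
  ultimately show ?thesis unfolding induced_map_def by blast
qed

text \<open>The space \<open>W\<close> is \<open>Z / N\<close> up to the isomorphism induced by \<open>q\<close>.  That \<open>W\<close> is a vector space and \<open>N\<close> a
subspace follows by transport along the surjection \<open>q\<close>, which saves checking the vector space axioms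
for nested coset constructions.\<close>

locale subquotient =
  fixes k :: "('k, 'x) ring_scheme"
    and V :: "('k, 'v) module" and Z N :: "'v set"
    and W :: "('k, 'w) module" and q :: "'v \<Rightarrow> 'w"
  assumes subspace_Z: "subspace k Z V"
    and N_subset: "N \<subseteq> Z"
    and image: "q ` Z = carrier W"
    and add: "\<And>x y. x \<in> Z \<Longrightarrow> y \<in> Z \<Longrightarrow> q (x \<oplus>\<^bsub>V\<^esub> y) = q x \<oplus>\<^bsub>W\<^esub> q y"
    and smult: "\<And>a x. a \<in> carrier k \<Longrightarrow> x \<in> Z \<Longrightarrow> q (a \<odot>\<^bsub>V\<^esub> x) = a \<odot>\<^bsub>W\<^esub> q x"
    and zero_iff: "\<And>x. x \<in> Z \<Longrightarrow> q x = \<zero>\<^bsub>W\<^esub> \<longleftrightarrow> x \<in> N"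
    and zero_N: "\<zero>\<^bsub>V\<^esub> \<in> N"
begin

lemmas Z = subspaceD[OF subspace_Z]

sublocale V: vectorspace k V by (rule Z(1))

lemma Z_carrier: "x \<in> Z \<Longrightarrow> x \<in> carrier V"
  using Z(2) by blast

lemma zero: "q \<zero>\<^bsub>V\<^esub> = \<zero>\<^bsub>W\<^esub>"
  using zero_iff Z(3) zero_N by blast

lemma closed: "x \<in> Z \<Longrightarrow> q x \<in> carrier W"
  using image by blast

lemma lift: 
  assumes "y \<in> carrier W"
  obtains x where "x \<in> Z" "q x = y"
  using assms unfolding image[symmetric] by (auto elim: imageE)

lemma vectorspace_image: "vectorspace k W"
proof (rule vs_criteria)
  show "field k" ..
  show "\<zero>\<^bsub>W\<^esub> \<in> carrier W" using closed[OF Z(3)] zero by simp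
  show "\<forall>v w. v \<in> carrier W \<and> w \<in> carrier W \<longrightarrow> v \<oplus>\<^bsub>W\<^esub> w \<in> carrier W"
    by (safe elim!: lift) (metis add closed Z(4))
  show "\<forall>v\<in>carrier W. \<exists>neg_v\<in>carrier W. v \<oplus>\<^bsub>W\<^esub> neg_v = \<zero>\<^bsub>W\<^esub>"
    by (safe elim!: lift) (metis add closed Z(6) V.r_neg zero Z_carrier)
  show "\<forall>c v. c \<in> carrier k \<and> v \<in> carrier W \<longrightarrow> c \<odot>\<^bsub>W\<^esub> v \<in> carrier W"
    by (safe elim!: lift) (metis smult closed Z(5))
  show "\<forall>v w. v \<in> carrier W \<and> w \<in> carrier W \<longrightarrow> v \<oplus>\<^bsub>W\<^esub> w = w \<oplus>\<^bsub>W\<^esub> v"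
    by (safe elim!: lift) (metis add V.a_comm Z_carrier)
  show "\<forall>v w x. v \<in> carrier W \<and> w \<in> carrier W \<and> x \<in> carrier W \<longrightarrow>
      v \<oplus>\<^bsub>W\<^esub> w \<oplus>\<^bsub>W\<^esub> x = v \<oplus>\<^bsub>W\<^esub> (w \<oplus>\<^bsub>W\<^esub> x)"
    by (safe elim!: lift) (metis add V.a_assoc Z_carrier Z(4))
  show "\<forall>v\<in>carrier W. v \<oplus>\<^bsub>W\<^esub> \<zero>\<^bsub>W\<^esub> = v"
    by (safe elim!: lift) (metis add zero V.r_zero Z_carrier Z(3))
  show "\<forall>a b v. a \<in> carrier k \<and> b \<in> carrier k \<and> v \<in> carrier W \<longrightarrow>
      (a \<otimes>\<^bsub>k\<^esub> b) \<odot>\<^bsub>W\<^esub> v = a \<odot>\<^bsub>W\<^esub> (b \<odot>\<^bsub>W\<^esub> v)"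
    by (safe elim!: lift) (metis smult V.smult_assoc1 V.R.m_closed Z_carrier Z(5))
  show "\<forall>v\<in>carrier W. \<one>\<^bsub>k\<^esub> \<odot>\<^bsub>W\<^esub> v = v"
    by (safe elim!: lift) (metis smult V.smult_one V.R.one_closed Z_carrier)
  show "\<forall>a b v. a \<in> carrier k \<and> b \<in> carrier k \<and> v \<in> carrier W \<longrightarrow>
      (a \<oplus>\<^bsub>k\<^esub> b) \<odot>\<^bsub>W\<^esub> v = a \<odot>\<^bsub>W\<^esub> v \<oplus>\<^bsub>W\<^esub> b \<odot>\<^bsub>W\<^esub> v"
    by (safe elim!: lift) (metis add smult V.smult_l_distr V.R.a_closed Z_carrier Z(5))
  show "\<forall>a v w. a \<in> carrier k \<and> v \<in> carrier W \<and> w \<in> carrier W \<longrightarrow>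
      a \<odot>\<^bsub>W\<^esub> (v \<oplus>\<^bsub>W\<^esub> w) = a \<odot>\<^bsub>W\<^esub> v \<oplus>\<^bsub>W\<^esub> a \<odot>\<^bsub>W\<^esub> w"
    by (safe elim!: lift) (metis add smult V.smult_r_distr Z_carrier Z(4,5))
qed

sublocale W: vectorspace k W by (rule vectorspace_image)

lemma uminus:
  assumes "x \<in> Z"
  shows "q (\<ominus>\<^bsub>V\<^esub> x) = \<ominus>\<^bsub>W\<^esub> q x"
proof -
  have "q ((\<ominus>\<^bsub>k\<^esub> \<one>\<^bsub>k\<^esub>) \<odot>\<^bsub>V\<^esub> x) = (\<ominus>\<^bsub>k\<^esub> \<one>\<^bsub>k\<^esub>) \<odot>\<^bsub>W\<^esub> q x"
    by (rule smult[OF V.R.a_inv_closed[OF V.R.one_closed] assms])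
  then show ?thesis
    unfolding V.smult_minus_1[OF Z_carrier[OF assms]] W.smult_minus_1[OF closed[OF assms]] .
qed

lemma diff: "x \<in> Z \<Longrightarrow> y \<in> Z \<Longrightarrow> q (x \<ominus>\<^bsub>V\<^esub> y) = q x \<ominus>\<^bsub>W\<^esub> q y"
  by (simp only: a_minus_def add uminus Z(6))

lemma eq_iff: "x \<in> Z \<Longrightarrow> y \<in> Z \<Longrightarrow> q x = q y \<longleftrightarrow> x \<ominus>\<^bsub>V\<^esub> y \<in> N"
  unfolding zero_iff[OF Z(7), symmetric] diff using closed by (metis W.minus_other_side)

lemma subspace_preimage:
  assumes "subspace k T W"
  shows "subspace k {x \<in> Z. q x \<in> T} V"
proof (rule subspaceI)
  note T = subspaceD[OF assms]
  show "vectorspace k V" ..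
  show "{x \<in> Z. q x \<in> T} \<subseteq> carrier V" using Z(2) by blast
  show "\<zero>\<^bsub>V\<^esub> \<in> {x \<in> Z. q x \<in> T}" using T(3) Z(3) zero by simp
qed (use subspaceD[OF assms] Z add smult in auto)

lemma subspace_N: "subspace k N V"
proof -
  have "N = {x \<in> Z. q x \<in> {\<zero>\<^bsub>W\<^esub>}}" using zero_iff N_subset by auto
  then show ?thesis
    using subspace_preimage[OF subspace_zero[OF vectorspace_image]] by simp
qed

lemma finsum:
  assumes "finite A" "\<And>a. a \<in> A \<Longrightarrow> f a \<in> Z"
  shows "q (finsum V f A) = finsum W (\<lambda>a. q (f a)) A"
  using assms
proof (induction A)
  case empty
  show ?case using zero by simp
next
  case (insert a A)
  have "finsum V f (insert a A) = f a \<oplus>\<^bsub>V\<^esub> finsum V f A"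
    using insert Z_carrier by (intro V.finsum_insert) auto
  moreover have "finsum W (\<lambda>a. q (f a)) (insert a A) = q (f a) \<oplus>\<^bsub>W\<^esub> finsum W (\<lambda>a. q (f a)) A"
    using insert closed by (intro W.finsum_insert) auto
  moreover have "finsum V f A \<in> Z"
    using insert by (intro subspace_finsum[OF subspace_Z]) auto
  ultimately show ?case using insert by (simp add: add)
qed

lemma subquotient_subspace:
  assumes "subspace k T W"
  shows "subquotient k V {x \<in> Z. q x \<in> T} N (W\<lparr>carrier := T\<rparr>) q"
proof (rule subquotient.intro)
  note T = subspaceD[OF assms]
  show "subspace k {x \<in> Z. q x \<in> T} V" by (rule subspace_preimage[OF assms])
  show "N \<subseteq> {x \<in> Z. q x \<in> T}" using zero_iff N_subset T(3) by fastforce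
  show "q ` {x \<in> Z. q x \<in> T} = carrier (W\<lparr>carrier := T\<rparr>)"
    using T(2) unfolding image[symmetric] by auto
  show "\<zero>\<^bsub>V\<^esub> \<in> N" by (rule zero_N)
qed (use add smult zero_iff in auto)

lemma subquotient_restrict:
  assumes "subspace k X V" "N \<subseteq> X" "X \<subseteq> Z"
  shows "subquotient k V X N (W\<lparr>carrier := q ` X\<rparr>) q"
  using assms add smult zero_iff zero_N by (intro subquotient.intro) (auto simp: subset_iff)

lemma subquotient_quotient:
  assumes "subspace k T W"
  shows "subquotient k V Z {x \<in> Z. q x \<in> T} (quotient_space W T) (\<lambda>x. T +>\<^bsub>W\<^esub> q x)"
proof -
  note T = subspaceD[OF assms]
  interpret T: abelian_subgroup T W by (rule subspace_abelian_subgroup[OF assms])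
  have coset_smult: "induced_map W T (\<lambda>x. a \<odot>\<^bsub>W\<^esub> x) (T +>\<^bsub>W\<^esub> y) = T +>\<^bsub>W\<^esub> (a \<odot>\<^bsub>W\<^esub> y)"
    if a: "a \<in> carrier k" and y: "y \<in> carrier W" for a y
  proof (rule induced_map_coset[OF assms assms y])
    show "a \<odot>\<^bsub>W\<^esub> y \<in> carrier W" using a y by (rule W.smult_closed)
    fix t assume t: "t \<in> T"
    then show "a \<odot>\<^bsub>W\<^esub> t \<in> T" by (rule T(5)[OF a])
    have "t \<in> carrier W" using T(2) t by blast
    then show "a \<odot>\<^bsub>W\<^esub> (t \<oplus>\<^bsub>W\<^esub> y) = a \<odot>\<^bsub>W\<^esub> t \<oplus>\<^bsub>W\<^esub> a \<odot>\<^bsub>W\<^esub> y"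
      using a y by (intro W.smult_r_distr)
  qed
  show ?thesis
  proof (rule subquotient.intro)
    show "subspace k Z V" by (rule subspace_Z)
    show "(\<lambda>x. T +>\<^bsub>W\<^esub> q x) ` Z = carrier (quotient_space W T)"
      unfolding quotient_space_def by (auto simp: A_RCOSETS_def' simp flip: image)
    show "T +>\<^bsub>W\<^esub> q (x \<oplus>\<^bsub>V\<^esub> y) = (T +>\<^bsub>W\<^esub> q x) \<oplus>\<^bsub>quotient_space W T\<^esub> (T +>\<^bsub>W\<^esub> q y)"
      if "x \<in> Z" "y \<in> Z" for x y
      using that closed by (simp add: quotient_space_def T.a_rcos_sum add)
    show "T +>\<^bsub>W\<^esub> q (a \<odot>\<^bsub>V\<^esub> x) = a \<odot>\<^bsub>quotient_space W T\<^esub> (T +>\<^bsub>W\<^esub> q x)"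
      if "a \<in> carrier k" "x \<in> Z" for a x
      using that closed by (simp add: quotient_space_def coset_smult smult)
    show "T +>\<^bsub>W\<^esub> q x = \<zero>\<^bsub>quotient_space W T\<^esub> \<longleftrightarrow> x \<in> {x \<in> Z. q x \<in> T}" if "x \<in> Z" for x
      using that closed[OF that] T.a_rcos_const T.a_rcos_self[of "q x"] by (auto simp: quotient_space_def)
    show "\<zero>\<^bsub>V\<^esub> \<in> {x \<in> Z. q x \<in> T}" using Z(3) zero T(3) by simp
  qed auto
qed

end

lemma subquotient_cong:
  assumes "subquotient k V Z N W q" and eq: "\<And>x. x \<in> Z \<Longrightarrow> q' x = q x"
  shows "subquotient k V Z N W q'"
proof -
  interpret S: subquotient k V Z N W q by fact
  show ?thesis
  proof (rule subquotient.intro)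
    show "q' ` Z = carrier W" unfolding S.image[symmetric] using eq by (rule image_cong[OF refl])
  qed (use S.subspace_Z S.N_subset S.zero_N S.zero_iff S.add S.smult S.Z(4,5) eq in auto)
qed

lemma subquotient_self:
  assumes "subspace k S V"
  shows "subquotient k V S {\<zero>\<^bsub>V\<^esub>} (V\<lparr>carrier := S\<rparr>) (\<lambda>x. x)"
  using assms subspaceD(3)[OF assms] by (intro subquotient.intro) auto

text \<open>The second isomorphism theorem \<open>Z / (Z \<inter> N') \<cong> (Z + N') / N'\<close>, with \<open>Z' = Z + N'\<close>.\<close>

lemma isomorphic_subquotients:
  assumes "subquotient k V Z N W q" and "subquotient k V Z' N' W' q'"
    and ZZ': "Z \<subseteq> Z'" and N: "N = Z \<inter> N'"
    and sum: "\<And>z. z \<in> Z' \<Longrightarrow> \<exists>x\<in>Z. z \<ominus>\<^bsub>V\<^esub> x \<in> N'"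
  shows "isomorphic_spaces k W W'"
proof -
  interpret S: subquotient k V Z N W q by fact
  interpret S': subquotient k V Z' N' W' q' by fact
  define h where "h w = q' (inv_into Z q w)" for w
  have h: "h (q x) = q' x" if x: "x \<in> Z" for x
  proof -
    let ?y = "inv_into Z q (q x)"
    have y: "?y \<in> Z" "q ?y = q x" using x by (auto intro: inv_into_into f_inv_into_f)
    then have "?y \<ominus>\<^bsub>V\<^esub> x \<in> N'" using S.eq_iff x N by blast
    then show ?thesis unfolding h_def using S'.eq_iff x y ZZ' by blast
  qed
  have "linear_map k W W' h"
  proof
    show "h \<in> module_hom k W W'"
      unfolding module_hom_def S.image[symmetric]
      using S'.closed ZZ' S.Z S'.add S'.smult
      by (auto simp: h subset_iff simp flip: S.add S.smult)
  qed
  moreover have "bij_betw h (carrier W) (carrier W')"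
    unfolding bij_betw_def
  proof
    show "inj_on h (carrier W)"
    proof (rule inj_onI)
      fix v w assume "v \<in> carrier W" "w \<in> carrier W" "h v = h w"
      then obtain x y where xy: "x \<in> Z" "q x = v" "y \<in> Z" "q y = w"
        by (auto elim!: S.lift)
      then have "q' x = q' y" using h \<open>h v = h w\<close> by auto
      then have "x \<ominus>\<^bsub>V\<^esub> y \<in> N'" using S'.eq_iff xy ZZ' by blast
      then show "v = w" using S.eq_iff[of x y] S.Z(7)[of x y] xy N by auto
    qed
    show "h ` carrier W = carrier W'"
    proof
      show "h ` carrier W \<subseteq> carrier W'"
        unfolding S.image[symmetric] using h S'.closed ZZ' by auto
      show "carrier W' \<subseteq> h ` carrier W"
      proof
        fix w assume "w \<in> carrier W'"
        then obtain z where z: "z \<in> Z'" "q' z = w" by (rule S'.lift)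
        then obtain x where x: "x \<in> Z" "z \<ominus>\<^bsub>V\<^esub> x \<in> N'" using sum by blast
        then have "q' z = q' x" using z S'.eq_iff[of z x] ZZ' by blast
        then have "h (q x) = w" "q x \<in> carrier W" using x z h S.closed by auto
        then show "w \<in> h ` carrier W" by blast
      qed
    qed
  qed
  ultimately show ?thesis unfolding isomorphic_spaces_def by blast
qed

section \<open>Incidence numbers\<close>

text \<open>The pairs that two linear orders list in opposite ways.  If \<open>r\<close> and \<open>r'\<close> order \<open>S\<close> linearly, their
number has the parity of the permutation which turns one order into the other.\<close>

definition inversions :: "'a set \<Rightarrow> 'a rel \<Rightarrow> 'a rel \<Rightarrow> 'a rel" where
  "inversions S r r' = {(u, v) \<in> S \<times> S. u \<noteq> v \<and> (u, v) \<in> r \<and> (v, u) \<in> r'}"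

lemma linear_order_onD:
  assumes "linear_order_on S r" "u \<in> S" "v \<in> S"
  shows "u \<noteq> v \<Longrightarrow> (u, v) \<in> r \<longleftrightarrow> (v, u) \<notin> r"
  using assms by (auto simp: order_on_defs total_on_def antisym_def)

lemma finite_inversions: "finite S \<Longrightarrow> finite (inversions S r r')"
  by (rule finite_subset[of _ "S \<times> S"]) (auto simp: inversions_def)

text \<open>The sign of a composition of permutations is the product of the signs: a pair is reversed between
\<open>r'\<close> and \<open>r''\<close> iff it is reversed in exactly one of the steps from \<open>r\<close> to \<open>r'\<close> and from \<open>r\<close> to
\<open>r''\<close>, so the sum counts every pair an even number of times.\<close>

lemma even_card_inversions:
  assumes fin: "finite S" and "linear_order_on A r" "linear_order_on B r'" "linear_order_on C r''"
    and "S \<subseteq> A" "S \<subseteq> B" "S \<subseteq> C"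
  shows "even (card (inversions S r r') + card (inversions S r' r'') + card (inversions S r r''))"
proof -
  let ?A = "inversions S r r'" and ?B = "inversions S r r''"
  have total: "(u, v) \<in> r \<longleftrightarrow> (v, u) \<notin> r" "(u, v) \<in> r' \<longleftrightarrow> (v, u) \<notin> r'"
    "(u, v) \<in> r'' \<longleftrightarrow> (v, u) \<notin> r''"
    if "u \<in> S" "v \<in> S" "u \<noteq> v" for u v
    using linear_order_onD[OF assms(2), of u v] linear_order_onD[OF assms(3), of u v]
      linear_order_onD[OF assms(4), of u v] that assms(5-7) by auto
  have finAB: "finite ?A" "finite ?B" by (simp_all add: finite_inversions fin)
  have "(x \<in> inversions S r' r'') = (x \<in> (?B - ?A) \<union> (?A - ?B)\<inverse>)" for x
  proof (cases x)
    case (Pair u v)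
    show ?thesis
    proof (cases "u \<in> S \<and> v \<in> S \<and> u \<noteq> v")
      case True
      then show ?thesis using total[of u v] unfolding Pair inversions_def by auto
    qed (auto simp: Pair inversions_def)
  qed
  then have "inversions S r' r'' = (?B - ?A) \<union> (?A - ?B)\<inverse>" by blast
  moreover have "(?B - ?A) \<inter> (?A - ?B)\<inverse> = {}"
  proof -
    have "(v, u) \<notin> ?A" if "(u, v) \<in> ?B" for u v
      using that total[of u v] by (auto simp: inversions_def)
    then show ?thesis by blast
  qed
  ultimately have "card (inversions S r' r'') = card (?B - ?A) + card (?A - ?B)"
    using finAB by (simp add: card_Un_disjoint)
  moreover have "card ?A = card (?A - ?B) + card (?A \<inter> ?B)"
    using finAB by (metis Diff_Diff_Int Diff_subset card_Diff_subset_Int card_mono finite_Diff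
        finite_Int le_add_diff_inverse2 inf_commute inf_le1 add.commute)
  moreover have "card ?B = card (?B - ?A) + card (?A \<inter> ?B)"
    using finAB by (metis card_Diff_subset_Int card_mono finite_Int inf_commute inf_le1
        le_add_diff_inverse2)
  ultimately have "card (inversions S r r') + card (inversions S r' r'') + card (inversions S r r'')
      = 2 * (card (?A - ?B) + card (?B - ?A) + card (?A \<inter> ?B))"
    by simp
  then show ?thesis by simp
qed

lemma card_inversions_insert:
  assumes "finite S" "b \<notin> S"
  shows "card (inversions (insert b S) r r') =
    card (inversions S r r') + card {u \<in> S. (u, b) \<in> r \<and> (b, u) \<in> r'}
      + card {u \<in> S. (b, u) \<in> r \<and> (u, b) \<in> r'}"
proof -
  let ?D = "{u \<in> S. (u, b) \<in> r \<and> (b, u) \<in> r'}" and ?E = "{u \<in> S. (b, u) \<in> r \<and> (u, b) \<in> r'}"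
  let ?X = "(\<lambda>u. (u, b)) ` ?D" and ?Y = "Pair b ` ?E"
  have "inversions (insert b S) r r' = inversions S r r' \<union> (?X \<union> ?Y)"
    using assms(2) by (auto simp: inversions_def)
  moreover have "card (inversions S r r' \<union> (?X \<union> ?Y)) = card (inversions S r r') + card (?X \<union> ?Y)"
  proof (rule card_Un_disjoint)
    show "finite (inversions S r r')" by (rule finite_inversions[OF assms(1)])
    show "finite (?X \<union> ?Y)" using assms(1) by simp
    show "inversions S r r' \<inter> (?X \<union> ?Y) = {}"
      using assms(2) by (auto simp: inversions_def)
  qed
  moreover have "card (?X \<union> ?Y) = card ?X + card ?Y"
    by (rule card_Un_disjoint) (use assms in auto)
  moreover have "card ?X = card ?D" "card ?Y = card ?E"
    by (auto intro!: card_image simp: inj_on_def)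
  ultimately show ?thesis by (simp only: add.assoc)
qed

lemma card_predecessors:
  assumes "finite S" "b \<notin> S" and "linear_order_on A r" "linear_order_on B r'"
    and "insert b S \<subseteq> A" "insert b S \<subseteq> B"
  shows "card {u \<in> S. (u, b) \<in> r'} + card {u \<in> S. (u, b) \<in> r \<and> (b, u) \<in> r'}
    = card {u \<in> S. (u, b) \<in> r} + card {u \<in> S. (b, u) \<in> r \<and> (u, b) \<in> r'}"
proof -
  have total: "(u, b) \<in> r \<longleftrightarrow> (b, u) \<notin> r" "(u, b) \<in> r' \<longleftrightarrow> (b, u) \<notin> r'" if "u \<in> S" for u
    using linear_order_onD[OF assms(3), of u b] linear_order_onD[OF assms(4), of u b] that assms
    by auto
  have "card {u \<in> S. (u, b) \<in> r'} + card {u \<in> S. (u, b) \<in> r \<and> (b, u) \<in> r'}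
     = card ({u \<in> S. (u, b) \<in> r'} \<union> {u \<in> S. (u, b) \<in> r \<and> (b, u) \<in> r'})"
    using assms(1) total by (subst card_Un_disjoint) auto
  also have "{u \<in> S. (u, b) \<in> r'} \<union> {u \<in> S. (u, b) \<in> r \<and> (b, u) \<in> r'}
     = {u \<in> S. (u, b) \<in> r} \<union> {u \<in> S. (b, u) \<in> r \<and> (u, b) \<in> r'}"
    using total by auto
  also have "card \<dots> = card {u \<in> S. (u, b) \<in> r} + card {u \<in> S. (b, u) \<in> r \<and> (u, b) \<in> r'}"
    using assms(1) total by (subst card_Un_disjoint) auto
  finally show ?thesis .
qed

text \<open>The intermediate orientation of \<open>insert b \<sigma>\<close> cancels from the sign of the way from
\<open>insert a (insert b \<sigma>)\<close> down to \<open>\<sigma>\<close>.  What remains is symmetric in \<open>a\<close> and \<open>b\<close> except for the last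
summand, which records whether \<open>b\<close> precedes \<open>a\<close>.\<close>

lemma incidence_path:
  assumes fin: "finite \<sigma>" and ab: "a \<notin> \<sigma>" "b \<notin> \<sigma>" "a \<noteq> b"
    and \<tau>: "linear_order_on (insert a (insert b \<sigma>)) (ori (insert a (insert b \<sigma>)))"
    and \<tau>a: "linear_order_on (insert b \<sigma>) (ori (insert b \<sigma>))"
    and \<sigma>: "linear_order_on \<sigma> (ori \<sigma>)"
  shows "incidence ori (insert a (insert b \<sigma>)) (insert b \<sigma>) * incidence ori (insert b \<sigma>) \<sigma>
    = (-1) ^ (card {u \<in> \<sigma>. (u, a) \<in> ori (insert a (insert b \<sigma>))}
        + card {u \<in> \<sigma>. (u, b) \<in> ori (insert a (insert b \<sigma>))}
        + card (inversions \<sigma> (ori (insert a (insert b \<sigma>))) (ori \<sigma>))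
        + (if (b, a) \<in> ori (insert a (insert b \<sigma>)) then 1 else 0))"
proof -
  let ?r = "ori (insert a (insert b \<sigma>))" and ?r' = "ori (insert b \<sigma>)" and ?r'' = "ori \<sigma>"
  have diff: "insert a (insert b \<sigma>) - insert b \<sigma> = {a}" "insert b \<sigma> - \<sigma> = {b}"
    using ab by auto
  have "?r \<inter> insert b \<sigma> \<times> {a}
      = (\<lambda>u. (u, a)) ` ({u \<in> \<sigma>. (u, a) \<in> ?r} \<union> (if (b, a) \<in> ?r then {b} else {}))"
    by auto
  then have "card (?r \<inter> insert b \<sigma> \<times> {a})
      = card ({u \<in> \<sigma>. (u, a) \<in> ?r} \<union> (if (b, a) \<in> ?r then {b} else {}))"
    by (simp add: card_image inj_on_def)
  also have "\<dots> = card {u \<in> \<sigma>. (u, a) \<in> ?r} + (if (b, a) \<in> ?r then 1 else 0)"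
    using fin ab by auto
  finally have 1: "card (?r \<inter> insert b \<sigma> \<times> {a}) = \<dots>" .
  have "?r' \<inter> \<sigma> \<times> {b} = (\<lambda>u. (u, b)) ` {u \<in> \<sigma>. (u, b) \<in> ?r'}" by auto
  then have 2: "card (?r' \<inter> \<sigma> \<times> {b}) = card {u \<in> \<sigma>. (u, b) \<in> ?r'}"
    by (simp add: card_image inj_on_def)
  note 3 = card_inversions_insert[OF fin ab(2), of ?r ?r']
  note 4 = card_predecessors[OF fin ab(2) \<tau> \<tau>a subset_insertI subset_refl]
  have 5: "even (card (inversions \<sigma> ?r ?r') + card (inversions \<sigma> ?r' ?r'') + card (inversions \<sigma> ?r ?r''))"
    by (rule even_card_inversions[OF fin \<tau> \<tau>a \<sigma>]) auto
  have arith: "(l + x) + (i + d + e) + (p + j) + (l + q' + m + x) = 2 * (l + x + q' + e) + (i + j + m)"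
    if "p + d = q' + e" for p d q' e i j l m x :: nat
    using that by simp
  have eq: "card (?r \<inter> insert b \<sigma> \<times> {a}) + card (inversions (insert b \<sigma>) ?r ?r')
     + (card (?r' \<inter> \<sigma> \<times> {b}) + card (inversions \<sigma> ?r' ?r''))
     + (card {u \<in> \<sigma>. (u, a) \<in> ?r} + card {u \<in> \<sigma>. (u, b) \<in> ?r}
        + card (inversions \<sigma> ?r ?r'') + (if (b, a) \<in> ?r then 1 else 0))
    = 2 * (card {u \<in> \<sigma>. (u, a) \<in> ?r} + (if (b, a) \<in> ?r then 1 else 0) + card {u \<in> \<sigma>. (u, b) \<in> ?r}
        + card {u \<in> \<sigma>. (b, u) \<in> ?r \<and> (u, b) \<in> ?r'})
      + (card (inversions \<sigma> ?r ?r') + card (inversions \<sigma> ?r' ?r'') + card (inversions \<sigma> ?r ?r''))"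
    unfolding 1 2 3 by (rule arith[OF 4])
  have even: "even (card (?r \<inter> insert b \<sigma> \<times> {a}) + card (inversions (insert b \<sigma>) ?r ?r')
     + (card (?r' \<inter> \<sigma> \<times> {b}) + card (inversions \<sigma> ?r' ?r''))
     + (card {u \<in> \<sigma>. (u, a) \<in> ?r} + card {u \<in> \<sigma>. (u, b) \<in> ?r}
        + card (inversions \<sigma> ?r ?r'') + (if (b, a) \<in> ?r then 1 else 0)))"
    unfolding eq by (rule dvd_add[OF dvd_triv_left 5])
  have sign: "(- 1) ^ m = (- 1 :: int) ^ n" if "even (m + n)" for m n :: nat
    using that by (simp add: minus_one_power_iff)
  from sign[OF even] show ?thesis
    unfolding incidence_def diff inversions_def[symmetric] power_add[symmetric] .
qed

text \<open>The sign rule behind \<open>\<partial>\<partial> = 0\<close>, for orientations that need not be compatible with each other: exactly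
one of the vertices \<open>a\<close> and \<open>b\<close> precedes the other one.\<close>

lemma incidence_anticommute:
  assumes fin: "finite \<sigma>" and ab: "a \<notin> \<sigma>" "b \<notin> \<sigma>" "a \<noteq> b"
    and ori: "\<And>\<upsilon>. \<sigma> \<subseteq> \<upsilon> \<Longrightarrow> \<upsilon> \<subseteq> insert a (insert b \<sigma>) \<Longrightarrow> linear_order_on \<upsilon> (ori \<upsilon>)"
  shows "incidence ori (insert a (insert b \<sigma>)) (insert b \<sigma>) * incidence ori (insert b \<sigma>) \<sigma>
    = - (incidence ori (insert a (insert b \<sigma>)) (insert a \<sigma>) * incidence ori (insert a \<sigma>) \<sigma>)"
proof -
  have "incidence ori (insert b (insert a \<sigma>)) (insert a \<sigma>) * incidence ori (insert a \<sigma>) \<sigma>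
    = (-1) ^ (card {u \<in> \<sigma>. (u, b) \<in> ori (insert b (insert a \<sigma>))}
        + card {u \<in> \<sigma>. (u, a) \<in> ori (insert b (insert a \<sigma>))}
        + card (inversions \<sigma> (ori (insert b (insert a \<sigma>))) (ori \<sigma>))
        + (if (a, b) \<in> ori (insert b (insert a \<sigma>)) then 1 else 0))"
    by (rule incidence_path[OF fin ab(2,1) ab(3)[symmetric]]) (rule ori; blast)+
  moreover have "(a, b) \<in> ori (insert a (insert b \<sigma>)) \<longleftrightarrow> (b, a) \<notin> ori (insert a (insert b \<sigma>))"
    by (rule linear_order_onD[OF ori]) (use ab in auto)
  moreover have "incidence ori (insert a (insert b \<sigma>)) (insert b \<sigma>) * incidence ori (insert b \<sigma>) \<sigma>
    = (-1) ^ (card {u \<in> \<sigma>. (u, a) \<in> ori (insert a (insert b \<sigma>))}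
        + card {u \<in> \<sigma>. (u, b) \<in> ori (insert a (insert b \<sigma>))}
        + card (inversions \<sigma> (ori (insert a (insert b \<sigma>))) (ori \<sigma>))
        + (if (b, a) \<in> ori (insert a (insert b \<sigma>)) then 1 else 0))"
    by (rule incidence_path[OF fin ab]) (rule ori; blast)+
  ultimately show ?thesis
    unfolding insert_commute[of b a]
    by (cases "(b, a) \<in> ori (insert a (insert b \<sigma>))") (simp_all add: power_add)
qed

lemma incidence_cases: "incidence ori \<tau> \<sigma> = 1 \<or> incidence ori \<tau> \<sigma> = - 1"
  unfolding incidence_def by (simp add: minus_one_power_iff)

section \<open>Chains with coefficients in a fixed space\<close>

text \<open>The vanishing of the diagonal has to be demanded separately, since \<open>x \<oplus> x = \<zero>\<close> does not force
\<open>x = \<zero>\<close> in characteristic two.\<close>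

lemma (in abelian_group) finsum_alternating:
  assumes "finite A" "\<And>a b. a \<in> A \<Longrightarrow> b \<in> A \<Longrightarrow> F a b \<in> carrier G"
    and "\<And>a. a \<in> A \<Longrightarrow> F a a = \<zero>"
    and "\<And>a b. a \<in> A \<Longrightarrow> b \<in> A \<Longrightarrow> a \<noteq> b \<Longrightarrow> F a b \<oplus> F b a = \<zero>"
  shows "(\<Oplus>a\<in>A. \<Oplus>b\<in>A. F a b) = \<zero>"
  using assms
proof (induction A)
  case empty
  show ?case by simp
next
  case (insert c A)
  have cl: "F a b \<in> carrier G" if "a \<in> insert c A" "b \<in> insert c A" for a b
    using insert.prems(1) that by blast
  let ?S = "\<lambda>a. \<Oplus>b\<in>A. F a b"
  have S: "?S a \<in> carrier G" if "a \<in> insert c A" for a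
    using cl that by (intro finsum_closed) auto
  have row: "(\<Oplus>b\<in>insert c A. F a b) = F a c \<oplus> ?S a" if "a \<in> insert c A" for a
    using insert.hyps cl that by (intro finsum_insert) auto
  have "(\<Oplus>a\<in>insert c A. \<Oplus>b\<in>insert c A. F a b) = (\<Oplus>a\<in>insert c A. F a c \<oplus> ?S a)"
    using row cl S by (intro finsum_cong') auto
  also have "\<dots> = (F c c \<oplus> ?S c) \<oplus> (\<Oplus>a\<in>A. F a c \<oplus> ?S a)"
    using insert.hyps cl S by (intro finsum_insert) auto
  also have "(\<Oplus>a\<in>A. F a c \<oplus> ?S a) = (\<Oplus>a\<in>A. F a c) \<oplus> (\<Oplus>a\<in>A. ?S a)"
    using cl S by (intro finsum_addf) auto
  also have "(\<Oplus>a\<in>A. ?S a) = \<zero>"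
    using insert.prems by (intro insert.IH) auto
  finally have "(\<Oplus>a\<in>insert c A. \<Oplus>b\<in>insert c A. F a b) = ?S c \<oplus> (\<Oplus>a\<in>A. F a c)"
    using insert.prems(2)[of c] S[of c] cl by (simp add: Pi_def)
  also have "\<dots> = (\<Oplus>a\<in>A. F c a \<oplus> F a c)"
    using cl by (intro finsum_addf[symmetric]) auto
  also have "\<dots> = (\<Oplus>a\<in>A. \<zero>)"
    using insert.hyps insert.prems(3) by (intro finsum_cong') auto
  finally show ?case by simp
qed

text \<open>Multiples by a sign are expressed through the scalar multiplication because the latter is shared by
a space and its subspaces, whereas the negation used by integer multiples depends on the carrier.\<close>

definition sign_scalar :: "('k, 'x) ring_scheme \<Rightarrow> int \<Rightarrow> 'k" where
  "sign_scalar k n = (if n = 1 then \<one>\<^bsub>k\<^esub> else \<ominus>\<^bsub>k\<^esub> \<one>\<^bsub>k\<^esub>)"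

lemma (in module) sign_scalar_closed: "sign_scalar R n \<in> carrier R"
  unfolding sign_scalar_def using R.one_closed R.a_inv_closed by presburger

lemma (in module) add_pow_sign:
  assumes "n = 1 \<or> n = - 1" "x \<in> carrier M"
  shows "[n] \<cdot>\<^bsub>M\<^esub> x = sign_scalar R n \<odot>\<^bsub>M\<^esub> x"
proof -
  have "[(- 1 :: int)] \<cdot>\<^bsub>M\<^esub> x = \<ominus>\<^bsub>M\<^esub> x"
    using M.add.int_pow_neg[of x 1] M.add.int_pow_1[of x] assms(2) by simp
  then show ?thesis
    using assms smult_minus_1[OF assms(2)] M.add.int_pow_1[of x]
    by (auto simp: sign_scalar_def)
qed

lemma (in module) sign_scalar_cancel:
  assumes "n = 1 \<or> n = - 1" "x \<in> carrier M"
  shows "sign_scalar R n \<odot>\<^bsub>M\<^esub> (sign_scalar R n \<odot>\<^bsub>M\<^esub> x) = x"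
proof -
  have "(\<ominus>\<^bsub>R\<^esub> \<one>\<^bsub>R\<^esub>) \<odot>\<^bsub>M\<^esub> ((\<ominus>\<^bsub>R\<^esub> \<one>\<^bsub>R\<^esub>) \<odot>\<^bsub>M\<^esub> x) = x"
    using assms(2) M.minus_minus[of x] smult_minus_1[OF assms(2)] smult_minus_1[of "\<ominus>\<^bsub>M\<^esub> x"]
      M.a_inv_closed[of x] by presburger
  then show ?thesis
    using assms(2) by (auto simp: sign_scalar_def)
qed

lemma (in module) sign_scalar_anticommute:
  assumes "x \<in> carrier M"
    and "m = 1 \<or> m = - 1" "n = 1 \<or> n = - 1" "m' = 1 \<or> m' = - 1" "n' = 1 \<or> n' = - 1"
    and "m * n = - (m' * n')"
  shows "sign_scalar R n \<odot>\<^bsub>M\<^esub> (sign_scalar R m \<odot>\<^bsub>M\<^esub> x)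
    \<oplus>\<^bsub>M\<^esub> sign_scalar R n' \<odot>\<^bsub>M\<^esub> (sign_scalar R m' \<odot>\<^bsub>M\<^esub> x) = \<zero>\<^bsub>M\<^esub>"
proof -
  have neg: "(\<ominus>\<^bsub>R\<^esub> \<one>\<^bsub>R\<^esub>) \<odot>\<^bsub>M\<^esub> y = \<ominus>\<^bsub>M\<^esub> y" if "y \<in> carrier M" for y
    using that by (rule smult_minus_1)
  have c: "\<ominus>\<^bsub>M\<^esub> x \<in> carrier M" using assms(1) by (rule M.a_inv_closed)
  have "\<ominus>\<^bsub>M\<^esub> (\<ominus>\<^bsub>M\<^esub> x) = x" "x \<oplus>\<^bsub>M\<^esub> \<ominus>\<^bsub>M\<^esub> x = \<zero>\<^bsub>M\<^esub>" "\<ominus>\<^bsub>M\<^esub> x \<oplus>\<^bsub>M\<^esub> x = \<zero>\<^bsub>M\<^esub>"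
    using assms(1) by (simp_all add: M.r_neg M.l_neg)
  with assms neg[OF assms(1)] neg[OF c] smult_one[OF assms(1)] smult_one[OF c] show ?thesis
    by (auto simp: sign_scalar_def)
qed

text \<open>Besides simplicial chains with coefficients in the field, this provides the ambient chains for all
cosheaves whose stalks are subquotients of \<open>V\<close>.\<close>

definition uniform_cosheaf :: "('k, 'v) module \<Rightarrow> ('a, 'k, 'v) cosheaf" where
  "uniform_cosheaf V = \<lparr>stalk = (\<lambda>_. V), extension = (\<lambda>_ _ x. x)\<rparr>"

lemma uniform_cosheaf_simps [simp]:
  "stalk (uniform_cosheaf V) \<sigma> = V" "extension (uniform_cosheaf V) \<tau> \<sigma> = (\<lambda>x. x)"
  by (simp_all add: uniform_cosheaf_def)

lemma constant_cosheaf_uniform: "constant_cosheaf k = uniform_cosheaf (self_space k)"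
  by (simp add: constant_cosheaf_def uniform_cosheaf_def)

locale oriented_complex =
  fixes k :: "('k, 'x) ring_scheme" and V :: "('k, 'v) module"
    and K :: "'a set set" and ori :: "'a set \<Rightarrow> 'a rel"
  assumes vectorspace: "vectorspace k V"
    and finite_complex: "finite K"
    and simplicial: "simplicial_complex K"
    and oriented: "orientation K ori"
begin

interpretation V: vectorspace k V by (rule vectorspace)

abbreviation "V_chains \<equiv> chain_module K (uniform_cosheaf V)"
abbreviation "bd \<equiv> boundary_map ori K (uniform_cosheaf V)"

lemma finite_simplex: "\<sigma> \<in> K \<Longrightarrow> finite \<sigma>"
  using simplicial by (auto simp: simplicial_complex_def)

lemma nonempty_simplex: "\<sigma> \<in> K \<Longrightarrow> \<sigma> \<noteq> {}"
  using simplicial by (auto simp: simplicial_complex_def)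

lemma face_closed: "\<tau> \<in> K \<Longrightarrow> \<sigma> \<subseteq> \<tau> \<Longrightarrow> \<sigma> \<noteq> {} \<Longrightarrow> \<sigma> \<in> K"
  using simplicial unfolding simplicial_complex_def by blast

lemma finite_vertices: "finite (\<Union>K)"
  using finite_complex finite_simplex by blast

lemma chains_carrier: "carrier (V_chains i) = (simplices K i \<rightarrow>\<^sub>E carrier V)"
  by (simp add: chain_module_def)

lemma chain_closed: "f \<in> carrier (V_chains i) \<Longrightarrow> \<sigma> \<in> simplices K i \<Longrightarrow> f \<sigma> \<in> carrier V"
  by (auto simp: chains_carrier)

lemma chains_zero: "\<sigma> \<in> simplices K i \<Longrightarrow> \<zero>\<^bsub>V_chains i\<^esub> \<sigma> = \<zero>\<^bsub>V\<^esub>"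
  and chains_add: "\<sigma> \<in> simplices K i \<Longrightarrow> (f \<oplus>\<^bsub>V_chains i\<^esub> g) \<sigma> = f \<sigma> \<oplus>\<^bsub>V\<^esub> g \<sigma>"
  and chains_smult: "\<sigma> \<in> simplices K i \<Longrightarrow> (a \<odot>\<^bsub>V_chains i\<^esub> f) \<sigma> = a \<odot>\<^bsub>V\<^esub> f \<sigma>"
  by (simp_all add: chain_module_def)

lemma chains_zero_closed: "\<zero>\<^bsub>V_chains i\<^esub> \<in> carrier (V_chains i)"
  and chains_add_closed: "f \<in> carrier (V_chains i) \<Longrightarrow> g \<in> carrier (V_chains i) \<Longrightarrow>
    f \<oplus>\<^bsub>V_chains i\<^esub> g \<in> carrier (V_chains i)"
  and chains_smult_closed: "a \<in> carrier k \<Longrightarrow> f \<in> carrier (V_chains i) \<Longrightarrow>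
    a \<odot>\<^bsub>V_chains i\<^esub> f \<in> carrier (V_chains i)"
  by (auto simp: chain_module_def PiE_iff)

lemma chain_eqI:
  assumes "f \<in> carrier (V_chains i)" "g \<in> carrier (V_chains i)"
    and "\<And>\<sigma>. \<sigma> \<in> simplices K i \<Longrightarrow> f \<sigma> = g \<sigma>"
  shows "f = g"
  using assms unfolding chains_carrier by (rule PiE_ext)

lemma vectorspace_chains: "vectorspace k (V_chains i)"
proof (rule vs_criteria)
  show "field k" ..
  note cl = chains_zero_closed chains_add_closed chains_smult_closed
  note ev = chains_zero chains_add chains_smult
  show "\<zero>\<^bsub>V_chains i\<^esub> \<in> carrier (V_chains i)" by (rule cl)
  show "\<forall>v w. v \<in> carrier (V_chains i) \<and> w \<in> carrier (V_chains i) \<longrightarrow>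
      v \<oplus>\<^bsub>V_chains i\<^esub> w \<in> carrier (V_chains i)"
    using cl by blast
  show "\<forall>c v. c \<in> carrier k \<and> v \<in> carrier (V_chains i) \<longrightarrow> c \<odot>\<^bsub>V_chains i\<^esub> v \<in> carrier (V_chains i)"
    using cl by blast
  show "\<forall>v\<in>carrier (V_chains i). \<exists>w\<in>carrier (V_chains i). v \<oplus>\<^bsub>V_chains i\<^esub> w = \<zero>\<^bsub>V_chains i\<^esub>"
  proof
    fix v assume v: "v \<in> carrier (V_chains i)"
    let ?w = "\<lambda>\<sigma>\<in>simplices K i. \<ominus>\<^bsub>V\<^esub> v \<sigma>"
    have w: "?w \<in> carrier (V_chains i)" using v by (auto simp: chains_carrier)
    have "v \<oplus>\<^bsub>V_chains i\<^esub> ?w = \<zero>\<^bsub>V_chains i\<^esub>"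
      by (rule chain_eqI[of _ i]) (use v w chain_closed[OF v] in \<open>auto simp: cl ev V.r_neg\<close>)
    then show "\<exists>w\<in>carrier (V_chains i). v \<oplus>\<^bsub>V_chains i\<^esub> w = \<zero>\<^bsub>V_chains i\<^esub>" using w by blast
  qed
  show "\<forall>v w. v \<in> carrier (V_chains i) \<and> w \<in> carrier (V_chains i) \<longrightarrow>
      v \<oplus>\<^bsub>V_chains i\<^esub> w = w \<oplus>\<^bsub>V_chains i\<^esub> v"
    by (safe, rule chain_eqI[of _ i]) (auto simp: cl ev chain_closed V.a_comm)
  show "\<forall>v w x. v \<in> carrier (V_chains i) \<and> w \<in> carrier (V_chains i) \<and> x \<in> carrier (V_chains i) \<longrightarrow>
      v \<oplus>\<^bsub>V_chains i\<^esub> w \<oplus>\<^bsub>V_chains i\<^esub> x = v \<oplus>\<^bsub>V_chains i\<^esub> (w \<oplus>\<^bsub>V_chains i\<^esub> x)"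
    by (safe, rule chain_eqI[of _ i]) (auto simp: cl ev chain_closed V.a_assoc)
  show "\<forall>v\<in>carrier (V_chains i). v \<oplus>\<^bsub>V_chains i\<^esub> \<zero>\<^bsub>V_chains i\<^esub> = v"
    by (safe, rule chain_eqI[of _ i]) (auto simp: cl ev chain_closed)
  show "\<forall>a b v. a \<in> carrier k \<and> b \<in> carrier k \<and> v \<in> carrier (V_chains i) \<longrightarrow>
      (a \<otimes>\<^bsub>k\<^esub> b) \<odot>\<^bsub>V_chains i\<^esub> v = a \<odot>\<^bsub>V_chains i\<^esub> (b \<odot>\<^bsub>V_chains i\<^esub> v)"
    by (safe, rule chain_eqI[of _ i]) (auto simp: cl ev chain_closed V.smult_assoc1)
  show "\<forall>v\<in>carrier (V_chains i). \<one>\<^bsub>k\<^esub> \<odot>\<^bsub>V_chains i\<^esub> v = v"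
    by (safe, rule chain_eqI[of _ i]) (auto simp: cl ev chain_closed)
  show "\<forall>a b v. a \<in> carrier k \<and> b \<in> carrier k \<and> v \<in> carrier (V_chains i) \<longrightarrow>
      (a \<oplus>\<^bsub>k\<^esub> b) \<odot>\<^bsub>V_chains i\<^esub> v = a \<odot>\<^bsub>V_chains i\<^esub> v \<oplus>\<^bsub>V_chains i\<^esub> b \<odot>\<^bsub>V_chains i\<^esub> v"
    by (safe, rule chain_eqI[of _ i]) (auto simp: cl ev chain_closed V.smult_l_distr)
  show "\<forall>a v w. a \<in> carrier k \<and> v \<in> carrier (V_chains i) \<and> w \<in> carrier (V_chains i) \<longrightarrow>
      a \<odot>\<^bsub>V_chains i\<^esub> (v \<oplus>\<^bsub>V_chains i\<^esub> w) = a \<odot>\<^bsub>V_chains i\<^esub> v \<oplus>\<^bsub>V_chains i\<^esub> a \<odot>\<^bsub>V_chains i\<^esub> w"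
    by (safe, rule chain_eqI[of _ i]) (auto simp: cl ev chain_closed V.smult_r_distr)
qed

lemma chains_minus:
  assumes "f \<in> carrier (V_chains i)" "g \<in> carrier (V_chains i)" "\<sigma> \<in> simplices K i"
  shows "(f \<ominus>\<^bsub>V_chains i\<^esub> g) \<sigma> = f \<sigma> \<ominus>\<^bsub>V\<^esub> g \<sigma>"
proof -
  interpret C: vectorspace k "V_chains i" by (rule vectorspace_chains)
  have "(\<ominus>\<^bsub>V_chains i\<^esub> g) \<sigma> = ((\<ominus>\<^bsub>k\<^esub> \<one>\<^bsub>k\<^esub>) \<odot>\<^bsub>V_chains i\<^esub> g) \<sigma>"
    by (simp only: C.smult_minus_1[OF assms(2)])
  also have "\<dots> = \<ominus>\<^bsub>V\<^esub> g \<sigma>"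
    using assms by (simp add: chains_smult V.smult_minus_1 chain_closed)
  finally show ?thesis using assms by (simp add: a_minus_def chains_add)
qed

lemma coface_simplices:
  assumes "\<sigma> \<in> simplices K (i - 1)" "v \<notin> \<sigma>" "insert v \<sigma> \<in> K"
  shows "insert v \<sigma> \<in> simplices K i"
  using assms finite_simplex[of \<sigma>] by (auto simp: simplices_def)

text \<open>Indexing the cofaces of \<open>\<sigma>\<close> by the additional vertex, with zero where there is none, turns boundaries
into sums over one fixed set of vertices; the double sum in \<open>\<partial>\<partial>\<close> then has a rectangular index set.\<close>

definition coface_term :: "('a set \<Rightarrow> 'v) \<Rightarrow> 'a set \<Rightarrow> 'a \<Rightarrow> 'v" where
  "coface_term f \<sigma> v =
    (if v \<notin> \<sigma> \<and> insert v \<sigma> \<in> K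
     then sign_scalar k (incidence ori (insert v \<sigma>) \<sigma>) \<odot>\<^bsub>V\<^esub> f (insert v \<sigma>) else \<zero>\<^bsub>V\<^esub>)"

lemma coface_term_in:
  assumes "\<sigma> \<in> simplices K (i - 1)" "subspace k S V"
    and "\<And>\<tau>. \<tau> \<in> simplices K i \<Longrightarrow> \<sigma> \<subseteq> \<tau> \<Longrightarrow> f \<tau> \<in> S"
  shows "coface_term f \<sigma> v \<in> S"
  using assms(3)[OF coface_simplices[OF assms(1)] subset_insertI] subspaceD(3,5)[OF assms(2)]
    V.sign_scalar_closed
  by (auto simp: coface_term_def)

lemma subspace_top: "subspace k (carrier V) V"
  by (rule subspaceI) (auto intro: vectorspace)

lemma coface_term_closed:
  assumes "f \<in> carrier (V_chains i)" "\<sigma> \<in> simplices K (i - 1)"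
  shows "coface_term f \<sigma> v \<in> carrier V"
  using assms by (intro coface_term_in[OF _ subspace_top]) (auto simp: chain_closed)

lemma boundary_eq:
  assumes "f \<in> carrier (V_chains i)" "\<sigma> \<in> simplices K (i - 1)"
  shows "bd i f \<sigma> = finsum V (coface_term f \<sigma>) (\<Union>K)"
proof -
  let ?A = "{v \<in> \<Union>K. v \<notin> \<sigma> \<and> insert v \<sigma> \<in> K}"
  let ?g = "\<lambda>\<tau>. sign_scalar k (incidence ori \<tau> \<sigma>) \<odot>\<^bsub>V\<^esub> f \<tau>"
  have fin: "finite \<sigma>" using assms finite_simplex by (auto simp: simplices_def)
  have cof: "insert v \<sigma> \<in> simplices K i" if "v \<in> ?A" for v
    using coface_simplices[OF assms(2)] that by blast
  have g: "?g \<tau> \<in> carrier V" if "\<tau> \<in> simplices K i" for \<tau>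
    using that assms(1) by (simp add: chain_closed V.sign_scalar_closed)
  have "{\<tau> \<in> simplices K i. \<sigma> \<subseteq> \<tau>} = (\<lambda>v. insert v \<sigma>) ` ?A"
  proof
    show "{\<tau> \<in> simplices K i. \<sigma> \<subseteq> \<tau>} \<subseteq> (\<lambda>v. insert v \<sigma>) ` ?A"
    proof
      fix \<tau> assume \<tau>: "\<tau> \<in> {\<tau> \<in> simplices K i. \<sigma> \<subseteq> \<tau>}"
      then have "finite \<tau>" "\<sigma> \<subseteq> \<tau>" using finite_simplex by (auto simp: simplices_def)
      moreover have "card \<tau> = Suc (card \<sigma>)" using \<tau> assms by (auto simp: simplices_def)
      ultimately have "card (\<tau> - \<sigma>) = 1" using fin by (simp add: card_Diff_subset)
      then obtain v where "\<tau> - \<sigma> = {v}" by (auto simp: card_1_singleton_iff)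
      then have "\<tau> = insert v \<sigma>" "v \<notin> \<sigma>" using \<open>\<sigma> \<subseteq> \<tau>\<close> by auto
      moreover have "\<tau> \<in> K" using \<tau> by (auto simp: simplices_def)
      ultimately show "\<tau> \<in> (\<lambda>v. insert v \<sigma>) ` ?A" by blast
    qed
    show "(\<lambda>v. insert v \<sigma>) ` ?A \<subseteq> {\<tau> \<in> simplices K i. \<sigma> \<subseteq> \<tau>}"
      using cof by blast
  qed
  moreover have "bd i f \<sigma> = (\<Oplus>\<^bsub>V\<^esub>\<tau>\<in>{\<tau> \<in> simplices K i. \<sigma> \<subseteq> \<tau>}. ?g \<tau>)"
    unfolding boundary_map_def using assms g
    by (auto intro!: V.finsum_cong' V.add_pow_sign incidence_cases simp: chain_closed)
  ultimately have "bd i f \<sigma> = finsum V ?g ((\<lambda>v. insert v \<sigma>) ` ?A)" by simp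
  also have "\<dots> = (\<Oplus>\<^bsub>V\<^esub>v\<in>?A. ?g (insert v \<sigma>))"
    by (rule V.finsum_reindex) (use cof g in \<open>auto simp: inj_on_def\<close>)
  also have "\<dots> = (\<Oplus>\<^bsub>V\<^esub>v\<in>\<Union>K. if v \<in> ?A then ?g (insert v \<sigma>) else \<zero>\<^bsub>V\<^esub>)"
    by (rule V.extend_sum[symmetric]) (use finite_vertices cof g in auto)
  also have "\<dots> = finsum V (coface_term f \<sigma>) (\<Union>K)"
    using coface_term_closed[OF assms] by (intro V.finsum_cong') (auto simp: coface_term_def)
  finally show ?thesis .
qed

lemma boundary_single_coface:
  assumes f: "f \<in> carrier (V_chains i)" and \<sigma>: "\<sigma> \<in> simplices K (i - 1)"
    and v: "v \<notin> \<sigma>" "insert v \<sigma> \<in> K"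
    and other: "\<And>u. u \<noteq> v \<Longrightarrow> u \<notin> \<sigma> \<Longrightarrow> insert u \<sigma> \<in> K \<Longrightarrow> f (insert u \<sigma>) = \<zero>\<^bsub>V\<^esub>"
  shows "bd i f \<sigma> = sign_scalar k (incidence ori (insert v \<sigma>) \<sigma>) \<odot>\<^bsub>V\<^esub> f (insert v \<sigma>)"
proof -
  have eq: "coface_term f \<sigma> = (\<lambda>u. if v = u then coface_term f \<sigma> u else \<zero>\<^bsub>V\<^esub>)"
  proof
    fix u show "coface_term f \<sigma> u = (if v = u then coface_term f \<sigma> u else \<zero>\<^bsub>V\<^esub>)"
      using other[of u] by (auto simp: coface_term_def V.sign_scalar_closed)
  qed
  have "bd i f \<sigma> = finsum V (coface_term f \<sigma>) (\<Union>K)" by (rule boundary_eq[OF f \<sigma>])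
  also have "\<dots> = (\<Oplus>\<^bsub>V\<^esub>u\<in>\<Union>K. if v = u then coface_term f \<sigma> u else \<zero>\<^bsub>V\<^esub>)"
    by (rule arg_cong[OF eq, of "\<lambda>h. finsum V h (\<Union>K)"])
  also have "\<dots> = coface_term f \<sigma> v"
    by (rule V.finsum_singleton) (use v finite_vertices coface_term_closed[OF f \<sigma>] in auto)
  finally show ?thesis using v by (simp add: coface_term_def)
qed

lemma boundary_in:
  assumes "f \<in> carrier (V_chains i)" "\<sigma> \<in> simplices K (i - 1)" "subspace k S V"
    and "\<And>\<tau>. \<tau> \<in> simplices K i \<Longrightarrow> \<sigma> \<subseteq> \<tau> \<Longrightarrow> f \<tau> \<in> S"
  shows "bd i f \<sigma> \<in> S"
  unfolding boundary_eq[OF assms(1,2)]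
  using finite_vertices by (intro subspace_finsum[OF assms(3)] coface_term_in[OF assms(2,3,4)])

lemma boundary_cong:
  assumes "f \<in> carrier (V_chains i)" "g \<in> carrier (V_chains i)" "\<sigma> \<in> simplices K (i - 1)"
    and "\<And>\<tau>. \<tau> \<in> simplices K i \<Longrightarrow> \<sigma> \<subseteq> \<tau> \<Longrightarrow> f \<tau> = g \<tau>"
  shows "bd i f \<sigma> = bd i g \<sigma>"
proof -
  have "coface_term f \<sigma> v = coface_term g \<sigma> v" for v
    using assms(4)[OF coface_simplices[OF assms(3)] subset_insertI, of v] by (auto simp: coface_term_def)
  then have "coface_term f \<sigma> = coface_term g \<sigma>" by blast
  then show ?thesis by (simp add: boundary_eq assms(1-3))
qed

lemma boundary_closed:
  assumes "f \<in> carrier (V_chains i)"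
  shows "bd i f \<in> carrier (V_chains (i - 1))"
proof -
  have "bd i f \<sigma> \<in> carrier V" if "\<sigma> \<in> simplices K (i - 1)" for \<sigma>
    using assms that by (intro boundary_in[OF assms _ subspace_top]) (auto simp: chain_closed)
  then show ?thesis unfolding chains_carrier by (auto simp: boundary_map_def)
qed

lemma boundary_add:
  assumes f: "f \<in> carrier (V_chains i)" and g: "g \<in> carrier (V_chains i)"
  shows "bd i (f \<oplus>\<^bsub>V_chains i\<^esub> g) = bd i f \<oplus>\<^bsub>V_chains (i - 1)\<^esub> bd i g"
proof (rule chain_eqI)
  fix \<sigma> assume \<sigma>: "\<sigma> \<in> simplices K (i - 1)"
  have "coface_term (f \<oplus>\<^bsub>V_chains i\<^esub> g) \<sigma> v = coface_term f \<sigma> v \<oplus>\<^bsub>V\<^esub> coface_term g \<sigma> v" for v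
    using coface_simplices[OF \<sigma>, of v] chain_closed[OF f] chain_closed[OF g]
    by (auto simp: coface_term_def chains_add V.smult_r_distr V.sign_scalar_closed)
  then have "bd i (f \<oplus>\<^bsub>V_chains i\<^esub> g) \<sigma> =
      (\<Oplus>\<^bsub>V\<^esub>v\<in>\<Union>K. coface_term f \<sigma> v \<oplus>\<^bsub>V\<^esub> coface_term g \<sigma> v)"
    unfolding boundary_eq[OF chains_add_closed[OF f g] \<sigma>] by presburger
  also have "\<dots> = bd i f \<sigma> \<oplus>\<^bsub>V\<^esub> bd i g \<sigma>"
    unfolding boundary_eq[OF f \<sigma>] boundary_eq[OF g \<sigma>]
    using coface_term_closed[OF f \<sigma>] coface_term_closed[OF g \<sigma>] by (intro V.finsum_addf) auto
  finally show "bd i (f \<oplus>\<^bsub>V_chains i\<^esub> g) \<sigma> = (bd i f \<oplus>\<^bsub>V_chains (i - 1)\<^esub> bd i g) \<sigma>"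
    using \<sigma> by (simp add: chains_add)
qed (intro boundary_closed chains_add_closed f g)+

lemma boundary_smult:
  assumes a: "a \<in> carrier k" and f: "f \<in> carrier (V_chains i)"
  shows "bd i (a \<odot>\<^bsub>V_chains i\<^esub> f) = a \<odot>\<^bsub>V_chains (i - 1)\<^esub> bd i f"
proof (rule chain_eqI[where i = "i - 1"])
  fix \<sigma> assume \<sigma>: "\<sigma> \<in> simplices K (i - 1)"
  have "coface_term (a \<odot>\<^bsub>V_chains i\<^esub> f) \<sigma> v = a \<odot>\<^bsub>V\<^esub> coface_term f \<sigma> v" for v
    using coface_simplices[OF \<sigma>, of v] chain_closed[OF f] a
    by (auto simp: coface_term_def chains_smult V.sign_scalar_closed V.R.m_comm
        simp flip: V.smult_assoc1)
  then have "bd i (a \<odot>\<^bsub>V_chains i\<^esub> f) \<sigma> = (\<Oplus>\<^bsub>V\<^esub>v\<in>\<Union>K. a \<odot>\<^bsub>V\<^esub> coface_term f \<sigma> v)"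
    unfolding boundary_eq[OF chains_smult_closed[OF a f] \<sigma>] by presburger
  also have "\<dots> = a \<odot>\<^bsub>V\<^esub> bd i f \<sigma>"
    unfolding boundary_eq[OF f \<sigma>]
    using coface_term_closed[OF f \<sigma>] a by (intro V.finsum_smult[symmetric]) auto
  finally show "bd i (a \<odot>\<^bsub>V_chains i\<^esub> f) \<sigma> = (a \<odot>\<^bsub>V_chains (i - 1)\<^esub> bd i f) \<sigma>"
    by (simp only: chains_smult[OF \<sigma>])
next
  show "bd i (a \<odot>\<^bsub>V_chains i\<^esub> f) \<in> carrier (V_chains (i - 1))"
    by (rule boundary_closed[OF chains_smult_closed[OF a f]])
next
  show "a \<odot>\<^bsub>V_chains (i - 1)\<^esub> bd i f \<in> carrier (V_chains (i - 1))"
    by (rule chains_smult_closed[OF a boundary_closed[OF f]])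
qed

lemma boundary_minus:
  assumes "f \<in> carrier (V_chains i)" "g \<in> carrier (V_chains i)" "\<sigma> \<in> simplices K (i - 1)"
  shows "bd i (f \<ominus>\<^bsub>V_chains i\<^esub> g) \<sigma> = bd i f \<sigma> \<ominus>\<^bsub>V\<^esub> bd i g \<sigma>"
proof -
  interpret C: vectorspace k "V_chains i" by (rule vectorspace_chains)
  interpret D: vectorspace k "V_chains (i - 1)" by (rule vectorspace_chains)
  have "bd i (\<ominus>\<^bsub>V_chains i\<^esub> g) = \<ominus>\<^bsub>V_chains (i - 1)\<^esub> bd i g"
    using boundary_smult[OF V.R.a_inv_closed[OF V.R.one_closed] assms(2)]
    unfolding C.smult_minus_1[OF assms(2)] D.smult_minus_1[OF boundary_closed[OF assms(2)]] .
  then have "bd i (f \<ominus>\<^bsub>V_chains i\<^esub> g) = bd i f \<ominus>\<^bsub>V_chains (i - 1)\<^esub> bd i g"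
    unfolding a_minus_def using boundary_add[OF assms(1) C.a_inv_closed[OF assms(2)]] by simp
  then show ?thesis
    using chains_minus[OF boundary_closed[OF assms(1)] boundary_closed[OF assms(2)] assms(3)] by simp
qed

lemma boundary_boundary:
  assumes f: "f \<in> carrier (V_chains i)"
  shows "bd (i - 1) (bd i f) = \<zero>\<^bsub>V_chains (i - 1 - 1)\<^esub>"
proof (rule chain_eqI)
  fix \<sigma> assume \<sigma>: "\<sigma> \<in> simplices K (i - 1 - 1)"
  define F where "F u v = (if u \<noteq> v \<and> u \<notin> \<sigma> \<and> v \<notin> \<sigma> \<and> insert v (insert u \<sigma>) \<in> K
      then sign_scalar k (incidence ori (insert u \<sigma>) \<sigma>) \<odot>\<^bsub>V\<^esub>
        (sign_scalar k (incidence ori (insert v (insert u \<sigma>)) (insert u \<sigma>)) \<odot>\<^bsub>V\<^esub>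
          f (insert v (insert u \<sigma>)))
      else \<zero>\<^bsub>V\<^esub>)" for u v
  have face: "insert u \<sigma> \<in> K" if "insert v (insert u \<sigma>) \<in> K" for u v
    by (rule face_closed[OF that]) auto
  have cof: "insert u \<sigma> \<in> simplices K (i - 1)" if "u \<notin> \<sigma>" "insert u \<sigma> \<in> K" for u
    using coface_simplices[OF \<sigma>] that by blast
  have cof2: "f (insert v (insert u \<sigma>)) \<in> carrier V"
    if "u \<noteq> v" "u \<notin> \<sigma>" "v \<notin> \<sigma>" "insert v (insert u \<sigma>) \<in> K" for u v
    using coface_simplices[OF cof[OF that(2) face[OF that(4)]], of v] that chain_closed[OF f]
    by auto
  have F: "F u v \<in> carrier V" for u v
    using cof2[of u v] by (auto simp: F_def V.sign_scalar_closed)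
  have row: "coface_term (bd i f) \<sigma> u = (\<Oplus>\<^bsub>V\<^esub>v\<in>\<Union>K. F u v)" for u
  proof (cases "u \<notin> \<sigma> \<and> insert u \<sigma> \<in> K")
    case True
    let ?e = "sign_scalar k (incidence ori (insert u \<sigma>) \<sigma>)"
    have "coface_term (bd i f) \<sigma> u = ?e \<odot>\<^bsub>V\<^esub> finsum V (coface_term f (insert u \<sigma>)) (\<Union>K)"
      using True cof[of u] by (simp add: coface_term_def boundary_eq[OF f])
    also have "\<dots> = (\<Oplus>\<^bsub>V\<^esub>v\<in>\<Union>K. ?e \<odot>\<^bsub>V\<^esub> coface_term f (insert u \<sigma>) v)"
      using True cof[of u] by (intro V.finsum_smult) (auto simp: V.sign_scalar_closed coface_term_closed[OF f])
    also have "\<dots> = (\<Oplus>\<^bsub>V\<^esub>v\<in>\<Union>K. F u v)"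
    proof -
      have "?e \<odot>\<^bsub>V\<^esub> coface_term f (insert u \<sigma>) v = F u v" for v
        using True by (auto simp: F_def coface_term_def V.sign_scalar_closed)
      then show ?thesis by simp
    qed
    finally show ?thesis .
  next
    case False
    then have "F u v = \<zero>\<^bsub>V\<^esub>" for v using face by (auto simp: F_def)
    then show ?thesis using False by (auto simp: coface_term_def)
  qed
  have "bd (i - 1) (bd i f) \<sigma> = finsum V (coface_term (bd i f) \<sigma>) (\<Union>K)"
    by (rule boundary_eq[OF boundary_closed[OF f] \<sigma>])
  also have "\<dots> = (\<Oplus>\<^bsub>V\<^esub>u\<in>\<Union>K. \<Oplus>\<^bsub>V\<^esub>v\<in>\<Union>K. F u v)"
    unfolding row by (rule refl)
  also have "\<dots> = \<zero>\<^bsub>V\<^esub>"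
  proof (rule V.finsum_alternating[OF finite_vertices])
    fix u v :: 'a assume "u \<noteq> v"
    have comm: "insert u (insert v \<sigma>) = insert v (insert u \<sigma>)" by (rule insert_commute)
    show "F u v \<oplus>\<^bsub>V\<^esub> F v u = \<zero>\<^bsub>V\<^esub>"
    proof (cases "u \<notin> \<sigma> \<and> v \<notin> \<sigma> \<and> insert v (insert u \<sigma>) \<in> K")
      case True
      have "linear_order_on \<upsilon> (ori \<upsilon>)" if "\<sigma> \<subseteq> \<upsilon>" "\<upsilon> \<subseteq> insert v (insert u \<sigma>)" for \<upsilon>
      proof -
        have "\<sigma> \<noteq> {}" using \<sigma> nonempty_simplex by (auto simp: simplices_def)
        then have "\<upsilon> \<noteq> {}" using that(1) by blast
        then have "\<upsilon> \<in> K" using face_closed[OF _ that(2)] True by blast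
        then show ?thesis using oriented by (auto simp: orientation_def)
      qed
      then have "incidence ori (insert v (insert u \<sigma>)) (insert u \<sigma>) * incidence ori (insert u \<sigma>) \<sigma>
        = - (incidence ori (insert v (insert u \<sigma>)) (insert v \<sigma>) * incidence ori (insert v \<sigma>) \<sigma>)"
        using True \<open>u \<noteq> v\<close> \<sigma> finite_simplex
        by (intro incidence_anticommute) (auto simp: simplices_def)
      moreover have "f (insert v (insert u \<sigma>)) \<in> carrier V" using cof2 True \<open>u \<noteq> v\<close> by blast
      ultimately show ?thesis
        using True \<open>u \<noteq> v\<close> unfolding F_def comm
        by (simp add: V.sign_scalar_anticommute incidence_cases)
    next
      case False
      then have "F u v = \<zero>\<^bsub>V\<^esub>" "F v u = \<zero>\<^bsub>V\<^esub>" by (auto simp: F_def comm)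
      then show ?thesis by simp
    qed
  qed (auto simp: F, simp add: F_def)
  finally show "bd (i - 1) (bd i f) \<sigma> = \<zero>\<^bsub>V_chains (i - 1 - 1)\<^esub> \<sigma>"
    using \<sigma> by (simp add: chains_zero)
qed (intro boundary_closed chains_zero_closed f)+

end

section \<open>Homology of complexes of subquotients\<close>

text \<open>A complex of subquotients of the spaces \<open>G i\<close> whose differential is induced by \<open>d\<close>.  Since \<open>q\<close> is
onto, everything known about \<open>d\<close> on \<open>Z\<close> is inherited by the differential of \<open>C\<close>.\<close>

locale subquotient_complex =
  fixes k :: "('k, 'x) ring_scheme" and G :: "int \<Rightarrow> ('k, 'v) module" and d :: "int \<Rightarrow> 'v \<Rightarrow> 'v"
    and Z N :: "int \<Rightarrow> 'v set" and C :: "('k, 'w) chain_complex" and q :: "int \<Rightarrow> 'v \<Rightarrow> 'w"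
  assumes subquotient: "\<And>i. subquotient k (G i) (Z i) (N i) (chain_space C i) (q i)"
    and d_closed: "\<And>i x. x \<in> Z i \<Longrightarrow> d i x \<in> Z (i - 1)"
    and d_add: "\<And>i x y. x \<in> Z i \<Longrightarrow> y \<in> Z i \<Longrightarrow>
      d i (x \<oplus>\<^bsub>G i\<^esub> y) = d i x \<oplus>\<^bsub>G (i - 1)\<^esub> d i y"
    and d_smult: "\<And>i a x. a \<in> carrier k \<Longrightarrow> x \<in> Z i \<Longrightarrow>
      d i (a \<odot>\<^bsub>G i\<^esub> x) = a \<odot>\<^bsub>G (i - 1)\<^esub> d i x"
    and d_d: "\<And>i x. x \<in> Z i \<Longrightarrow> d (i - 1) (d i x) = \<zero>\<^bsub>G (i - 1 - 1)\<^esub>"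
    and differential_q: "\<And>i x. x \<in> Z i \<Longrightarrow> differential C i (q i x) = q (i - 1) (d i x)"
begin

lemma differential_linear: "linear_map k (chain_space C i) (chain_space C (i - 1)) (differential C i)"
proof -
  interpret S: subquotient k "G i" "Z i" "N i" "chain_space C i" "q i" by (rule subquotient)
  interpret S': subquotient k "G (i - 1)" "Z (i - 1)" "N (i - 1)" "chain_space C (i - 1)" "q (i - 1)"
    by (rule subquotient)
  have "differential C i \<in> module_hom k (chain_space C i) (chain_space C (i - 1))"
    unfolding module_hom_def
  proof (intro CollectI conjI allI impI; (elim conjE)?)
    show "differential C i \<in> carrier (chain_space C i) \<rightarrow> carrier (chain_space C (i - 1))"
    proof
      fix y assume "y \<in> carrier (chain_space C i)"
      then obtain x where "x \<in> Z i" "q i x = y" by (rule S.lift)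
      then show "differential C i y \<in> carrier (chain_space C (i - 1))"
        using differential_q[of x i] S'.closed d_closed by auto
    qed
  next
    fix y y' assume "y \<in> carrier (chain_space C i)" "y' \<in> carrier (chain_space C i)"
    then obtain x x' where "x \<in> Z i" "q i x = y" "x' \<in> Z i" "q i x' = y'"
      by (metis S.lift)
    then show "differential C i (y \<oplus>\<^bsub>chain_space C i\<^esub> y') =
        differential C i y \<oplus>\<^bsub>chain_space C (i - 1)\<^esub> differential C i y'"
      using S.add[of x x'] differential_q S.Z(4)[of x x'] d_add d_closed S'.add by metis
  next
    fix a y assume a: "a \<in> carrier k" and "y \<in> carrier (chain_space C i)"
    then obtain x where "x \<in> Z i" "q i x = y" by (metis S.lift)
    then show "differential C i (a \<odot>\<^bsub>chain_space C i\<^esub> y) =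
        a \<odot>\<^bsub>chain_space C (i - 1)\<^esub> differential C i y"
      using a S.smult[of a x] differential_q S.Z(5)[of a x] d_smult d_closed S'.smult by metis
  qed
  then show ?thesis
    using S.vectorspace_image S'.vectorspace_image
    by (simp add: linear_map_def mod_hom_def mod_hom_axioms_def vectorspace_def)
qed

lemma cycles_subspace: "subspace k (cycles C i) (chain_space C i)"
proof -
  interpret f: linear_map k "chain_space C i" "chain_space C (i - 1)" "differential C i"
    by (rule differential_linear)
  show ?thesis using f.kerT_is_subspace by (simp add: f.ker_def cycles_def)
qed

lemma boundaries_subspace: "subspace k (boundaries C i) (chain_space C i)"
proof -
  interpret f: linear_map k "chain_space C (i + 1)" "chain_space C i" "differential C (i + 1)"
    using differential_linear[of "i + 1"] by simp
  show ?thesis using f.imT_is_subspace by (simp add: f.im_def boundaries_def)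
qed

lemma cycles_iff: "x \<in> Z i \<Longrightarrow> q i x \<in> cycles C i \<longleftrightarrow> d i x \<in> N (i - 1)"
proof -
  assume x: "x \<in> Z i"
  interpret S: subquotient k "G i" "Z i" "N i" "chain_space C i" "q i" by (rule subquotient)
  interpret S': subquotient k "G (i - 1)" "Z (i - 1)" "N (i - 1)" "chain_space C (i - 1)" "q (i - 1)"
    by (rule subquotient)
  show ?thesis
    using S.closed[OF x] S'.zero_iff[OF d_closed[OF x]] differential_q[OF x] by (simp add: cycles_def)
qed

lemma boundaries_iff:
  assumes x: "x \<in> Z i"
  shows "q i x \<in> boundaries C i \<longleftrightarrow> (\<exists>u\<in>Z (i + 1). x \<ominus>\<^bsub>G i\<^esub> d (i + 1) u \<in> N i)"
proof -
  interpret S: subquotient k "G i" "Z i" "N i" "chain_space C i" "q i" by (rule subquotient)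
  interpret S': subquotient k "G (i + 1)" "Z (i + 1)" "N (i + 1)" "chain_space C (i + 1)" "q (i + 1)"
    by (rule subquotient)
  have "boundaries C i = (\<lambda>u. q i (d (i + 1) u)) ` Z (i + 1)"
    unfolding boundaries_def S'.image[symmetric] using differential_q[of _ "i + 1"] by force
  moreover have "q i x = q i (d (i + 1) u) \<longleftrightarrow> x \<ominus>\<^bsub>G i\<^esub> d (i + 1) u \<in> N i" if "u \<in> Z (i + 1)" for u
    using S.eq_iff[OF x] d_closed[OF that] by simp
  ultimately show ?thesis by (auto simp: image_iff)
qed

lemma boundaries_cycles: "boundaries C i \<subseteq> cycles C i"
proof -
  interpret S: subquotient k "G (i - 1)" "Z (i - 1)" "N (i - 1)" "chain_space C (i - 1)" "q (i - 1)"
    by (rule subquotient)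
  interpret S': subquotient k "G (i + 1)" "Z (i + 1)" "N (i + 1)" "chain_space C (i + 1)" "q (i + 1)"
    by (rule subquotient)
  show ?thesis
  proof
    fix y assume "y \<in> boundaries C i"
    then obtain u where u: "u \<in> Z (i + 1)" "y = q i (d (i + 1) u)"
      unfolding boundaries_def S'.image[symmetric] using differential_q[of _ "i + 1"] by force
    have "d i (d (i + 1) u) = \<zero>\<^bsub>G (i - 1)\<^esub>" using d_d[OF u(1)] by simp
    then have "d i (d (i + 1) u) \<in> N (i - 1)" using S.zero_N by simp
    then show "y \<in> cycles C i" using u d_closed[OF u(1)] cycles_iff[of "d (i + 1) u" i] by simp
  qed
qed

text \<open>The space is represented by the elements whose boundary becomes zero in the quotient by \<open>N\<close>, and a
representative is trivial if it is a boundary up to an element of \<open>N\<close>.\<close>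

theorem homology_subquotient:
  "subquotient k (G i) {x \<in> Z i. d i x \<in> N (i - 1)}
     {x \<in> Z i. \<exists>u\<in>Z (i + 1). x \<ominus>\<^bsub>G i\<^esub> d (i + 1) u \<in> N i} (homology C i)
     (\<lambda>x. boundaries C i +>\<^bsub>(chain_space C i)\<lparr>carrier := cycles C i\<rparr>\<^esub> q i x)"
proof -
  interpret S: subquotient k "G i" "Z i" "N i" "chain_space C i" "q i" by (rule subquotient)
  let ?C = "(chain_space C i)\<lparr>carrier := cycles C i\<rparr>"
  interpret S': subquotient k "G i" "{x \<in> Z i. q i x \<in> cycles C i}" "N i" ?C "q i"
    by (rule S.subquotient_subspace[OF cycles_subspace])
  have "subspace k (boundaries C i) ?C"
    using subspaceD[OF boundaries_subspace[of i]] boundaries_cycles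
    by (intro subspaceI S'.vectorspace_image) auto
  note S'.subquotient_quotient[OF this]
  moreover have "{x \<in> Z i. q i x \<in> cycles C i} = {x \<in> Z i. d i x \<in> N (i - 1)}"
    using cycles_iff by blast
  moreover have "{x \<in> {x \<in> Z i. q i x \<in> cycles C i}. q i x \<in> boundaries C i} =
     {x \<in> Z i. \<exists>u\<in>Z (i + 1). x \<ominus>\<^bsub>G i\<^esub> d (i + 1) u \<in> N i}"
    using boundaries_iff boundaries_cycles by blast
  ultimately show ?thesis unfolding homology_def by simp
qed

text \<open>Passing to a quotient complex keeps \<open>Z\<close> and enlarges the kernel, so that the description of
homology applies to quotient complexes without further work.\<close>

theorem quotient_complex_subquotient:
  assumes T: "\<And>i. subspace k (carrier (chain_space D i)) (chain_space C i)"
    and diff: "\<And>i y. y \<in> carrier (chain_space D i) \<Longrightarrow>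
      differential C i y \<in> carrier (chain_space D (i - 1))"
  shows "subquotient_complex k G d Z (\<lambda>i. {x \<in> Z i. q i x \<in> carrier (chain_space D i)})
    (quotient_complex C D) (\<lambda>i x. carrier (chain_space D i) +>\<^bsub>chain_space C i\<^esub> q i x)"
proof (rule subquotient_complex.intro)
  fix i
  interpret S: subquotient k "G i" "Z i" "N i" "chain_space C i" "q i" by (rule subquotient)
  show "subquotient k (G i) (Z i) {x \<in> Z i. q i x \<in> carrier (chain_space D i)}
      (chain_space (quotient_complex C D) i)
      (\<lambda>x. carrier (chain_space D i) +>\<^bsub>chain_space C i\<^esub> q i x)"
    unfolding quotient_complex_def using S.subquotient_quotient[OF T] by simp
  fix x assume x: "x \<in> Z i"
  interpret f: linear_map k "chain_space C i" "chain_space C (i - 1)" "differential C i"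
    by (rule differential_linear)
  have c: "q i x \<in> carrier (chain_space C i)" by (rule S.closed[OF x])
  have "induced_map (chain_space C (i - 1)) (carrier (chain_space D (i - 1))) (differential C i)
      (carrier (chain_space D i) +>\<^bsub>chain_space C i\<^esub> q i x)
    = carrier (chain_space D (i - 1)) +>\<^bsub>chain_space C (i - 1)\<^esub> differential C i (q i x)"
    using c subspaceD(2)[OF T[of i]] diff by (intro induced_map_coset[OF T T]) auto
  then show "differential (quotient_complex C D) i
      (carrier (chain_space D i) +>\<^bsub>chain_space C i\<^esub> q i x)
    = carrier (chain_space D (i - 1)) +>\<^bsub>chain_space C (i - 1)\<^esub> q (i - 1) (d i x)"
    unfolding quotient_complex_def by (simp add: differential_q[OF x])
qed (use d_closed d_add d_smult d_d in blast)+

end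

section \<open>Relative homology of cosheaves of subquotients\<close>

context oriented_complex
begin

definition chains_in :: "('a set \<Rightarrow> 'v set) \<Rightarrow> 'a set set \<Rightarrow> int \<Rightarrow> ('a set \<Rightarrow> 'v) set" where
  "chains_in S L i = {f \<in> carrier (V_chains i).
     (\<forall>\<sigma>\<in>simplices K i. f \<sigma> \<in> S \<sigma>) \<and> (\<forall>\<sigma>\<in>simplices K i - L. f \<sigma> = \<zero>\<^bsub>V\<^esub>)}"

lemma chains_inD:
  assumes "f \<in> chains_in S L i"
  shows "f \<in> carrier (V_chains i)" "\<And>\<sigma>. \<sigma> \<in> simplices K i \<Longrightarrow> f \<sigma> \<in> S \<sigma>"
    "\<And>\<sigma>. \<sigma> \<in> simplices K i \<Longrightarrow> \<sigma> \<notin> L \<Longrightarrow> f \<sigma> = \<zero>\<^bsub>V\<^esub>"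
  using assms by (auto simp: chains_in_def)

lemma chains_in_subspace:
  assumes "\<And>\<sigma>. \<sigma> \<in> K \<Longrightarrow> subspace k (S \<sigma>) V"
  shows "subspace k (chains_in S L i) (V_chains i)"
proof (rule subspaceI)
  interpret V: vectorspace k V by (rule vectorspace)
  have S: "subspace k (S \<sigma>) V" if "\<sigma> \<in> simplices K i" for \<sigma>
    using assms that by (simp add: simplices_def)
  note S = subspaceD[OF S]
  show "vectorspace k (V_chains i)" by (rule vectorspace_chains)
  show "chains_in S L i \<subseteq> carrier (V_chains i)" by (auto simp: chains_in_def)
  show "\<zero>\<^bsub>V_chains i\<^esub> \<in> chains_in S L i"
    using S(3) by (simp add: chains_in_def chains_zero chains_zero_closed)
  show "x \<oplus>\<^bsub>V_chains i\<^esub> y \<in> chains_in S L i" if "x \<in> chains_in S L i" "y \<in> chains_in S L i" for x y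
    using that S(4) by (simp add: chains_in_def chains_add chains_add_closed)
  show "a \<odot>\<^bsub>V_chains i\<^esub> x \<in> chains_in S L i" if "a \<in> carrier k" "x \<in> chains_in S L i" for a x
    using that S(5) by (simp add: chains_in_def chains_smult chains_smult_closed)
qed

lemma chains_in_mono:
  assumes "f \<in> chains_in S L i" "\<And>\<sigma>. \<sigma> \<in> K \<Longrightarrow> S \<sigma> \<subseteq> S' \<sigma>"
  shows "f \<in> chains_in S' L i"
  using assms by (auto simp: chains_in_def simplices_def)

lemma boundary_chains_in:
  assumes S: "\<And>\<sigma>. \<sigma> \<in> K \<Longrightarrow> subspace k (S \<sigma>) V"
    and mono: "\<And>\<sigma> \<tau>. \<tau> \<in> K \<Longrightarrow> \<sigma> \<in> K \<Longrightarrow> \<sigma> \<subseteq> \<tau> \<Longrightarrow> S \<tau> \<subseteq> S \<sigma>"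
    and L: "L \<in> subcomplexes K" and f: "f \<in> chains_in S L i"
  shows "bd i f \<in> chains_in S L (i - 1)"
proof -
  note f = chains_inD[OF f]
  have "bd i f \<sigma> \<in> S \<sigma>" if "\<sigma> \<in> simplices K (i - 1)" for \<sigma>
  proof (rule boundary_in[OF f(1) that])
    show "subspace k (S \<sigma>) V" using S that by (simp add: simplices_def)
    show "f \<tau> \<in> S \<sigma>" if "\<tau> \<in> simplices K i" "\<sigma> \<subseteq> \<tau>" for \<tau>
      using f(2)[OF that(1)] mono[of \<tau> \<sigma>] that \<open>\<sigma> \<in> simplices K (i - 1)\<close>
      by (auto simp: simplices_def)
  qed
  moreover have "bd i f \<sigma> = \<zero>\<^bsub>V\<^esub>" if "\<sigma> \<in> simplices K (i - 1)" "\<sigma> \<notin> L" for \<sigma>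
  proof -
    have "bd i f \<sigma> \<in> {\<zero>\<^bsub>V\<^esub>}"
    proof (rule boundary_in[OF f(1) that(1) subspace_zero[OF vectorspace]])
      fix \<tau> assume "\<tau> \<in> simplices K i" "\<sigma> \<subseteq> \<tau>"
      moreover have "\<sigma> \<noteq> {}" using that(1) nonempty_simplex by (auto simp: simplices_def)
      ultimately have "\<tau> \<notin> L" using L that(2) by (auto simp: subcomplexes_def simplicial_complex_def)
      then show "f \<tau> \<in> {\<zero>\<^bsub>V\<^esub>}" using f(3) \<open>\<tau> \<in> simplices K i\<close> by simp
    qed
    then show ?thesis by simp
  qed
  ultimately show ?thesis using boundary_closed[OF f(1)] by (simp add: chains_in_def)
qed

end

text \<open>As \<open>Z \<tau> \<subseteq> Z \<sigma>\<close> for a face \<open>\<sigma>\<close> of \<open>\<tau>\<close>, the families of elements of the spaces \<open>Z \<sigma>\<close> form a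
subcomplex of the chains with coefficients in \<open>V\<close>, and the extension maps of \<open>A\<close> are induced by
inclusions.\<close>

locale subquotient_cosheaf = oriented_complex k V K ori
  for k :: "('k, 'x) ring_scheme" and V :: "('k, 'v) module"
    and K :: "'a set set" and ori :: "'a set \<Rightarrow> 'a rel" +
  fixes Z N :: "'a set \<Rightarrow> 'v set" and A :: "('a, 'k, 'w) cosheaf" and q :: "'a set \<Rightarrow> 'v \<Rightarrow> 'w"
  assumes stalk: "\<And>\<sigma>. \<sigma> \<in> K \<Longrightarrow> subquotient k V (Z \<sigma>) (N \<sigma>) (stalk A \<sigma>) (q \<sigma>)"
    and mono: "\<And>\<sigma> \<tau>. \<tau> \<in> K \<Longrightarrow> \<sigma> \<in> K \<Longrightarrow> \<sigma> \<subseteq> \<tau> \<Longrightarrow> Z \<tau> \<subseteq> Z \<sigma>"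
    and extension: "\<And>\<sigma> \<tau> x. \<tau> \<in> K \<Longrightarrow> \<sigma> \<in> K \<Longrightarrow> \<sigma> \<subseteq> \<tau> \<Longrightarrow> x \<in> Z \<tau> \<Longrightarrow>
      extension A \<tau> \<sigma> (q \<tau> x) = q \<sigma> x"
begin

definition chain_map :: "int \<Rightarrow> ('a set \<Rightarrow> 'v) \<Rightarrow> 'a set \<Rightarrow> 'w" where
  "chain_map i f = (\<lambda>\<sigma>\<in>simplices K i. q \<sigma> (f \<sigma>))"

lemma simplex_stalk:
  assumes "\<sigma> \<in> simplices K i"
  shows "subquotient k V (Z \<sigma>) (N \<sigma>) (stalk A \<sigma>) (q \<sigma>)"
  using assms stalk by (simp add: simplices_def)

lemma chain_space_subquotient:
  "subquotient k (V_chains i) (chains_in Z L i) (chains_in N L i)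
     (chain_space (chains_on ori K A L) i) (chain_map i)"
proof (rule subquotient.intro)
  note S = simplex_stalk
  show "subspace k (chains_in Z L i) (V_chains i)"
    by (rule chains_in_subspace) (rule subquotient.subspace_Z[OF stalk])
  show "chains_in N L i \<subseteq> chains_in Z L i"
    using subquotient.N_subset[OF S] by (fastforce simp: chains_in_def)
  have N: "subspace k (N \<sigma>) V" if "\<sigma> \<in> K" for \<sigma>
    by (rule subquotient.subspace_N[OF stalk[OF that]])
  show "\<zero>\<^bsub>V_chains i\<^esub> \<in> chains_in N L i"
    by (rule subspaceD(3)[OF chains_in_subspace[OF N]])
  show "chain_map i (f \<oplus>\<^bsub>V_chains i\<^esub> g) =
      chain_map i f \<oplus>\<^bsub>chain_space (chains_on ori K A L) i\<^esub> chain_map i g"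
    if "f \<in> chains_in Z L i" "g \<in> chains_in Z L i" for f g
    using that subquotient.add[OF S]
    by (auto simp: chain_map_def chains_on_def chain_module_def chains_in_def)
  show "chain_map i (a \<odot>\<^bsub>V_chains i\<^esub> f) =
      a \<odot>\<^bsub>chain_space (chains_on ori K A L) i\<^esub> chain_map i f"
    if "a \<in> carrier k" "f \<in> chains_in Z L i" for a f
    using that subquotient.smult[OF S]
    by (auto simp: chain_map_def chains_on_def chain_module_def chains_in_def)
  show "chain_map i f = \<zero>\<^bsub>chain_space (chains_on ori K A L) i\<^esub> \<longleftrightarrow> f \<in> chains_in N L i"
    if f: "f \<in> chains_in Z L i" for f
  proof -
    have "chain_map i f = \<zero>\<^bsub>chain_space (chains_on ori K A L) i\<^esub> \<longleftrightarrow>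
        (\<forall>\<sigma>\<in>simplices K i. q \<sigma> (f \<sigma>) = \<zero>\<^bsub>stalk A \<sigma>\<^esub>)"
      by (auto simp: chain_map_def chains_on_def chain_module_def fun_eq_iff restrict_def)
    also have "\<dots> \<longleftrightarrow> (\<forall>\<sigma>\<in>simplices K i. f \<sigma> \<in> N \<sigma>)"
      using subquotient.zero_iff[OF S] chains_inD(2)[OF f] by blast
    finally show ?thesis using f by (simp add: chains_in_def)
  qed
  show "chain_map i ` chains_in Z L i = carrier (chain_space (chains_on ori K A L) i)"
  proof
    show "chain_map i ` chains_in Z L i \<subseteq> carrier (chain_space (chains_on ori K A L) i)"
      using subquotient.closed[OF S] subquotient.zero[OF S]
      by (auto simp: chain_map_def chains_on_def chain_module_def chains_in_def)
    show "carrier (chain_space (chains_on ori K A L) i) \<subseteq> chain_map i ` chains_in Z L i"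
    proof
      fix g assume "g \<in> carrier (chain_space (chains_on ori K A L) i)"
      then have g: "g \<in> (\<Pi>\<^sub>E \<sigma>\<in>simplices K i. carrier (stalk A \<sigma>))"
        "\<And>\<sigma>. \<sigma> \<in> simplices K i \<Longrightarrow> \<sigma> \<notin> L \<Longrightarrow> g \<sigma> = \<zero>\<^bsub>stalk A \<sigma>\<^esub>"
        by (auto simp: chains_on_def chain_module_def)
      have "\<exists>x\<in>Z \<sigma>. q \<sigma> x = g \<sigma> \<and> (\<sigma> \<notin> L \<longrightarrow> x = \<zero>\<^bsub>V\<^esub>)" if \<sigma>: "\<sigma> \<in> simplices K i" for \<sigma>
      proof -
        interpret S: subquotient k V "Z \<sigma>" "N \<sigma>" "stalk A \<sigma>" "q \<sigma>" by (rule S[OF \<sigma>])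
        show ?thesis
        proof (cases "\<sigma> \<in> L")
          case True
          have "g \<sigma> \<in> carrier (stalk A \<sigma>)" using g(1) \<sigma> by auto
          then show ?thesis using True by (metis S.lift)
        next
          case False
          then show ?thesis using S.Z(3) S.zero g(2)[OF \<sigma>] by auto
        qed
      qed
      then obtain f where f: "\<And>\<sigma>. \<sigma> \<in> simplices K i \<Longrightarrow> f \<sigma> \<in> Z \<sigma>"
        "\<And>\<sigma>. \<sigma> \<in> simplices K i \<Longrightarrow> q \<sigma> (f \<sigma>) = g \<sigma>"
        "\<And>\<sigma>. \<sigma> \<in> simplices K i \<Longrightarrow> \<sigma> \<notin> L \<Longrightarrow> f \<sigma> = \<zero>\<^bsub>V\<^esub>"
        by metis
      have "restrict f (simplices K i) \<in> chains_in Z L i"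
        using f subquotient.Z_carrier[OF S] by (auto simp: chains_in_def chains_carrier)
      moreover have "chain_map i (restrict f (simplices K i)) = g"
        using f(2) g(1) by (auto simp: chain_map_def fun_eq_iff restrict_def PiE_def extensional_def)
      ultimately show "g \<in> chain_map i ` chains_in Z L i" by blast
    qed
  qed
qed

lemma boundary_chain_map:
  assumes f: "f \<in> chains_in Z L i"
  shows "boundary_map ori K A i (chain_map i f) = chain_map (i - 1) (bd i f)"
proof -
  have "(\<Oplus>\<^bsub>stalk A \<sigma>\<^esub>\<tau>\<in>{\<tau> \<in> simplices K i. \<sigma> \<subseteq> \<tau>}.
        [incidence ori \<tau> \<sigma>] \<cdot>\<^bsub>stalk A \<sigma>\<^esub> extension A \<tau> \<sigma> (chain_map i f \<tau>)) = q \<sigma> (bd i f \<sigma>)"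
    if \<sigma>: "\<sigma> \<in> simplices K (i - 1)" for \<sigma>
  proof -
    interpret S: subquotient k V "Z \<sigma>" "N \<sigma>" "stalk A \<sigma>" "q \<sigma>" by (rule simplex_stalk[OF \<sigma>])
    let ?T = "{\<tau> \<in> simplices K i. \<sigma> \<subseteq> \<tau>}"
    have fin: "finite ?T" using finite_complex by (auto simp: simplices_def)
    have fZ: "f \<tau> \<in> Z \<sigma>" if "\<tau> \<in> ?T" for \<tau>
      using chains_inD(2)[OF f, of \<tau>] mono[of \<tau> \<sigma>] that \<sigma> by (auto simp: simplices_def)
    have eq: "[incidence ori \<tau> \<sigma>] \<cdot>\<^bsub>V\<^esub> f \<tau> = sign_scalar k (incidence ori \<tau> \<sigma>) \<odot>\<^bsub>V\<^esub> f \<tau>"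
      if "\<tau> \<in> ?T" for \<tau>
      using fZ[OF that] S.Z_carrier by (intro S.V.add_pow_sign incidence_cases) auto
    have cl: "[incidence ori \<tau> \<sigma>] \<cdot>\<^bsub>V\<^esub> f \<tau> \<in> Z \<sigma>" if "\<tau> \<in> ?T" for \<tau>
      unfolding eq[OF that] using fZ[OF that] by (intro S.Z(5) S.V.sign_scalar_closed)
    have summand: "[incidence ori \<tau> \<sigma>] \<cdot>\<^bsub>stalk A \<sigma>\<^esub> extension A \<tau> \<sigma> (chain_map i f \<tau>) =
        q \<sigma> ([incidence ori \<tau> \<sigma>] \<cdot>\<^bsub>V\<^esub> f \<tau>)" if "\<tau> \<in> ?T" for \<tau>
    proof -
      have "extension A \<tau> \<sigma> (chain_map i f \<tau>) = q \<sigma> (f \<tau>)"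
        using that \<sigma> chains_inD(2)[OF f, of \<tau>] extension[of \<tau> \<sigma> "f \<tau>"]
        by (auto simp: chain_map_def simplices_def)
      then show ?thesis
        unfolding eq[OF that]
        using S.W.add_pow_sign[OF incidence_cases S.closed[OF fZ[OF that]]]
          S.smult[OF S.V.sign_scalar_closed fZ[OF that]] by simp
    qed
    have "bd i f \<sigma> = (\<Oplus>\<^bsub>V\<^esub>\<tau>\<in>?T. [incidence ori \<tau> \<sigma>] \<cdot>\<^bsub>V\<^esub> f \<tau>)"
      using \<sigma> by (simp add: boundary_map_def)
    then have "q \<sigma> (bd i f \<sigma>) = (\<Oplus>\<^bsub>stalk A \<sigma>\<^esub>\<tau>\<in>?T. q \<sigma> ([incidence ori \<tau> \<sigma>] \<cdot>\<^bsub>V\<^esub> f \<tau>))"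
      using S.finsum[OF fin cl] by simp
    also have "\<dots> = (\<Oplus>\<^bsub>stalk A \<sigma>\<^esub>\<tau>\<in>?T.
        [incidence ori \<tau> \<sigma>] \<cdot>\<^bsub>stalk A \<sigma>\<^esub> extension A \<tau> \<sigma> (chain_map i f \<tau>))"
    proof (rule S.W.finsum_cong'[OF refl])
      show "(\<lambda>\<tau>. [incidence ori \<tau> \<sigma>] \<cdot>\<^bsub>stalk A \<sigma>\<^esub> extension A \<tau> \<sigma> (chain_map i f \<tau>))
          \<in> ?T \<rightarrow> carrier (stalk A \<sigma>)"
        using S.closed[OF cl] summand by (intro Pi_I) metis
    qed (rule summand[symmetric])
    finally show ?thesis by (rule sym)
  qed
  then show ?thesis
    unfolding boundary_map_def[of ori K A] chain_map_def[of "i - 1"] by (intro restrict_ext)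
qed

lemma chains_on_subquotient:
  assumes L: "L \<in> subcomplexes K"
  shows "subquotient_complex k V_chains bd (chains_in Z L) (chains_in N L) (chains_on ori K A L) chain_map"
proof (rule subquotient_complex.intro)
  fix i
  show "subquotient k (V_chains i) (chains_in Z L i) (chains_in N L i)
      (chain_space (chains_on ori K A L) i) (chain_map i)"
    by (rule chain_space_subquotient)
  fix f assume f: "f \<in> chains_in Z L i"
  show "bd i f \<in> chains_in Z L (i - 1)"
    using boundary_chains_in[OF subquotient.subspace_Z[OF stalk] mono L f] by simp
  show "bd (i - 1) (bd i f) = \<zero>\<^bsub>V_chains (i - 1 - 1)\<^esub>"
    by (rule boundary_boundary[OF chains_inD(1)[OF f]])
  show "differential (chains_on ori K A L) i (chain_map i f) = chain_map (i - 1) (bd i f)"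
    using boundary_chain_map[OF f] by (simp add: chains_on_def)
  show "bd i (a \<odot>\<^bsub>V_chains i\<^esub> f) = a \<odot>\<^bsub>V_chains (i - 1)\<^esub> bd i f" if "a \<in> carrier k" for a
    by (rule boundary_smult[OF that chains_inD(1)[OF f]])
  fix g assume g: "g \<in> chains_in Z L i"
  show "bd i (f \<oplus>\<^bsub>V_chains i\<^esub> g) = bd i f \<oplus>\<^bsub>V_chains (i - 1)\<^esub> bd i g"
    by (rule boundary_add[OF chains_inD(1)[OF f] chains_inD(1)[OF g]])
qed

text \<open>The relative homology classes are represented by chains with values in \<open>Z\<close>; both conditions are
imposed only on simplices outside \<open>L'\<close>, as everything on \<open>L'\<close> is divided out.\<close>

theorem relative_homology_subquotient:
  assumes L: "L \<in> subcomplexes K" and L': "L' \<in> subcomplexes K" and sub: "L' \<subseteq> L"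
  obtains h where "subquotient k (V_chains s)
    {f \<in> chains_in Z L s. \<forall>\<sigma>\<in>simplices K (s - 1) - L'. bd s f \<sigma> \<in> N \<sigma>}
    {f \<in> chains_in Z L s. \<exists>u\<in>chains_in Z L (s + 1).
       \<forall>\<sigma>\<in>simplices K s - L'. f \<sigma> \<ominus>\<^bsub>V\<^esub> bd (s + 1) u \<sigma> \<in> N \<sigma>}
    (homology (quotient_complex (chains_on ori K A L) (chains_on ori K A L')) s) h"
proof -
  let ?C = "chains_on ori K A L" and ?D = "chains_on ori K A L'"
  interpret C: subquotient_complex k V_chains bd "chains_in Z L" "chains_in N L" ?C chain_map
    by (rule chains_on_subquotient[OF L])
  interpret D: subquotient_complex k V_chains bd "chains_in Z L'" "chains_in N L'" ?D chain_map
    by (rule chains_on_subquotient[OF L'])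
  have sub_carrier: "carrier (chain_space ?D i) \<subseteq> carrier (chain_space ?C i)" for i
    using sub by (auto simp: chains_on_def)
  have ops: "zero (chain_space ?D i) = zero (chain_space ?C i)"
    "add (chain_space ?D i) = add (chain_space ?C i)"
    "smult (chain_space ?D i) = smult (chain_space ?C i)" for i
    by (simp_all add: chains_on_def)
  have T: "subspace k (carrier (chain_space ?D i)) (chain_space ?C i)" for i
  proof (rule subspaceI)
    interpret CS: subquotient k "V_chains i" "chains_in Z L i" "chains_in N L i" "chain_space ?C i" "chain_map i"
      by (rule C.subquotient)
    interpret DS: subquotient k "V_chains i" "chains_in Z L' i" "chains_in N L' i" "chain_space ?D i" "chain_map i"
      by (rule D.subquotient)
    show "vectorspace k (chain_space ?C i)" by (rule CS.vectorspace_image)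
    show "carrier (chain_space ?D i) \<subseteq> carrier (chain_space ?C i)" by (rule sub_carrier)
    show "\<zero>\<^bsub>chain_space ?C i\<^esub> \<in> carrier (chain_space ?D i)"
      using DS.W.zero_closed unfolding ops .
    show "x \<oplus>\<^bsub>chain_space ?C i\<^esub> y \<in> carrier (chain_space ?D i)"
      if "x \<in> carrier (chain_space ?D i)" "y \<in> carrier (chain_space ?D i)" for x y
      using DS.W.a_closed[OF that] unfolding ops .
    show "a \<odot>\<^bsub>chain_space ?C i\<^esub> x \<in> carrier (chain_space ?D i)"
      if "a \<in> carrier k" "x \<in> carrier (chain_space ?D i)" for a x
      using DS.W.smult_closed[OF that] unfolding ops .
  qed
  have diff: "differential ?C i y \<in> carrier (chain_space ?D (i - 1))"
    if "y \<in> carrier (chain_space ?D i)" for i y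
  proof -
    interpret f: linear_map k "chain_space ?D i" "chain_space ?D (i - 1)" "differential ?D i"
      by (rule D.differential_linear)
    have "differential ?C i = differential ?D i" by (simp add: chains_on_def)
    then show ?thesis using f.T_im[OF that] by simp
  qed
  interpret Q: subquotient_complex k V_chains bd "chains_in Z L"
    "\<lambda>i. {f \<in> chains_in Z L i. chain_map i f \<in> carrier (chain_space ?D i)}" "quotient_complex ?C ?D"
    "\<lambda>i f. carrier (chain_space ?D i) +>\<^bsub>chain_space ?C i\<^esub> chain_map i f"
    by (rule C.quotient_complex_subquotient[OF T diff])
  have mem: "chain_map i f \<in> carrier (chain_space ?D i) \<longleftrightarrow> (\<forall>\<sigma>\<in>simplices K i - L'. f \<sigma> \<in> N \<sigma>)"
    if f: "f \<in> chains_in Z L i" for i f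
  proof -
    have "q \<sigma> (f \<sigma>) \<in> carrier (stalk A \<sigma>)" "q \<sigma> (f \<sigma>) = \<zero>\<^bsub>stalk A \<sigma>\<^esub> \<longleftrightarrow> f \<sigma> \<in> N \<sigma>"
      if "\<sigma> \<in> simplices K i" for \<sigma>
      using subquotient.closed[OF simplex_stalk[OF that]]
        subquotient.zero_iff[OF simplex_stalk[OF that]] chains_inD(2)[OF f that] by auto
    then show ?thesis
      by (auto simp: chain_map_def chains_on_def chain_module_def)
  qed
  have bdZ: "bd i f \<in> chains_in Z L (i - 1)" if "f \<in> chains_in Z L i" for i f
    by (rule C.d_closed[OF that])
  have cyc: "{f \<in> chains_in Z L s. bd s f \<in> {f \<in> chains_in Z L (s - 1).
        chain_map (s - 1) f \<in> carrier (chain_space ?D (s - 1))}}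
    = {f \<in> chains_in Z L s. \<forall>\<sigma>\<in>simplices K (s - 1) - L'. bd s f \<sigma> \<in> N \<sigma>}"
    using bdZ mem by blast
  have minus: "f \<ominus>\<^bsub>V_chains s\<^esub> bd (s + 1) u \<in> {f \<in> chains_in Z L s. chain_map s f \<in> carrier (chain_space ?D s)}
      \<longleftrightarrow> (\<forall>\<sigma>\<in>simplices K s - L'. f \<sigma> \<ominus>\<^bsub>V\<^esub> bd (s + 1) u \<sigma> \<in> N \<sigma>)"
    if f: "f \<in> chains_in Z L s" and u: "u \<in> chains_in Z L (s + 1)" for f u
  proof -
    have b: "bd (s + 1) u \<in> chains_in Z L s" using bdZ[OF u] by simp
    have m: "f \<ominus>\<^bsub>V_chains s\<^esub> bd (s + 1) u \<in> chains_in Z L s"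
      by (rule subspaceD(7)[OF subquotient.subspace_Z[OF chain_space_subquotient] f b])
    show ?thesis
      using m mem[OF m] chains_minus[OF chains_inD(1)[OF f] chains_inD(1)[OF b]] by simp
  qed
  have bdry: "{f \<in> chains_in Z L s. \<exists>u\<in>chains_in Z L (s + 1). f \<ominus>\<^bsub>V_chains s\<^esub> bd (s + 1) u
        \<in> {f \<in> chains_in Z L s. chain_map s f \<in> carrier (chain_space ?D s)}}
    = {f \<in> chains_in Z L s. \<exists>u\<in>chains_in Z L (s + 1).
       \<forall>\<sigma>\<in>simplices K s - L'. f \<sigma> \<ominus>\<^bsub>V\<^esub> bd (s + 1) u \<sigma> \<in> N \<sigma>}"
    using minus by blast
  show ?thesis by (rule that) (rule Q.homology_subquotient[of s, unfolded cyc bdry])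
qed

end

section \<open>Cosheaves that differ by an acyclic one\<close>

context oriented_complex
begin

text \<open>The homology of the pair \<open>(L, L')\<close> with coefficients in the subspaces \<open>S \<sigma>\<close> vanishes in all degrees,
expressed with chains of \<open>L\<close> in place of cosets.\<close>

definition relatively_acyclic :: "('a set \<Rightarrow> 'v set) \<Rightarrow> 'a set set \<Rightarrow> 'a set set \<Rightarrow> bool" where
  "relatively_acyclic S L L' \<longleftrightarrow> (\<forall>i. \<forall>f\<in>chains_in S L i.
     (\<forall>\<sigma>\<in>simplices K (i - 1) - L'. bd i f \<sigma> = \<zero>\<^bsub>V\<^esub>) \<longrightarrow>
     (\<exists>w\<in>chains_in S L (i + 1). \<forall>\<sigma>\<in>simplices K i - L'. bd (i + 1) w \<sigma> = f \<sigma>))"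

text \<open>Acyclicity also fills chains that have values in \<open>N\<close> only outside \<open>L'\<close>: setting such a chain to zero
on \<open>L'\<close> leaves its boundary outside \<open>L'\<close> unchanged, since no coface of a simplex outside the
subcomplex \<open>L'\<close> lies in \<open>L'\<close>.\<close>

lemma acyclic_filling:
  assumes N: "\<And>\<sigma>. \<sigma> \<in> K \<Longrightarrow> subspace k (N \<sigma>) V"
    and acyclic: "relatively_acyclic N L L'" and L': "L' \<in> subcomplexes K"
    and g: "g \<in> carrier (V_chains i)" "\<And>\<sigma>. \<sigma> \<in> simplices K i - L \<Longrightarrow> g \<sigma> = \<zero>\<^bsub>V\<^esub>"
    and gN: "\<And>\<sigma>. \<sigma> \<in> simplices K i - L' \<Longrightarrow> g \<sigma> \<in> N \<sigma>"
    and cycle: "\<And>\<sigma>. \<sigma> \<in> simplices K (i - 1) - L' \<Longrightarrow> bd i g \<sigma> = \<zero>\<^bsub>V\<^esub>"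
  obtains w where "w \<in> chains_in N L (i + 1)"
    "\<And>\<sigma>. \<sigma> \<in> simplices K i - L' \<Longrightarrow> bd (i + 1) w \<sigma> = g \<sigma>"
proof -
  interpret V: vectorspace k V by (rule vectorspace)
  define g' where "g' = (\<lambda>\<sigma>\<in>simplices K i. if \<sigma> \<in> L' then \<zero>\<^bsub>V\<^esub> else g \<sigma>)"
  have N0: "\<zero>\<^bsub>V\<^esub> \<in> N \<sigma>" if "\<sigma> \<in> simplices K i" for \<sigma>
    using subspaceD(3)[OF N] that by (simp add: simplices_def)
  have g': "g' \<in> carrier (V_chains i)"
    using chain_closed[OF g(1)] unfolding g'_def chains_carrier by auto
  have "g' \<in> chains_in N L i"
    using g' g(2) gN N0 by (auto simp: chains_in_def g'_def)
  moreover have "bd i g' \<sigma> = \<zero>\<^bsub>V\<^esub>" if "\<sigma> \<in> simplices K (i - 1) - L'" for \<sigma>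
  proof -
    have "g' \<tau> = g \<tau>" if "\<tau> \<in> simplices K i" "\<sigma> \<subseteq> \<tau>" for \<tau>
    proof -
      have "\<sigma> \<noteq> {}" using \<open>\<sigma> \<in> simplices K (i - 1) - L'\<close> nonempty_simplex by (auto simp: simplices_def)
      then have "\<tau> \<notin> L'"
        using L' that \<open>\<sigma> \<in> simplices K (i - 1) - L'\<close>
        unfolding subcomplexes_def simplicial_complex_def by blast
      then show ?thesis using that by (simp add: g'_def)
    qed
    then have "bd i g' \<sigma> = bd i g \<sigma>" using that by (intro boundary_cong[OF g' g(1)]) auto
    then show ?thesis using cycle[OF that] by simp
  qed
  ultimately obtain w where w: "w \<in> chains_in N L (i + 1)"
    "\<And>\<sigma>. \<sigma> \<in> simplices K i - L' \<Longrightarrow> bd (i + 1) w \<sigma> = g' \<sigma>"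
    using acyclic unfolding relatively_acyclic_def by blast
  show ?thesis by (rule that[OF w(1)]) (simp add: w(2), simp add: g'_def)
qed

text \<open>This is the part of the long exact sequence of \<open>0 \<rightarrow> N \<rightarrow> Z \<rightarrow> Z / N \<rightarrow> 0\<close> that is needed here.  A cycle
modulo \<open>N\<close> has a boundary with values in \<open>N\<close>, and subtracting a filling of this boundary in \<open>N\<close> makes
it a cycle, so the induced map on homology is onto.  A cycle that is a boundary modulo \<open>N\<close> differs
from this boundary by a cycle with values in \<open>N\<close>, which is itself a boundary, so the map is
one-to-one.\<close>

theorem relative_homology_isomorphic:
  assumes A: "subquotient_cosheaf k V K ori Z (\<lambda>_. {\<zero>\<^bsub>V\<^esub>}) A q"
    and A': "subquotient_cosheaf k V K ori Z N A' q'"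
    and L: "L \<in> subcomplexes K" and L': "L' \<in> subcomplexes K" and sub: "L' \<subseteq> L"
    and acyclic: "relatively_acyclic N L L'"
  shows "isomorphic_spaces k
    (homology (quotient_complex (chains_on ori K A L) (chains_on ori K A L')) s)
    (homology (quotient_complex (chains_on ori K A' L) (chains_on ori K A' L')) s)"
proof -
  interpret V: vectorspace k V by (rule vectorspace)
  interpret A: subquotient_cosheaf k V K ori Z "\<lambda>_. {\<zero>\<^bsub>V\<^esub>}" A q by (rule A)
  interpret A': subquotient_cosheaf k V K ori Z N A' q' by (rule A')
  have Z: "subspace k (Z \<sigma>) V" and N: "subspace k (N \<sigma>) V" and NZ: "N \<sigma> \<subseteq> Z \<sigma>"
    if "\<sigma> \<in> K" for \<sigma>
    using subquotient.subspace_Z[OF A'.stalk[OF that]] subquotient.subspace_N[OF A'.stalk[OF that]]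
      subquotient.N_subset[OF A'.stalk[OF that]] by auto
  have N0: "\<zero>\<^bsub>V\<^esub> \<in> N \<sigma>" if "\<sigma> \<in> simplices K i" for \<sigma> i
    using subspaceD(3)[OF N] that by (simp add: simplices_def)
  note subspace_ZL = chains_in_subspace[of Z L, OF Z]
  have bdZ: "bd i f \<in> chains_in Z L (i - 1)" if "f \<in> chains_in Z L i" for i f
    by (rule boundary_chains_in[OF Z A'.mono L that])
  have bd_bd: "bd (i - 1) (bd i f) \<sigma> = \<zero>\<^bsub>V\<^esub>"
    if "f \<in> chains_in Z L i" "\<sigma> \<in> simplices K (i - 1 - 1)" for i f \<sigma>
    unfolding boundary_boundary[OF chains_inD(1)[OF that(1)]] by (rule chains_zero[OF that(2)])
  let ?Z = "\<lambda>N. {f \<in> chains_in Z L s. \<forall>\<sigma>\<in>simplices K (s - 1) - L'. bd s f \<sigma> \<in> N \<sigma>}"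
  let ?B = "\<lambda>N. {f \<in> chains_in Z L s. \<exists>u\<in>chains_in Z L (s + 1).
       \<forall>\<sigma>\<in>simplices K s - L'. f \<sigma> \<ominus>\<^bsub>V\<^esub> bd (s + 1) u \<sigma> \<in> N \<sigma>}"
  obtain h where h: "subquotient k (V_chains s) (?Z (\<lambda>_. {\<zero>\<^bsub>V\<^esub>})) (?B (\<lambda>_. {\<zero>\<^bsub>V\<^esub>}))
    (homology (quotient_complex (chains_on ori K A L) (chains_on ori K A L')) s) h"
    by (rule A.relative_homology_subquotient[OF L L' sub])
  obtain h' where h': "subquotient k (V_chains s) (?Z N) (?B N)
    (homology (quotient_complex (chains_on ori K A' L) (chains_on ori K A' L')) s) h'"
    by (rule A'.relative_homology_subquotient[OF L L' sub])
  show ?thesis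
  proof (rule isomorphic_subquotients[OF h h'])
    show "?Z (\<lambda>_. {\<zero>\<^bsub>V\<^esub>}) \<subseteq> ?Z N" using N0 by auto
    show "?B (\<lambda>_. {\<zero>\<^bsub>V\<^esub>}) = ?Z (\<lambda>_. {\<zero>\<^bsub>V\<^esub>}) \<inter> ?B N"
    proof
      show "?B (\<lambda>_. {\<zero>\<^bsub>V\<^esub>}) \<subseteq> ?Z (\<lambda>_. {\<zero>\<^bsub>V\<^esub>}) \<inter> ?B N"
      proof
        fix f assume f: "f \<in> ?B (\<lambda>_. {\<zero>\<^bsub>V\<^esub>})"
        then obtain u where u: "f \<in> chains_in Z L s" "u \<in> chains_in Z L (s + 1)"
          "\<forall>\<sigma>\<in>simplices K s - L'. f \<sigma> \<ominus>\<^bsub>V\<^esub> bd (s + 1) u \<sigma> \<in> {\<zero>\<^bsub>V\<^esub>}"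
          by blast
        have "f \<sigma> \<ominus>\<^bsub>V\<^esub> bd (s + 1) u \<sigma> \<in> N \<sigma>" if "\<sigma> \<in> simplices K s - L'" for \<sigma>
        proof -
          have "f \<sigma> \<ominus>\<^bsub>V\<^esub> bd (s + 1) u \<sigma> = \<zero>\<^bsub>V\<^esub>" using u(3) that by blast
          then show ?thesis using N0[of \<sigma> s] that by simp
        qed
        then have "f \<in> ?B N" using u(1,2) by blast
        moreover have "f \<in> ?Z (\<lambda>_. {\<zero>\<^bsub>V\<^esub>})" using subquotient.N_subset[OF h] f by (rule subsetD)
        ultimately show "f \<in> ?Z (\<lambda>_. {\<zero>\<^bsub>V\<^esub>}) \<inter> ?B N" by (rule IntI[rotated])
      qed
      show "?Z (\<lambda>_. {\<zero>\<^bsub>V\<^esub>}) \<inter> ?B N \<subseteq> ?B (\<lambda>_. {\<zero>\<^bsub>V\<^esub>})"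
      proof
        fix f assume "f \<in> ?Z (\<lambda>_. {\<zero>\<^bsub>V\<^esub>}) \<inter> ?B N"
        then obtain u where f: "f \<in> chains_in Z L s"
          and cyc: "\<And>\<sigma>. \<sigma> \<in> simplices K (s - 1) - L' \<Longrightarrow> bd s f \<sigma> = \<zero>\<^bsub>V\<^esub>"
          and u: "u \<in> chains_in Z L (s + 1)"
          and fu: "\<And>\<sigma>. \<sigma> \<in> simplices K s - L' \<Longrightarrow> f \<sigma> \<ominus>\<^bsub>V\<^esub> bd (s + 1) u \<sigma> \<in> N \<sigma>"
          by auto
        have du: "bd (s + 1) u \<in> chains_in Z L s" using bdZ[OF u] by simp
        let ?g = "f \<ominus>\<^bsub>V_chains s\<^esub> bd (s + 1) u"
        have g: "?g \<in> chains_in Z L s" by (rule subspaceD(7)[OF subspace_ZL f du])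
        have g_eq: "?g \<sigma> = f \<sigma> \<ominus>\<^bsub>V\<^esub> bd (s + 1) u \<sigma>" if "\<sigma> \<in> simplices K s" for \<sigma>
          by (rule chains_minus[OF chains_inD(1)[OF f] chains_inD(1)[OF du] that])
        have "bd s ?g \<sigma> = \<zero>\<^bsub>V\<^esub>" if \<sigma>: "\<sigma> \<in> simplices K (s - 1) - L'" for \<sigma>
        proof -
          have "bd s (bd (s + 1) u) \<sigma> = \<zero>\<^bsub>V\<^esub>" using bd_bd[OF u, of \<sigma>] \<sigma> by simp
          then show ?thesis
            using boundary_minus[OF chains_inD(1)[OF f] chains_inD(1)[OF du], of \<sigma>] cyc[OF \<sigma>] \<sigma>
            by simp
        qed
        then obtain w where w: "w \<in> chains_in N L (s + 1)"
          "\<And>\<sigma>. \<sigma> \<in> simplices K s - L' \<Longrightarrow> bd (s + 1) w \<sigma> = ?g \<sigma>"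
          using acyclic_filling[OF N acyclic L' chains_inD(1)[OF g], of thesis] chains_inD(3)[OF g] g_eq fu
          by auto
        have wZ: "w \<in> chains_in Z L (s + 1)" by (rule chains_in_mono[OF w(1) NZ])
        have dw: "bd (s + 1) w \<in> chains_in Z L s" using bdZ[OF wZ] by simp
        have uw: "u \<oplus>\<^bsub>V_chains (s + 1)\<^esub> w \<in> chains_in Z L (s + 1)"
          by (rule subspaceD(4)[OF subspace_ZL u wZ])
        have "f \<sigma> \<ominus>\<^bsub>V\<^esub> bd (s + 1) (u \<oplus>\<^bsub>V_chains (s + 1)\<^esub> w) \<sigma> = \<zero>\<^bsub>V\<^esub>"
          if \<sigma>: "\<sigma> \<in> simplices K s - L'" for \<sigma>
        proof -
          have c: "f \<sigma> \<in> carrier V" "bd (s + 1) u \<sigma> \<in> carrier V"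
            using \<sigma> chain_closed[OF chains_inD(1)[OF f]] chain_closed[OF chains_inD(1)[OF du]] by auto
          have "bd (s + 1) (u \<oplus>\<^bsub>V_chains (s + 1)\<^esub> w) \<sigma> = bd (s + 1) u \<sigma> \<oplus>\<^bsub>V\<^esub> bd (s + 1) w \<sigma>"
            using boundary_add[OF chains_inD(1)[OF u] chains_inD(1)[OF wZ]] \<sigma> by (simp add: chains_add)
          also have "\<dots> = bd (s + 1) u \<sigma> \<oplus>\<^bsub>V\<^esub> (f \<sigma> \<ominus>\<^bsub>V\<^esub> bd (s + 1) u \<sigma>)"
            using w(2)[OF \<sigma>] g_eq \<sigma> by simp
          also have "\<dots> = f \<sigma>"
            using c by (simp add: a_minus_def V.a_lcomm V.r_neg)
          finally show ?thesis using c by simp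
        qed
        then show "f \<in> ?B (\<lambda>_. {\<zero>\<^bsub>V\<^esub>})" using f uw by blast
      qed
    qed
    fix f assume "f \<in> ?Z N"
    then have f: "f \<in> chains_in Z L s"
      and fN: "\<And>\<sigma>. \<sigma> \<in> simplices K (s - 1) - L' \<Longrightarrow> bd s f \<sigma> \<in> N \<sigma>"
      by auto
    have df: "bd s f \<in> chains_in Z L (s - 1)" by (rule bdZ[OF f])
    obtain w where w: "w \<in> chains_in N L (s - 1 + 1)"
      "\<And>\<sigma>. \<sigma> \<in> simplices K (s - 1) - L' \<Longrightarrow> bd (s - 1 + 1) w \<sigma> = bd s f \<sigma>"
    proof (rule acyclic_filling[OF N acyclic L' chains_inD(1)[OF df], of thesis])
      show "\<sigma> \<in> simplices K (s - 1) - L \<Longrightarrow> bd s f \<sigma> = \<zero>\<^bsub>V\<^esub>" for \<sigma>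
        using chains_inD(3)[OF df] by blast
      show "\<sigma> \<in> simplices K (s - 1 - 1) - L' \<Longrightarrow> bd (s - 1) (bd s f) \<sigma> = \<zero>\<^bsub>V\<^esub>" for \<sigma>
        using bd_bd[OF f] by blast
    qed (use fN in auto)
    then have w: "w \<in> chains_in N L s"
      "\<And>\<sigma>. \<sigma> \<in> simplices K (s - 1) - L' \<Longrightarrow> bd s w \<sigma> = bd s f \<sigma>"
      by auto
    have wZ: "w \<in> chains_in Z L s" by (rule chains_in_mono[OF w(1) NZ])
    let ?x = "f \<ominus>\<^bsub>V_chains s\<^esub> w"
    have x: "?x \<in> chains_in Z L s" by (rule subspaceD(7)[OF subspace_ZL f wZ])
    have "bd s ?x \<sigma> = \<zero>\<^bsub>V\<^esub>" if \<sigma>: "\<sigma> \<in> simplices K (s - 1) - L'" for \<sigma>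
    proof -
      have "bd s f \<sigma> \<in> carrier V" using chain_closed[OF chains_inD(1)[OF df]] \<sigma> by blast
      then show ?thesis
        using boundary_minus[OF chains_inD(1)[OF f] chains_inD(1)[OF wZ], of \<sigma>] \<sigma> w(2)[OF \<sigma>] by simp
    qed
    then have xZ: "?x \<in> ?Z (\<lambda>_. {\<zero>\<^bsub>V\<^esub>})" using x by blast
    interpret U: vectorspace k "V_chains s" by (rule vectorspace_chains)
    have "f \<ominus>\<^bsub>V_chains s\<^esub> ?x = w"
      using chains_inD(1)[OF f] chains_inD(1)[OF w(1)]
      by (simp add: a_minus_def U.minus_add U.minus_minus U.r_neg flip: U.a_assoc)
    moreover have "w \<in> ?B N"
    proof -
      have z: "\<zero>\<^bsub>V_chains (s + 1)\<^esub> \<in> chains_in Z L (s + 1)" by (rule subspaceD(3)[OF subspace_ZL])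
      have "w \<sigma> \<ominus>\<^bsub>V\<^esub> bd (s + 1) \<zero>\<^bsub>V_chains (s + 1)\<^esub> \<sigma> \<in> N \<sigma>" if \<sigma>: "\<sigma> \<in> simplices K s" for \<sigma>
      proof -
        have "bd (s + 1) \<zero>\<^bsub>V_chains (s + 1)\<^esub> \<sigma> \<in> {\<zero>\<^bsub>V\<^esub>}"
          using \<sigma> by (intro boundary_in[OF chains_zero_closed _ subspace_zero[OF vectorspace]])
            (auto simp: chains_zero)
        then show ?thesis
          using subspaceD(7)[OF N chains_inD(2)[OF w(1) \<sigma>] N0[OF \<sigma>]] \<sigma> by (simp add: simplices_def)
      qed
      then show ?thesis using wZ z by blast
    qed
    ultimately have "f \<ominus>\<^bsub>V_chains s\<^esub> ?x \<in> ?B N" by simp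
    then show "\<exists>x\<in>?Z (\<lambda>_. {\<zero>\<^bsub>V\<^esub>}). f \<ominus>\<^bsub>V_chains s\<^esub> x \<in> ?B N" using xZ by blast
  qed
qed

end

section \<open>An acyclicity criterion on order complexes\<close>

lemma order_complexD:
  assumes "\<sigma> \<in> order_complex R"
  shows "\<sigma> \<subseteq> R" "finite \<sigma>" "\<sigma> \<noteq> {}" "\<And>a b. a \<in> \<sigma> \<Longrightarrow> b \<in> \<sigma> \<Longrightarrow> a \<le> b \<or> b \<le> a"
  using assms by (auto simp: order_complex_def Complete_Partial_Order.chain_def)

lemma order_complexI:
  assumes "\<sigma> \<subseteq> R" "finite \<sigma>" "\<sigma> \<noteq> {}" "\<And>a b. a \<in> \<sigma> \<Longrightarrow> b \<in> \<sigma> \<Longrightarrow> a \<le> b \<or> b \<le> a"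
  shows "\<sigma> \<in> order_complex R"
  using assms by (auto simp: order_complex_def Complete_Partial_Order.chain_def)

lemma order_complex_subset:
  assumes "\<tau> \<in> order_complex R" "\<sigma> \<subseteq> \<tau>" "\<sigma> \<noteq> {}"
  shows "\<sigma> \<in> order_complex R"
  using order_complexD[OF assms(1)] assms(2,3) finite_subset[OF assms(2)]
  by (intro order_complexI) (auto simp: subset_iff)

lemma simplicial_order_complex: "simplicial_complex (order_complex R)"
  unfolding simplicial_complex_def using order_complexD(2,3) order_complex_subset by metis

lemma finite_order_complex: "finite R \<Longrightarrow> finite (order_complex R)"
  by (rule finite_subset[of _ "Pow R"]) (auto simp: order_complex_def)

lemma chain_min:
  assumes "\<sigma> \<in> order_complex R"
  shows "chain_min \<sigma> \<in> \<sigma>" "\<And>a. a \<in> \<sigma> \<Longrightarrow> chain_min \<sigma> \<le> a"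
proof -
  note \<sigma> = order_complexD[OF assms]
  obtain m where m: "m \<in> \<sigma>" "\<And>a. a \<in> \<sigma> \<Longrightarrow> a \<le> m \<Longrightarrow> m = a"
    using finite_has_minimal[OF \<sigma>(2,3)] by blast
  then have least: "m \<le> a" if "a \<in> \<sigma>" for a using \<sigma>(4)[of m a] that by auto
  have "chain_min \<sigma> = m" by (rule Least_equality) (use m least in auto)
  then show "chain_min \<sigma> \<in> \<sigma>" "\<And>a. a \<in> \<sigma> \<Longrightarrow> chain_min \<sigma> \<le> a" using m least by auto
qed

lemma chain_min_eqI:
  assumes "a \<in> \<sigma>" "\<And>x. x \<in> \<sigma> \<Longrightarrow> a \<le> x"
  shows "chain_min \<sigma> = a"
  using assms by (rule Least_equality)

lemma chain_max:
  assumes "\<sigma> \<in> order_complex R"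
  shows "chain_max \<sigma> \<in> \<sigma>" "\<And>a. a \<in> \<sigma> \<Longrightarrow> a \<le> chain_max \<sigma>"
proof -
  note \<sigma> = order_complexD[OF assms]
  obtain m where m: "m \<in> \<sigma>" "\<And>a. a \<in> \<sigma> \<Longrightarrow> m \<le> a \<Longrightarrow> m = a"
    using finite_has_maximal[OF \<sigma>(2,3)] by blast
  then have greatest: "a \<le> m" if "a \<in> \<sigma>" for a using \<sigma>(4)[of m a] that by auto
  have "chain_max \<sigma> = m" by (rule Greatest_equality) (use m greatest in auto)
  then show "chain_max \<sigma> \<in> \<sigma>" "\<And>a. a \<in> \<sigma> \<Longrightarrow> a \<le> chain_max \<sigma>" using m greatest by auto
qed

lemma chain_max_subcomplex:
  assumes down: "\<And>a b. a \<le> b \<Longrightarrow> Q b \<Longrightarrow> Q a"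
  shows "{\<sigma> \<in> order_complex R. Q (chain_max \<sigma>)} \<in> subcomplexes (order_complex R)"
proof -
  have "\<sigma> \<in> order_complex R \<and> Q (chain_max \<sigma>)"
    if "\<tau> \<in> order_complex R" "Q (chain_max \<tau>)" "\<sigma> \<subseteq> \<tau>" "\<sigma> \<noteq> {}" for \<sigma> \<tau>
  proof -
    have \<sigma>: "\<sigma> \<in> order_complex R" by (rule order_complex_subset[OF that(1,3,4)])
    then have "chain_max \<sigma> \<le> chain_max \<tau>" using chain_max(1)[OF \<sigma>] chain_max(2)[OF that(1)] that(3) by blast
    then show ?thesis using \<sigma> down that(2) by blast
  qed
  moreover have "finite \<sigma> \<and> \<sigma> \<noteq> {}" if "\<sigma> \<in> order_complex R" for \<sigma>
    using order_complexD(2,3)[OF that] by (rule conjI)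
  ultimately show ?thesis
    unfolding subcomplexes_def simplicial_complex_def by simp blast
qed

lemma chains_below_subcomplex:
  "{\<sigma> \<in> order_complex R. chain_max \<sigma> \<le> r} \<in> subcomplexes (order_complex R)"
  "{\<sigma> \<in> order_complex R. chain_max \<sigma> < r} \<in> subcomplexes (order_complex R)"
  by (rule chain_max_subcomplex, erule order_trans, assumption)
    (rule chain_max_subcomplex, erule order_le_less_trans, assumption)

text \<open>The map \<open>g\<close> retracts \<open>R\<close> onto its fixed points, going down and preserving the order, and the spaces
\<open>S a\<close> and \<open>S (g a)\<close> agree.  For a fixed point \<open>a\<close>, the elements \<open>x\<close> with
\<open>a \<le> g x\<close> are those above \<open>a\<close>, so \<open>g\<close> is final as a map to the fixed points, and the derived
colimit of \<open>S\<close> can be computed on them.  As \<open>r\<close> is not fixed, the elements \<open>\<le> r\<close> and those \<open>< r\<close> have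
the same fixed points, so the relative homology at \<open>r\<close> has to vanish.\<close>

locale order_complex_retraction = oriented_complex k V "order_complex R" ori
  for k :: "('k, 'x) ring_scheme" and V :: "('k, 'v) module"
    and R :: "'r::order set" and ori :: "'r set \<Rightarrow> 'r rel" +
  fixes r :: 'r and g :: "'r \<Rightarrow> 'r" and S :: "'r \<Rightarrow> 'v set"
  assumes g_closed: "\<And>a. a \<in> R \<Longrightarrow> g a \<in> R"
    and g_le: "\<And>a. a \<in> R \<Longrightarrow> g a \<le> a"
    and g_idem: "\<And>a. a \<in> R \<Longrightarrow> g (g a) = g a"
    and g_mono: "\<And>a b. a \<in> R \<Longrightarrow> b \<in> R \<Longrightarrow> a \<le> b \<Longrightarrow> g a \<le> g b"
    and g_r: "g r \<noteq> r"
    and S_subspace: "\<And>a. a \<in> R \<Longrightarrow> subspace k (S a) V"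
    and S_g: "\<And>a. a \<in> R \<Longrightarrow> S a \<subseteq> S (g a)"
    and S_mono: "\<And>a b. a \<in> R \<Longrightarrow> b \<in> R \<Longrightarrow> a \<le> b \<Longrightarrow> S a \<subseteq> S b"
begin

abbreviation "K \<equiv> order_complex R"

definition top_chains :: "'r set set" where
  "top_chains = {\<sigma> \<in> K. r \<in> \<sigma> \<and> (\<forall>a\<in>\<sigma>. a \<le> r)}"

definition moved :: "'r set \<Rightarrow> 'r set" where
  "moved \<sigma> = {a \<in> \<sigma>. g a \<noteq> a}"

text \<open>A chain and the chain obtained by inserting or deleting its pivot have the same moved elements,
hence the same pivot.  This makes the toggling of the pivot an involution.\<close>

definition pivot :: "'r set \<Rightarrow> 'r" where
  "pivot \<sigma> = g (chain_min (moved \<sigma>))"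

lemma top_chain_iff:
  "\<sigma> \<in> K \<Longrightarrow> \<sigma> \<in> top_chains \<longleftrightarrow> chain_max \<sigma> \<le> r \<and> \<not> chain_max \<sigma> < r"
  unfolding top_chains_def using chain_max[of \<sigma> R]
  by (auto simp: order_less_le intro: order_trans) (metis order_antisym)

lemma top_chains_coface:
  "\<sigma> \<in> top_chains \<Longrightarrow> \<sigma> \<subseteq> \<tau> \<Longrightarrow> \<tau> \<in> K \<Longrightarrow> chain_max \<tau> \<le> r \<Longrightarrow> \<tau> \<in> top_chains"
  unfolding top_chains_def using chain_max(2)[of \<tau> R] by (auto intro: order_trans)

context
  fixes \<sigma> assumes \<sigma>: "\<sigma> \<in> top_chains"
begin

lemma in_K: "\<sigma> \<in> K"
  using \<sigma> by (simp add: top_chains_def)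

lemma moved_in_K: "moved \<sigma> \<in> K"
  by (rule order_complex_subset[OF in_K]) (use \<sigma> g_r in \<open>auto simp: moved_def top_chains_def\<close>)

lemma least_moved:
  shows "chain_min (moved \<sigma>) \<in> \<sigma>" "g (chain_min (moved \<sigma>)) \<noteq> chain_min (moved \<sigma>)"
    "\<And>a. a \<in> \<sigma> \<Longrightarrow> g a \<noteq> a \<Longrightarrow> chain_min (moved \<sigma>) \<le> a" "chain_min (moved \<sigma>) \<in> R"
  using chain_min[OF moved_in_K] order_complexD(1)[OF in_K] by (auto simp: moved_def)

lemma pivot:
  shows "pivot \<sigma> \<in> R" "pivot \<sigma> \<le> chain_min (moved \<sigma>)" "g (pivot \<sigma>) = pivot \<sigma>" "pivot \<sigma> \<le> r" "pivot \<sigma> \<noteq> r"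
proof -
  show "pivot \<sigma> \<in> R" "g (pivot \<sigma>) = pivot \<sigma>" and le: "pivot \<sigma> \<le> chain_min (moved \<sigma>)"
    using least_moved(4) g_closed g_idem g_le by (auto simp: pivot_def)
  then show "pivot \<sigma> \<noteq> r" using g_r by auto
  have "chain_min (moved \<sigma>) \<le> r" using least_moved(1) \<sigma> by (auto simp: top_chains_def)
  then show "pivot \<sigma> \<le> r" using le by (rule order_trans[rotated])
qed

lemma pivot_comparable:
  assumes "a \<in> \<sigma>"
  shows "chain_min (moved \<sigma>) \<le> a \<or> g a = a \<and> a \<le> pivot \<sigma>"
proof (cases "chain_min (moved \<sigma>) \<le> a")
  case False
  then have le: "a \<le> chain_min (moved \<sigma>)" and "g a = a"
    using order_complexD(4)[OF in_K assms least_moved(1)] least_moved(3)[OF assms] by auto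
  moreover have "g a \<le> pivot \<sigma>"
    unfolding pivot_def using le assms order_complexD(1)[OF in_K] least_moved(4)
    by (intro g_mono) auto
  ultimately show ?thesis by simp
qed simp

lemma insert_pivot: "insert (pivot \<sigma>) \<sigma> \<in> top_chains"
proof -
  have comp: "a \<le> pivot \<sigma> \<or> pivot \<sigma> \<le> a" if "a \<in> \<sigma>" for a
    using pivot_comparable[OF that] pivot(2) order_trans by blast
  have "insert (pivot \<sigma>) \<sigma> \<in> K"
  proof (rule order_complexI)
    fix a b assume "a \<in> insert (pivot \<sigma>) \<sigma>" "b \<in> insert (pivot \<sigma>) \<sigma>"
    then show "a \<le> b \<or> b \<le> a" using comp order_complexD(4)[OF in_K, of a b] by auto
  qed (use order_complexD(1,2)[OF in_K] pivot(1) in auto)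
  then show ?thesis using \<sigma> pivot(4) by (auto simp: top_chains_def)
qed

lemma remove_pivot: "\<sigma> - {pivot \<sigma>} \<in> top_chains"
proof -
  have "r \<in> \<sigma> - {pivot \<sigma>}" using \<sigma> pivot(5) by (auto simp: top_chains_def)
  moreover have "\<sigma> - {pivot \<sigma>} \<in> K" using order_complex_subset[OF in_K, of "\<sigma> - {pivot \<sigma>}"] calculation by blast
  ultimately show ?thesis using \<sigma> by (auto simp: top_chains_def)
qed

text \<open>Deleting the pivot can only enlarge the minimum from \<open>g m\<close> to \<open>m\<close>, where \<open>m\<close> is the least moved
element, and \<open>S\<close> has the same value at both: a fixed element below \<open>m\<close> is also below \<open>g m\<close>.\<close>

lemma S_remove_pivot:
  assumes "pivot \<sigma> \<in> \<sigma>"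
  shows "S (chain_min (\<sigma> - {pivot \<sigma>})) \<subseteq> S (chain_min \<sigma>)"
proof -
  let ?\<sigma>' = "\<sigma> - {pivot \<sigma>}" and ?m = "chain_min (moved \<sigma>)"
  let ?c = "chain_min ?\<sigma>'"
  have K': "?\<sigma>' \<in> K" using remove_pivot by (simp add: top_chains_def)
  note c = chain_min[OF K']
  have m: "?m \<in> ?\<sigma>'" using least_moved(1,2) pivot(3) by auto
  show ?thesis
  proof (cases "g ?c = ?c")
    case True
    have "?c \<in> R" using c(1) order_complexD(1)[OF in_K] by blast
    then have "g ?c \<le> g ?m" using least_moved(4) c(2)[OF m] by (rule g_mono)
    then have "g ?c \<le> pivot \<sigma>" unfolding pivot_def .
    have "chain_min \<sigma> = ?c"
    proof (rule chain_min_eqI)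
      show "?c \<in> \<sigma>" using c(1) by blast
      fix x assume "x \<in> \<sigma>"
      then show "?c \<le> x" using c(2)[of x] \<open>g ?c \<le> pivot \<sigma>\<close> True by (cases "x = pivot \<sigma>") auto
    qed
    then show ?thesis by simp
  next
    case False
    then have "?m \<le> ?c" using c(1) least_moved(3) by blast
    then have eq: "?c = ?m" using c(2)[OF m] by simp
    have "chain_min \<sigma> = pivot \<sigma>"
    proof (rule chain_min_eqI[OF assms])
      fix x assume "x \<in> \<sigma>"
      then show "pivot \<sigma> \<le> x" using c(2)[of x] eq pivot(2) by (cases "x = pivot \<sigma>") auto
    qed
    then show ?thesis using S_g[OF least_moved(4)] eq by (simp add: pivot_def)
  qed
qed

end

lemma pivot_cong: "moved \<sigma> = moved \<tau> \<Longrightarrow> pivot \<sigma> = pivot \<tau>"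
  by (simp add: pivot_def)

lemma moved_insert:
  "moved (insert a \<sigma>) = (if g a = a then moved \<sigma> else insert a (moved \<sigma>))"
  by (auto simp: moved_def)

lemma moved_remove_pivot: "\<sigma> \<in> top_chains \<Longrightarrow> moved (\<sigma> - {pivot \<sigma>}) = moved \<sigma>"
  using pivot(3) by (auto simp: moved_def)

abbreviation below :: "'r set set" where
  "below \<equiv> {\<sigma> \<in> K. chain_max \<sigma> \<le> r}"

abbreviation strictly_below :: "'r set set" where
  "strictly_below \<equiv> {\<sigma> \<in> K. chain_max \<sigma> < r}"

abbreviation coefficients :: "int \<Rightarrow> ('r set \<Rightarrow> 'v) set" where
  "coefficients \<equiv> chains_in (\<lambda>\<sigma>. S (chain_min \<sigma>)) below"

lemma S_chain_min: "\<sigma> \<in> K \<Longrightarrow> subspace k (S (chain_min \<sigma>)) V"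
  using chain_min(1) order_complexD(1) by (intro S_subspace) blast

lemma S_chain_min_mono:
  assumes "\<tau> \<in> K" "\<sigma> \<in> K" "\<sigma> \<subseteq> \<tau>"
  shows "S (chain_min \<tau>) \<subseteq> S (chain_min \<sigma>)"
  using chain_min[OF assms(1)] chain_min[OF assms(2)] order_complexD(1)[OF assms(1)] assms(3)
  by (intro S_mono) auto

lemma coefficients_outside:
  assumes "f \<in> coefficients i" "\<sigma> \<in> simplices K i" "\<sigma> \<notin> strictly_below" "\<sigma> \<notin> top_chains"
  shows "f \<sigma> = \<zero>\<^bsub>V\<^esub>"
  using chains_inD(3)[OF assms(1,2)] assms(2-4) top_chain_iff[of \<sigma>] by (auto simp: simplices_def)

text \<open>The insertion of the pivot, extended linearly: the value at \<open>\<tau>\<close> comes from the chain whose pivot was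
inserted to get \<open>\<tau>\<close>.  The sign makes \<open>\<tau>\<close> contribute with coefficient one to the boundary at
\<open>\<tau> - {pivot \<tau>}\<close>.\<close>

definition toggle :: "int \<Rightarrow> ('r set \<Rightarrow> 'v) \<Rightarrow> 'r set \<Rightarrow> 'v" where
  "toggle i f = (\<lambda>\<tau>\<in>simplices K (i + 1). if \<tau> \<in> top_chains \<and> pivot \<tau> \<in> \<tau>
     then sign_scalar k (incidence ori \<tau> (\<tau> - {pivot \<tau>})) \<odot>\<^bsub>V\<^esub> f (\<tau> - {pivot \<tau>}) else \<zero>\<^bsub>V\<^esub>)"

lemma remove_pivot_simplices:
  assumes "\<tau> \<in> simplices K (i + 1)" "\<tau> \<in> top_chains" "pivot \<tau> \<in> \<tau>"
  shows "\<tau> - {pivot \<tau>} \<in> simplices K i"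
  using assms remove_pivot[OF assms(2)] order_complexD(2)[of \<tau> R]
    card_Suc_Diff1[of \<tau> "pivot \<tau>"]
  by (auto simp: simplices_def top_chains_def)

lemma toggle_closed:
  assumes f: "f \<in> coefficients i"
  shows "toggle i f \<in> coefficients (i + 1)"
proof -
  interpret V: vectorspace k V by (rule vectorspace)
  have in_S: "toggle i f \<tau> \<in> S (chain_min \<tau>)" if \<tau>: "\<tau> \<in> simplices K (i + 1)" for \<tau>
  proof -
    have S: "subspace k (S (chain_min \<tau>)) V" using \<tau> by (intro S_chain_min) (simp add: simplices_def)
    show ?thesis
    proof (cases "\<tau> \<in> top_chains \<and> pivot \<tau> \<in> \<tau>")
      case True
      then have "f (\<tau> - {pivot \<tau>}) \<in> S (chain_min \<tau>)"
        using chains_inD(2)[OF f remove_pivot_simplices[OF \<tau>]] S_remove_pivot[of \<tau>] by blast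
      then have "sign_scalar k n \<odot>\<^bsub>V\<^esub> f (\<tau> - {pivot \<tau>}) \<in> S (chain_min \<tau>)" for n
        by (rule subspaceD(5)[OF S V.sign_scalar_closed])
      then show ?thesis using \<tau> True by (simp add: toggle_def)
    next
      case False
      then have "toggle i f \<tau> = \<zero>\<^bsub>V\<^esub>" using \<tau> by (auto simp: toggle_def)
      then show ?thesis using subspaceD(3)[OF S] by simp
    qed
  qed
  have "toggle i f \<tau> \<in> carrier V" if \<tau>: "\<tau> \<in> simplices K (i + 1)" for \<tau>
    using subspaceD(2)[OF S_chain_min, of \<tau>] in_S[OF \<tau>] \<tau> by (auto simp: simplices_def)
  then have "toggle i f \<in> carrier (V_chains (i + 1))"
    unfolding chains_carrier by (auto simp: toggle_def)
  moreover have "toggle i f \<tau> = \<zero>\<^bsub>V\<^esub>" if "\<tau> \<in> simplices K (i + 1)" "\<tau> \<notin> below" for \<tau>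
    using that top_chain_iff[of \<tau>] by (auto simp: toggle_def simplices_def)
  ultimately show ?thesis using in_S by (simp add: chains_in_def)
qed

lemma boundary_toggle_zero:
  assumes f: "f \<in> coefficients i" and \<sigma>: "\<sigma> \<in> simplices K i"
    and vanish: "\<And>\<tau>. \<tau> \<in> simplices K i \<Longrightarrow> \<tau> \<in> top_chains \<Longrightarrow> moved \<sigma> \<subseteq> moved \<tau> \<Longrightarrow> f \<tau> = \<zero>\<^bsub>V\<^esub>"
  shows "bd (i + 1) (toggle i f) \<sigma> = \<zero>\<^bsub>V\<^esub>"
proof -
  interpret V: vectorspace k V by (rule vectorspace)
  have "bd (i + 1) (toggle i f) \<sigma> \<in> {\<zero>\<^bsub>V\<^esub>}"
  proof (rule boundary_in[OF chains_inD(1)[OF toggle_closed[OF f]] _ subspace_zero[OF vectorspace]])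
    show "\<sigma> \<in> simplices K (i + 1 - 1)" using \<sigma> by simp
    fix \<tau> assume \<tau>: "\<tau> \<in> simplices K (i + 1)" "\<sigma> \<subseteq> \<tau>"
    show "toggle i f \<tau> \<in> {\<zero>\<^bsub>V\<^esub>}"
    proof (cases "\<tau> \<in> top_chains \<and> pivot \<tau> \<in> \<tau>")
      case True
      moreover have "moved \<sigma> \<subseteq> moved (\<tau> - {pivot \<tau>})"
        using moved_remove_pivot[of \<tau>] True \<tau>(2) by (auto simp: moved_def)
      ultimately have "f (\<tau> - {pivot \<tau>}) = \<zero>\<^bsub>V\<^esub>"
        using vanish remove_pivot_simplices[OF \<tau>(1)] remove_pivot by blast
      then show ?thesis using \<tau> True by (simp add: toggle_def V.sign_scalar_closed)
    qed (use \<tau> in \<open>auto simp: toggle_def\<close>)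
  qed
  then show ?thesis by simp
qed

text \<open>Only the coface with the pivot contributes to the boundary at \<open>\<sigma>\<close>: a coface by another fixed vertex
has the same pivot and does not contain it, and a coface by a moved vertex has more moved elements.\<close>

lemma boundary_toggle_pivot:
  assumes f: "f \<in> coefficients i" and \<sigma>: "\<sigma> \<in> simplices K i" "\<sigma> \<in> top_chains" "pivot \<sigma> \<notin> \<sigma>"
    and vanish: "\<And>\<tau>. \<tau> \<in> simplices K i \<Longrightarrow> \<tau> \<in> top_chains \<Longrightarrow> moved \<sigma> \<subset> moved \<tau> \<Longrightarrow> f \<tau> = \<zero>\<^bsub>V\<^esub>"
  shows "bd (i + 1) (toggle i f) \<sigma> = f \<sigma>"
proof -
  interpret V: vectorspace k V by (rule vectorspace)
  let ?p = "pivot \<sigma>" and ?w = "toggle i f"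
  let ?e = "sign_scalar k (incidence ori (insert ?p \<sigma>) \<sigma>)"
  have \<sigma>': "\<sigma> \<in> simplices K (i + 1 - 1)" using \<sigma>(1) by simp
  have pK: "insert ?p \<sigma> \<in> top_chains" "insert ?p \<sigma> \<in> K"
    using insert_pivot[OF \<sigma>(2)] by (auto simp: top_chains_def)
  have "bd (i + 1) ?w \<sigma> = ?e \<odot>\<^bsub>V\<^esub> ?w (insert ?p \<sigma>)"
  proof (rule boundary_single_coface[OF chains_inD(1)[OF toggle_closed[OF f]] \<sigma>' \<sigma>(3) pK(2)])
    fix u assume u: "u \<noteq> ?p" "u \<notin> \<sigma>" "insert u \<sigma> \<in> K"
    let ?\<tau> = "insert u \<sigma>"
    have \<tau>: "?\<tau> \<in> simplices K (i + 1)" by (rule coface_simplices[OF \<sigma>' u(2,3)])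
    show "?w ?\<tau> = \<zero>\<^bsub>V\<^esub>"
    proof (cases "?\<tau> \<in> top_chains \<and> pivot ?\<tau> \<in> ?\<tau>")
      case True
      have "g u \<noteq> u"
      proof
        assume "g u = u"
        then have "pivot ?\<tau> = ?p" by (intro pivot_cong) (simp add: moved_insert)
        then show False using True u(1) \<sigma>(3) by auto
      qed
      then have "moved \<sigma> \<subset> moved (?\<tau> - {pivot ?\<tau>})"
        using moved_remove_pivot[of ?\<tau>] True u(2) by (auto simp: moved_insert moved_def)
      then have "f (?\<tau> - {pivot ?\<tau>}) = \<zero>\<^bsub>V\<^esub>"
        using vanish remove_pivot_simplices[OF \<tau>] remove_pivot True by blast
      then show ?thesis using \<tau> True by (simp add: toggle_def V.sign_scalar_closed)
    qed (use \<tau> in \<open>auto simp: toggle_def\<close>)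
  qed
  also have "?w (insert ?p \<sigma>) = ?e \<odot>\<^bsub>V\<^esub> f \<sigma>"
  proof -
    have "pivot (insert ?p \<sigma>) = ?p"
      using pivot(3)[OF \<sigma>(2)] by (intro pivot_cong) (simp add: moved_insert)
    moreover have "insert ?p \<sigma> - {?p} = \<sigma>" using \<sigma>(3) by auto
    moreover have "insert ?p \<sigma> \<in> simplices K (i + 1)" by (rule coface_simplices[OF \<sigma>' \<sigma>(3) pK(2)])
    ultimately show ?thesis using pK(1) by (simp add: toggle_def)
  qed
  also have "?e \<odot>\<^bsub>V\<^esub> (?e \<odot>\<^bsub>V\<^esub> f \<sigma>) = f \<sigma>"
    by (rule V.sign_scalar_cancel[OF incidence_cases chain_closed[OF chains_inD(1)[OF f] \<sigma>(1)]])
  finally show ?thesis .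
qed

lemma finite_moved: "\<sigma> \<in> K \<Longrightarrow> finite (moved \<sigma>)"
  unfolding moved_def by (rule finite_subset[OF _ order_complexD(2)]) auto

text \<open>The chains with maximum \<open>r\<close> on which \<open>f\<close> is supported have fewer than \<open>n\<close> moved elements, and the proof
is by induction on \<open>n\<close>.  In the step from \<open>n\<close> to \<open>Suc n\<close>, subtracting the boundary of
\<open>toggle i f\<close> kills the values of \<open>f\<close> on the chains with exactly \<open>n\<close> moved elements that do not contain
their pivot.  On the chains with \<open>n\<close> moved elements that do contain it, the result
then has to vanish because it is a cycle: at the chain without the pivot, its boundary has only one
summand left.\<close>

lemma relative_cycle_bounds:
  assumes "f \<in> coefficients i"
    and "\<And>\<sigma>. \<sigma> \<in> simplices K (i - 1) - strictly_below \<Longrightarrow> bd i f \<sigma> = \<zero>\<^bsub>V\<^esub>"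
    and "\<And>\<sigma>. \<sigma> \<in> simplices K i \<Longrightarrow> \<sigma> \<in> top_chains \<Longrightarrow> n \<le> card (moved \<sigma>) \<Longrightarrow> f \<sigma> = \<zero>\<^bsub>V\<^esub>"
  shows "\<exists>w\<in>coefficients (i + 1). \<forall>\<sigma>\<in>simplices K i - strictly_below. bd (i + 1) w \<sigma> = f \<sigma>"
  using assms
proof (induction n arbitrary: f)
  case 0
  have "f \<sigma> = \<zero>\<^bsub>V\<^esub>" if "\<sigma> \<in> simplices K i - strictly_below" for \<sigma>
    using 0(3) coefficients_outside[OF 0(1)] that by blast
  moreover have "bd (i + 1) \<zero>\<^bsub>V_chains (i + 1)\<^esub> \<sigma> = \<zero>\<^bsub>V\<^esub>" if "\<sigma> \<in> simplices K i" for \<sigma>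
  proof -
    have "bd (i + 1) \<zero>\<^bsub>V_chains (i + 1)\<^esub> \<sigma> \<in> {\<zero>\<^bsub>V\<^esub>}"
      using that by (intro boundary_in[OF chains_zero_closed _ subspace_zero[OF vectorspace]])
        (auto simp: chains_zero)
    then show ?thesis by simp
  qed
  moreover have "\<zero>\<^bsub>V_chains (i + 1)\<^esub> \<in> coefficients (i + 1)"
    by (rule subspaceD(3)[OF chains_in_subspace[OF S_chain_min]])
  ultimately show ?case by (intro bexI) auto
next
  case (Suc n)
  note f = Suc.prems(1) and cycle = Suc.prems(2) and vanish = Suc.prems(3)
  interpret V: vectorspace k V by (rule vectorspace)
  let ?w = "toggle i f"
  let ?f' = "f \<ominus>\<^bsub>V_chains i\<^esub> bd (i + 1) ?w"
  have w: "?w \<in> coefficients (i + 1)" by (rule toggle_closed[OF f])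
  have dw: "bd (i + 1) ?w \<in> coefficients i"
    using boundary_chains_in[OF S_chain_min S_chain_min_mono chains_below_subcomplex(1) w] by simp
  have f': "?f' \<in> coefficients i"
    by (rule subspaceD(7)[OF chains_in_subspace[OF S_chain_min] f dw])
  have f'_eq: "?f' \<sigma> = f \<sigma> \<ominus>\<^bsub>V\<^esub> bd (i + 1) ?w \<sigma>" "f \<sigma> \<in> carrier V" if "\<sigma> \<in> simplices K i" for \<sigma>
    using chains_minus[OF chains_inD(1)[OF f] chains_inD(1)[OF dw] that]
      chain_closed[OF chains_inD(1)[OF f] that] by auto
  have cycle': "bd i ?f' \<sigma> = \<zero>\<^bsub>V\<^esub>" if \<sigma>: "\<sigma> \<in> simplices K (i - 1) - strictly_below" for \<sigma>
  proof -
    have "bd i (bd (i + 1) ?w) \<sigma> = \<zero>\<^bsub>V\<^esub>"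
      using boundary_boundary[OF chains_inD(1)[OF w]] chains_zero[of \<sigma> "i - 1"] \<sigma> by simp
    then show ?thesis
      using boundary_minus[OF chains_inD(1)[OF f] chains_inD(1)[OF dw], of \<sigma>] cycle[OF \<sigma>] \<sigma> by simp
  qed
  have many: "?f' \<sigma> = \<zero>\<^bsub>V\<^esub>"
    if \<sigma>: "\<sigma> \<in> simplices K i" "\<sigma> \<in> top_chains" "Suc n \<le> card (moved \<sigma>)" for \<sigma>
  proof -
    have "bd (i + 1) ?w \<sigma> = \<zero>\<^bsub>V\<^esub>"
    proof (rule boundary_toggle_zero[OF f \<sigma>(1)])
      fix \<tau> assume \<tau>: "\<tau> \<in> simplices K i" "\<tau> \<in> top_chains" "moved \<sigma> \<subseteq> moved \<tau>"
      then have "card (moved \<sigma>) \<le> card (moved \<tau>)"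
        by (intro card_mono finite_moved) (auto simp: simplices_def)
      then show "f \<tau> = \<zero>\<^bsub>V\<^esub>" using vanish \<tau> \<sigma>(3) by auto
    qed
    then show ?thesis using f'_eq[OF \<sigma>(1)] vanish[OF \<sigma>] by simp
  qed
  have no_pivot: "?f' \<sigma> = \<zero>\<^bsub>V\<^esub>"
    if \<sigma>: "\<sigma> \<in> simplices K i" "\<sigma> \<in> top_chains" "n \<le> card (moved \<sigma>)" "pivot \<sigma> \<notin> \<sigma>" for \<sigma>
  proof -
    have "bd (i + 1) ?w \<sigma> = f \<sigma>"
    proof (rule boundary_toggle_pivot[OF f \<sigma>(1,2,4)])
      fix \<tau> assume \<tau>: "\<tau> \<in> simplices K i" "\<tau> \<in> top_chains" "moved \<sigma> \<subset> moved \<tau>"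
      then have "card (moved \<sigma>) < card (moved \<tau>)"
        by (intro psubset_card_mono finite_moved) (auto simp: simplices_def)
      then show "f \<tau> = \<zero>\<^bsub>V\<^esub>" using vanish \<tau> \<sigma>(3) by auto
    qed
    then show ?thesis using f'_eq[OF \<sigma>(1)] by simp
  qed
  have vanish': "?f' \<sigma> = \<zero>\<^bsub>V\<^esub>"
    if \<sigma>: "\<sigma> \<in> simplices K i" "\<sigma> \<in> top_chains" "n \<le> card (moved \<sigma>)" for \<sigma>
  proof (cases "pivot \<sigma> \<in> \<sigma>")
    case False
    then show ?thesis by (rule no_pivot[OF \<sigma>])
  next
    case True
    let ?p = "pivot \<sigma>" and ?\<rho> = "\<sigma> - {pivot \<sigma>}"
    let ?e = "sign_scalar k (incidence ori \<sigma> ?\<rho>)"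
    have \<rho>: "?\<rho> \<in> simplices K (i - 1)" "?\<rho> \<in> top_chains" "?\<rho> \<in> K"
      using remove_pivot_simplices[of \<sigma> "i - 1"] remove_pivot[OF \<sigma>(2)] \<sigma> True
      by (auto simp: top_chains_def)
    have ins: "insert ?p ?\<rho> = \<sigma>" using True by auto
    \<comment> \<open>Every other coface with maximum \<open>r\<close> lacks its pivot or has more than \<open>n\<close> moved elements.\<close>
    have "bd i ?f' ?\<rho> = sign_scalar k (incidence ori (insert ?p ?\<rho>) ?\<rho>) \<odot>\<^bsub>V\<^esub> ?f' (insert ?p ?\<rho>)"
    proof (rule boundary_single_coface[OF chains_inD(1)[OF f'] \<rho>(1)])
      fix u assume u: "u \<noteq> ?p" "u \<notin> ?\<rho>" "insert u ?\<rho> \<in> K"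
      let ?\<tau> = "insert u ?\<rho>"
      have \<tau>: "?\<tau> \<in> simplices K i" by (rule coface_simplices[OF \<rho>(1) u(2,3)])
      show "?f' ?\<tau> = \<zero>\<^bsub>V\<^esub>"
      proof (cases "chain_max ?\<tau> \<le> r")
        case False
        then show ?thesis using chains_inD(3)[OF f' \<tau>] by simp
      next
        case below: True
        have top: "?\<tau> \<in> top_chains" by (rule top_chains_coface[OF \<rho>(2) subset_insertI u(3) below])
        have moved_\<rho>: "moved ?\<rho> = moved \<sigma>" by (rule moved_remove_pivot[OF \<sigma>(2)])
        show ?thesis
        proof (cases "g u = u")
          case True
          then have moved_\<tau>: "moved ?\<tau> = moved \<sigma>" by (simp add: moved_insert moved_\<rho>)
          then have "pivot ?\<tau> = ?p" by (rule pivot_cong)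
          then have "pivot ?\<tau> \<notin> ?\<tau>" using u(1) by auto
          then show ?thesis using no_pivot[OF \<tau> top] \<sigma>(3) moved_\<tau> by simp
        next
          case False
          then have "moved ?\<tau> = insert u (moved \<sigma>)" by (simp add: moved_insert moved_\<rho>)
          moreover have "u \<notin> moved \<sigma>" using u(1,2) by (auto simp: moved_def)
          moreover have "finite (moved \<sigma>)" using \<sigma>(1) by (intro finite_moved) (simp add: simplices_def)
          ultimately have "Suc n \<le> card (moved ?\<tau>)" using \<sigma>(3) by simp
          then show ?thesis by (rule many[OF \<tau> top])
        qed
      qed
    qed (use ins \<sigma>(1) in \<open>auto simp: simplices_def\<close>)
    moreover have "bd i ?f' ?\<rho> = \<zero>\<^bsub>V\<^esub>"
      using cycle' \<rho> top_chain_iff[OF \<rho>(3)] by blast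
    ultimately have "?e \<odot>\<^bsub>V\<^esub> ?f' \<sigma> = \<zero>\<^bsub>V\<^esub>" using ins by simp
    then have "?e \<odot>\<^bsub>V\<^esub> (?e \<odot>\<^bsub>V\<^esub> ?f' \<sigma>) = \<zero>\<^bsub>V\<^esub>" by (simp add: V.sign_scalar_closed)
    then show ?thesis
      unfolding V.sign_scalar_cancel[OF incidence_cases chain_closed[OF chains_inD(1)[OF f'] \<sigma>(1)]] .
  qed
  obtain w' where w': "w' \<in> coefficients (i + 1)"
    "\<And>\<sigma>. \<sigma> \<in> simplices K i - strictly_below \<Longrightarrow> bd (i + 1) w' \<sigma> = ?f' \<sigma>"
    using Suc.IH[OF f' cycle' vanish'] by blast
  have sum: "?w \<oplus>\<^bsub>V_chains (i + 1)\<^esub> w' \<in> coefficients (i + 1)"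
    by (rule subspaceD(4)[OF chains_in_subspace[OF S_chain_min] w w'(1)])
  have "bd (i + 1) (?w \<oplus>\<^bsub>V_chains (i + 1)\<^esub> w') \<sigma> = f \<sigma>"
    if \<sigma>: "\<sigma> \<in> simplices K i - strictly_below" for \<sigma>
  proof -
    have c: "f \<sigma> \<in> carrier V" "bd (i + 1) ?w \<sigma> \<in> carrier V"
      using \<sigma> chain_closed[OF chains_inD(1)[OF f]] chain_closed[OF chains_inD(1)[OF dw]] by auto
    have "bd (i + 1) (?w \<oplus>\<^bsub>V_chains (i + 1)\<^esub> w') \<sigma> = bd (i + 1) ?w \<sigma> \<oplus>\<^bsub>V\<^esub> bd (i + 1) w' \<sigma>"
      using boundary_add[OF chains_inD(1)[OF w] chains_inD(1)[OF w'(1)]] \<sigma> by (simp add: chains_add)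
    also have "\<dots> = bd (i + 1) ?w \<sigma> \<oplus>\<^bsub>V\<^esub> (f \<sigma> \<ominus>\<^bsub>V\<^esub> bd (i + 1) ?w \<sigma>)"
      using w'(2)[OF \<sigma>] f'_eq(1) \<sigma> by simp
    also have "\<dots> = f \<sigma>"
      using c by (simp add: a_minus_def V.a_lcomm V.r_neg)
    finally show ?thesis .
  qed
  then show ?case using sum by blast
qed

theorem coefficients_acyclic:
  "relatively_acyclic (\<lambda>\<sigma>. S (chain_min \<sigma>)) below strictly_below"
  unfolding relatively_acyclic_def
proof (intro allI ballI impI)
  fix i f
  assume f: "f \<in> coefficients i" "\<forall>\<sigma>\<in>simplices K (i - 1) - strictly_below. bd i f \<sigma> = \<zero>\<^bsub>V\<^esub>"
  have "\<not> Suc (card (\<Union>K)) \<le> card (moved \<sigma>)" if "\<sigma> \<in> simplices K i" for \<sigma>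
  proof -
    have "moved \<sigma> \<subseteq> \<Union>K" using that unfolding moved_def simplices_def by blast
    then show ?thesis using card_mono[OF finite_vertices] by (simp add: not_less_eq_eq[symmetric])
  qed
  then show "\<exists>w\<in>coefficients (i + 1). \<forall>\<sigma>\<in>simplices K i - strictly_below. bd (i + 1) w \<sigma> = f \<sigma>"
    using f by (intro relative_cycle_bounds[where n = "Suc (card (\<Union>K))"]) auto
qed

end

section \<open>Homology of the members of a filtration\<close>

context oriented_complex
begin

lemma uniform_subquotient_cosheaf:
  "subquotient_cosheaf k V K ori (\<lambda>_. carrier V) (\<lambda>_. {\<zero>\<^bsub>V\<^esub>}) (uniform_cosheaf V) (\<lambda>_ x. x)"
  using subquotient_self[OF subspace_top]
  by (intro subquotient_cosheaf.intro oriented_complex_axioms subquotient_cosheaf_axioms.intro) simp_all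

context
  fixes L assumes L: "L \<in> subcomplexes K"
begin

abbreviation (input) "L_chains \<equiv> chains_on ori K (uniform_cosheaf V) L"

lemma chains_on_uniform_carrier: "carrier (chain_space L_chains i) = chains_in (\<lambda>_. carrier V) L i"
  by (auto simp: chains_on_def chain_module_def chains_in_def)

lemma uniform_complex:
  "subquotient_complex k V_chains bd (chains_in (\<lambda>_. carrier V) L) (chains_in (\<lambda>_. {\<zero>\<^bsub>V\<^esub>}) L) L_chains
     (\<lambda>i. subquotient_cosheaf.chain_map K (\<lambda>_ x. x) i)"
  by (rule subquotient_cosheaf.chains_on_subquotient[OF uniform_subquotient_cosheaf L])

lemma uniform_chain_map:
  assumes "f \<in> chains_in S L' i"
  shows "subquotient_cosheaf.chain_map K (\<lambda>_ x. x) i f = f"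
proof -
  have "f \<in> extensional (simplices K i)"
    using chains_inD(1)[OF assms] by (simp add: chains_carrier PiE_def)
  then show ?thesis
    unfolding subquotient_cosheaf.chain_map_def[OF uniform_subquotient_cosheaf]
    by (rule extensional_restrict)
qed

text \<open>For a subcomplex, numerator and denominator of the subquotient are the cycles and boundaries
themselves, as subspaces of the chains of \<open>K\<close>.\<close>

lemma cycles_subspace: "subspace k (cycles L_chains i) (V_chains i)"
  and boundaries_subspace: "subspace k (boundaries L_chains i) (V_chains i)"
  and boundaries_cycles: "boundaries L_chains i \<subseteq> cycles L_chains i"
  and homology_subquotient:
    "subquotient k (V_chains i) (cycles L_chains i) (boundaries L_chains i) (homology L_chains i)
      (\<lambda>x. boundaries L_chains i +>\<^bsub>V_chains i\<^esub> x)"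
proof -
  interpret C: subquotient_complex k V_chains bd "chains_in (\<lambda>_. carrier V) L"
    "chains_in (\<lambda>_. {\<zero>\<^bsub>V\<^esub>}) L" L_chains "\<lambda>i. subquotient_cosheaf.chain_map K (\<lambda>_ x. x) i"
    by (rule uniform_complex)
  have carrier: "x \<in> chains_in (\<lambda>_. carrier V) L i" if "x \<in> cycles L_chains i" for x
    using that unfolding cycles_def chains_on_uniform_carrier by blast
  have cyc: "{x \<in> chains_in (\<lambda>_. carrier V) L i. bd i x \<in> chains_in (\<lambda>_. {\<zero>\<^bsub>V\<^esub>}) L (i - 1)} = cycles L_chains i"
    using C.cycles_iff[of _ i] carrier by (auto simp: uniform_chain_map)
  have bdry: "{x \<in> chains_in (\<lambda>_. carrier V) L i. \<exists>u\<in>chains_in (\<lambda>_. carrier V) L (i + 1).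
      x \<ominus>\<^bsub>V_chains i\<^esub> bd (i + 1) u \<in> chains_in (\<lambda>_. {\<zero>\<^bsub>V\<^esub>}) L i} = boundaries L_chains i"
    using C.boundaries_iff[of _ i] C.boundaries_cycles[of i] carrier by (auto simp: uniform_chain_map)
  have coset: "boundaries L_chains i +>\<^bsub>(chain_space L_chains i)\<lparr>carrier := cycles L_chains i\<rparr>\<^esub> x =
      boundaries L_chains i +>\<^bsub>V_chains i\<^esub> x" for x
    by (simp add: a_r_coset_def' chains_on_def)
  note * = C.homology_subquotient[of i, unfolded cyc bdry coset]
  show "subquotient k (V_chains i) (cycles L_chains i) (boundaries L_chains i) (homology L_chains i)
      (\<lambda>x. boundaries L_chains i +>\<^bsub>V_chains i\<^esub> x)"
    by (rule subquotient_cong[OF *]) (simp add: uniform_chain_map[OF carrier])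
  show "subspace k (cycles L_chains i) (V_chains i)" "subspace k (boundaries L_chains i) (V_chains i)"
    using subquotient.subspace_Z[OF *] subquotient.subspace_N[OF *] by auto
  show "boundaries L_chains i \<subseteq> cycles L_chains i" by (rule C.boundaries_cycles)
qed

end

lemma cycles_mono: "L \<subseteq> L' \<Longrightarrow>
    cycles (chains_on ori K (uniform_cosheaf V) L) i \<subseteq> cycles (chains_on ori K (uniform_cosheaf V) L') i"
  and boundaries_mono: "L \<subseteq> L' \<Longrightarrow>
    boundaries (chains_on ori K (uniform_cosheaf V) L) i \<subseteq> boundaries (chains_on ori K (uniform_cosheaf V) L') i"
  unfolding cycles_def boundaries_def chains_on_def by auto

text \<open>The maps between the homology spaces of nested subcomplexes are induced by the identity on cycles,
so that one ambient space serves all members of a filtration.\<close>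

lemma homology_transition:
  assumes L: "L \<in> subcomplexes K" and L': "L' \<in> subcomplexes K" and sub: "L \<subseteq> L'"
    and x: "x \<in> cycles (chains_on ori K (uniform_cosheaf V) L) i"
  shows "induced_map (chain_space (chains_on ori K (uniform_cosheaf V) L') i)
      (boundaries (chains_on ori K (uniform_cosheaf V) L') i) (\<lambda>x. x)
      (boundaries (chains_on ori K (uniform_cosheaf V) L) i +>\<^bsub>V_chains i\<^esub> x)
    = boundaries (chains_on ori K (uniform_cosheaf V) L') i +>\<^bsub>V_chains i\<^esub> x"
proof -
  let ?C' = "chains_on ori K (uniform_cosheaf V) L'"
  have x': "x \<in> cycles ?C' i" using cycles_mono[OF sub] x by blast
  have "induced_map (V_chains i) (boundaries ?C' i) (\<lambda>x. x)
      (boundaries (chains_on ori K (uniform_cosheaf V) L) i +>\<^bsub>V_chains i\<^esub> x)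
    = boundaries ?C' i +>\<^bsub>V_chains i\<^esub> x"
    using boundaries_mono[OF sub, of i] subspaceD(2)[OF cycles_subspace[OF L']] x'
    by (intro induced_map_coset[OF boundaries_subspace[OF L] boundaries_subspace[OF L']]) auto
  then show ?thesis by (simp add: induced_map_def a_r_coset_def' chains_on_def)
qed

end

section \<open>Birth-death spaces and kernels\<close>

lemma vectorspace_self:
  assumes "field k"
  shows "vectorspace k (self_space k)"
proof -
  interpret field k by fact
  show ?thesis
    by (rule vs_criteria) (auto simp: self_space_def field_axioms a_ac m_assoc l_distr r_distr intro!: bexI[of _ "\<ominus>\<^bsub>k\<^esub> _"] r_neg)
qed

theorem theorem10:
  fixes k :: "('k, 'x) ring_scheme"
    and P :: "'p::order set"
    and K :: "'a set set"
    and F :: "'p \<Rightarrow> 'a set set"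
    and ori\<^sub>K :: "'a set \<Rightarrow> 'a rel"
    and ori\<^sub>\<Delta> :: "('p \<times> 'p extended) set \<Rightarrow> ('p \<times> 'p extended) rel"
    and \<rho> s :: int
    and b :: 'p
    and d :: "'p extended"
  assumes "field k"
    and "finite P"
    and "finite K" and "simplicial_complex K"
    and "orientation K ori\<^sub>K"
    and "orientation (order_complex (segments P)) ori\<^sub>\<Delta>"
    and "F \<in> P \<rightarrow> subcomplexes K" and "mono_on P F"
    and "0 \<le> \<rho>" and "0 \<le> s"
    and "(b, d) \<in> segments P" and "Fin b < d"
  shows "isomorphic_spaces k
    (moebius_homology ori\<^sub>\<Delta> (segments P) (birth_death_module k ori\<^sub>K K F \<rho>) s (b, d))
    (moebius_homology ori\<^sub>\<Delta> (segments P) (kernel_module (homology_module k ori\<^sub>K K F \<rho>)) s (b, d))"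
proof -
  let ?C = "\<lambda>p. simplicial_chains k ori\<^sub>K K (F p)"
  let ?M = "homology_module k ori\<^sub>K K F \<rho>" and ?R = "segments P"
  define U where "U = chain_module K (constant_cosheaf k) \<rho>"
  define Zc where "Zc p = cycles (?C p) \<rho>" for p
  define Bc where "Bc p = boundaries (?C p) \<rho>" for p
  \<comment> \<open>Since \<open>-\<infinity>\<close> is not the end of a segment, the default case is the one of \<open>\<infinity>\<close>.\<close>
  define ZB where "ZB r = (case snd r of Fin p' \<Rightarrow> Zc (fst r) \<inter> Bc p' | _ \<Rightarrow> Zc (fst r))" for r
  define \<phi> where "\<phi> p x = Bc p +>\<^bsub>U\<^esub> x" for p x
  interpret K: oriented_complex k "self_space k" K ori\<^sub>K
    by (rule oriented_complex.intro[OF vectorspace_self[OF assms(1)] assms(3-5)])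
  have F: "F p \<in> subcomplexes K" if "p \<in> P" for p using assms(7) that by blast
  have F_mono: "F p \<subseteq> F p'" if "p \<in> P" "p' \<in> P" "p \<le> p'" for p p'
    using assms(8) that by (auto simp: mono_on_def)
  note defs = U_def Zc_def Bc_def constant_cosheaf_uniform
  have Zc: "subspace k (Zc p) U" and Bc: "subspace k (Bc p) U" and Bc_Zc: "Bc p \<subseteq> Zc p"
    and H: "subquotient k U (Zc p) (Bc p) (homology (?C p) \<rho>) (\<phi> p)" if "p \<in> P" for p
    unfolding defs \<phi>_def using K.cycles_subspace[OF F[OF that]] K.boundaries_subspace[OF F[OF that]]
      K.boundaries_cycles[OF F[OF that]] K.homology_subquotient[OF F[OF that]] by auto
  have Zc_mono: "Zc p \<subseteq> Zc p'" and Bc_mono: "Bc p \<subseteq> Bc p'" if "p \<in> P" "p' \<in> P" "p \<le> p'" for p p'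
    unfolding defs using K.cycles_mono[OF F_mono[OF that]] K.boundaries_mono[OF F_mono[OF that]] by auto
  have transition: "transition ?M p p' (\<phi> p x) = \<phi> p' x"
    if "p \<in> P" "p' \<in> P" "p \<le> p'" "x \<in> Zc p" for p p' x
    using K.homology_transition[OF F[OF that(1)] F[OF that(2)] F_mono[OF that(1-3)]] that(4)
    by (simp add: defs \<phi>_def homology_module_def)
  have segE: "fst r \<in> P \<and> (snd r = \<infinity> \<or> (\<exists>p'\<in>P. snd r = Fin p' \<and> fst r \<le> p'))" if "r \<in> ?R" for r
    using that by (auto simp: segments_def)
  have ZB: "subspace k (ZB r) U" "Bc (fst r) \<subseteq> ZB r" "ZB r \<subseteq> Zc (fst r)" if "r \<in> ?R" for r
    using segE[OF that] Zc Bc Bc_Zc[THEN subsetD] Bc_mono[THEN subsetD]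
    by (auto simp: ZB_def subspace_Int)
  have ZB_mono: "ZB r \<subseteq> ZB r'" if "r \<in> ?R" "r' \<in> ?R" "r \<le> r'" for r r'
    using segE[OF that(1)] segE[OF that(2)] that(3) Zc_mono[of "fst r" "fst r'"] Bc_mono
    by (fastforce simp: ZB_def less_eq_prod_def)
  have kernel: "subquotient k U (ZB r) (Bc (fst r)) (space (kernel_module ?M) r) (\<phi> (fst r))"
    if r: "r \<in> ?R" for r
  proof -
    obtain p y where py: "r = (p, y)" by (cases r)
    have p: "p \<in> P" using segE[OF r] py by simp
    interpret H: subquotient k U "Zc p" "Bc p" "homology (?C p) \<rho>" "\<phi> p" by (rule H[OF p])
    show ?thesis
    proof (cases "y = \<infinity>")
      case True
      then show ?thesis
        using H.subquotient_axioms py by (simp add: ZB_def kernel_module_def homology_module_def)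
    next
      case False
      then obtain p' where p': "p' \<in> P" "y = Fin p'" "p \<le> p'" using segE[OF r] py by auto
      interpret H': subquotient k U "Zc p'" "Bc p'" "homology (?C p') \<rho>" "\<phi> p'" by (rule H[OF p'(1)])
      have "{x \<in> carrier (homology (?C p) \<rho>). transition ?M p p' x = \<zero>\<^bsub>homology (?C p') \<rho>\<^esub>}
          = \<phi> p ` (Zc p \<inter> Bc p')"
        unfolding H.image[symmetric]
        using transition[OF p p'(1,3)] H'.zero_iff Zc_mono[OF p p'(1,3)] by (auto simp: subset_iff)
      moreover have "subquotient k U (ZB r) (Bc p)
          ((homology (?C p) \<rho>)\<lparr>carrier := \<phi> p ` ZB r\<rparr>) (\<phi> p)"
        using ZB[OF r] py by (intro H.subquotient_restrict) auto
      ultimately show ?thesis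
        using py p' by (simp add: ZB_def kernel_module_def homology_module_def)
    qed
  qed
  have min: "chain_min \<sigma> \<in> ?R" if "\<sigma> \<in> order_complex ?R" for \<sigma>
    using chain_min(1)[OF that] order_complexD(1)[OF that] by blast
  have min_le: "chain_min \<tau> \<le> chain_min \<sigma>"
    if "\<tau> \<in> order_complex ?R" "\<sigma> \<in> order_complex ?R" "\<sigma> \<subseteq> \<tau>" for \<sigma> \<tau>
    using chain_min(2)[OF that(1)] chain_min(1)[OF that(2)] that(3) by blast
  have "finite ?R"
  proof (rule finite_subset)
    show "?R \<subseteq> P \<times> (insert \<infinity> (Fin ` P))" by (auto simp: segments_def)
  qed (use assms(2) in auto)
  then interpret R: oriented_complex k U "order_complex ?R" ori\<^sub>\<Delta>
    using assms(6) K.vectorspace_chains[of \<rho>]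
    by (intro oriented_complex.intro)
      (simp_all add: defs finite_order_complex simplicial_order_complex)
  have A: "subquotient_cosheaf k U (order_complex ?R) ori\<^sub>\<Delta> (\<lambda>\<sigma>. ZB (chain_min \<sigma>)) (\<lambda>_. {\<zero>\<^bsub>U\<^esub>})
      (order_cosheaf (birth_death_module k ori\<^sub>K K F \<rho>)) (\<lambda>_ x. x)"
  proof (intro subquotient_cosheaf.intro R.oriented_complex_axioms subquotient_cosheaf_axioms.intro)
    fix \<sigma> assume \<sigma>: "\<sigma> \<in> order_complex ?R"
    have "space (birth_death_module k ori\<^sub>K K F \<rho>) r = U\<lparr>carrier := ZB r\<rparr>" for r
      by (cases r; cases "snd r") (simp_all add: birth_death_module_def ZB_def U_def Zc_def Bc_def)
    then show "subquotient k U (ZB (chain_min \<sigma>)) {\<zero>\<^bsub>U\<^esub>}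
        (stalk (order_cosheaf (birth_death_module k ori\<^sub>K K F \<rho>)) \<sigma>) (\<lambda>x. x)"
      using subquotient_self[OF ZB(1)[OF min[OF \<sigma>]]] by (simp add: order_cosheaf_def)
  next
    fix \<sigma> \<tau> assume "\<tau> \<in> order_complex ?R" "\<sigma> \<in> order_complex ?R" "\<sigma> \<subseteq> \<tau>"
    then show "ZB (chain_min \<tau>) \<subseteq> ZB (chain_min \<sigma>)" by (intro ZB_mono min min_le)
  qed (simp add: order_cosheaf_def birth_death_module_def)
  have A': "subquotient_cosheaf k U (order_complex ?R) ori\<^sub>\<Delta> (\<lambda>\<sigma>. ZB (chain_min \<sigma>))
      (\<lambda>\<sigma>. Bc (fst (chain_min \<sigma>))) (order_cosheaf (kernel_module ?M)) (\<lambda>\<sigma>. \<phi> (fst (chain_min \<sigma>)))"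
  proof (intro subquotient_cosheaf.intro R.oriented_complex_axioms subquotient_cosheaf_axioms.intro)
    fix \<sigma> assume "\<sigma> \<in> order_complex ?R"
    then show "subquotient k U (ZB (chain_min \<sigma>)) (Bc (fst (chain_min \<sigma>)))
        (stalk (order_cosheaf (kernel_module ?M)) \<sigma>) (\<phi> (fst (chain_min \<sigma>)))"
      using kernel[OF min] by (simp add: order_cosheaf_def)
  next
    fix \<sigma> \<tau> assume *: "\<tau> \<in> order_complex ?R" "\<sigma> \<in> order_complex ?R" "\<sigma> \<subseteq> \<tau>"
    then show "ZB (chain_min \<tau>) \<subseteq> ZB (chain_min \<sigma>)" by (intro ZB_mono min min_le)
    fix x assume "x \<in> ZB (chain_min \<tau>)"
    then have "x \<in> Zc (fst (chain_min \<tau>))" using ZB(3)[OF min[OF *(1)]] by blast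
    moreover have "fst (chain_min \<tau>) \<le> fst (chain_min \<sigma>)"
      using min_le[OF *] by (simp add: less_eq_prod_def)
    ultimately have "transition ?M (fst (chain_min \<tau>)) (fst (chain_min \<sigma>)) (\<phi> (fst (chain_min \<tau>)) x)
        = \<phi> (fst (chain_min \<sigma>)) x"
      using segE[OF min[OF *(1)]] segE[OF min[OF *(2)]] by (intro transition) auto
    then show "extension (order_cosheaf (kernel_module ?M)) \<tau> \<sigma> (\<phi> (fst (chain_min \<tau>)) x)
        = \<phi> (fst (chain_min \<sigma>)) x"
      by (simp add: order_cosheaf_def kernel_module_def case_prod_beta)
  qed
  \<comment> \<open>The boundaries of \<open>F p\<close> form the same subspace for all segments that start at \<open>p\<close>.\<close>
  interpret L: order_complex_retraction k U ?R ori\<^sub>\<Delta> "(b, d)" "\<lambda>r. (fst r, Fin (fst r))" "\<lambda>r. Bc (fst r)"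
  proof (intro order_complex_retraction.intro R.oriented_complex_axioms order_complex_retraction_axioms.intro)
    fix a assume a: "a \<in> ?R"
    show "(fst a, Fin (fst a)) \<in> ?R" using segE[OF a] by (simp add: segments_def)
    show "(fst a, Fin (fst a)) \<le> a" using segE[OF a] by (auto simp: less_eq_prod_def)
    show "subspace k (Bc (fst a)) U" using segE[OF a] Bc by blast
    fix a' assume "a' \<in> ?R" "a \<le> a'"
    then show "Bc (fst a) \<subseteq> Bc (fst a')"
      using segE[OF a] segE[of a'] by (intro Bc_mono) (auto simp: less_eq_prod_def)
  qed (use assms(12) in \<open>auto simp: less_eq_prod_def\<close>)
  show ?thesis
    unfolding moebius_homology_def
    by (rule R.relative_homology_isomorphic[OF A A' chains_below_subcomplex _ L.coefficients_acyclic]) auto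
qed

end
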